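(* Let $k\ge 2$ be an even integer and let $r$ be an even integer. For every $x>0$, \begin{align*} \sum_{n=1}^{\infty} D_{k,r}(n) e^{-nx}=&-\frac{1}{2}\zeta(-r)+\frac{1}{k}\Gamma\left(\frac{1}{k}\right)\zeta\left(\frac{1}{k}-r\right)x^{- \frac{1}{k}}+R_{1+r}+\frac{(-1)^{\frac{k+r-2}{2}} (2\pi)^{\frac{k+1-2r}{2}}}{x\, k^{\frac{2k-1}{2}}}\\ &\times \sum_{\substack{j=-(k-1)\\ j\equiv k-1 \ (\mathrm{mod}\ 2)}}^{k-1} \sum_{n=1}^{\infty} S_{k,r}(n)\; G_{0,k}^{\,k,0} \!\left( \,\begin{matrix}-\\ r,-\frac{1}{k},\dots ,-\frac{k-1}{k} \end{matrix} \; \Big| X(j) \right), \end{align*} where $X(j)=\dfrac{e^{-\frac{i\pi j}{2}} (2\pi)^{k+1}n}{k^{k} x}$ and $$R_{1+r}=\begin{cases} r!\,\zeta(k(1+r))\,x^{-(1+r)}, & r\ge 0,\\[2pt] \dfrac{(-1)^{1+r}}{(-(1+r))!}\,k\,\zeta'(k(1+r))\,x^{-(1+r)}, & r<0.\end{cases}$$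
   Context: $\zeta$ is the Riemann zeta function and $\Gamma$ the gamma function. For $k\in\mathbb{N}$, $r\in\mathbb{Z}$ define the divisor functions $D_{k,r}(n)=\sum_{d\ge1,\ d^k\mid n}\left(\frac{n}{d^k}\right)^r$ and $S_{k,r}(n)=\sum_{d\ge1,\ d^k\mid n}\left(\frac{n}{d^k}\right)^{-r}d^{k-1}$. The sum over $j$ runs over $j=-(k-1),-(k-3),\dots,k-3,k-1$. For complex $b_1,\dots,b_k$ the Meijer $G$-function is $G_{0,k}^{\,k,0}\!\left(\begin{matrix}-\\ b_1,\dots,b_k\end{matrix}\Big| z\right)=\frac{1}{2\pi i}\int_L \prod_{j=1}^k\Gamma(b_j+s)\,z^{-s}\,ds$, where $L$ is a vertical line (from $-i\infty$ to $+i\infty$) lying to the right of all poles of the integrand, and $z^{-s}$ uses the principal branch; it converges for $|\arg z|<k\pi/2$.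
   Formalization: In the Meijer G-function, z^{-s} at z = X(j) is taken with arg z = -πj/2 not reduced modulo 2π, instead of the principal branch; the two agree for k = 2, and for k ≥ 4 the identity with the principal branch is false. *)

theory Defs
  imports "HOL-Complex_Analysis.Complex_Analysis"
begin

text \<open>
  The Riemann zeta function as the analytic continuation of its Dirichlet series. Since
  \<open>UNIV - {1}\<close> is connected, the choice is unique away from \<open>1\<close>; the value at \<open>1\<close> is unspecified.
\<close>
definition zeta :: "complex \<Rightarrow> complex" where
  "zeta = (SOME f. f holomorphic_on (UNIV - {1}) \<and>
             (\<forall>s. Re s > 1 \<longrightarrow> f s = (\<Sum>n. of_nat (Suc n) powr (-s))))"

definition divisor_D :: "nat \<Rightarrow> int \<Rightarrow> nat \<Rightarrow> real" where
  "divisor_D k r n = (\<Sum>d | d \<ge> 1 \<and> d ^ k dvd n. (real n / real (d ^ k)) powi r)"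

definition divisor_S :: "nat \<Rightarrow> int \<Rightarrow> nat \<Rightarrow> real" where
  "divisor_S k r n = (\<Sum>d | d \<ge> 1 \<and> d ^ k dvd n. (real n / real (d ^ k)) powi (-r) * real (d ^ (k - 1)))"

text \<open>
  The abscissa of some vertical line to the right of all the poles \<open>-b - m\<close> of
  \<open>\<Prod>\<^sub>b \<Gamma>(b + s)\<close>, where \<open>b\<close> ranges over the list and \<open>m\<close> over the naturals.
\<close>
definition line_abscissa :: "complex list \<Rightarrow> real" where
  "line_abscissa bs = (SOME c. \<forall>b\<in>set bs. \<forall>m::nat. Re (- b - of_nat m) < c)"

text \<open>
  \<open>meijer_G bs \<rho> \<theta>\<close> is the Meijer function with upper indices \<open>k, 0\<close>, lower indices \<open>0, k\<close> and
  \<open>k = length bs\<close>, at the point \<open>\<rho> e\<^sup>i\<^sup>\<theta>\<close> with \<open>\<rho> > 0\<close>. The argument \<open>\<theta>\<close> is part of the data, i.e.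
  \<open>z\<^sup>-\<^sup>s\<close> means \<open>exp (- s (ln \<rho> + i \<theta>))\<close>: the domain of convergence \<open>\<bar>\<theta>\<bar> < k \<pi> / 2\<close> exceeds the
  range \<open>(-\<pi>, \<pi>]\<close> of the principal argument as soon as \<open>k > 2\<close>, and there the value depends
  on \<open>\<theta>\<close> itself and not just on \<open>\<theta>\<close> modulo \<open>2 \<pi>\<close>. The line \<open>s = c + i t\<close>
  is parametrised by \<open>t\<close>, whence the factor \<open>\<i>\<close> coming from \<open>ds = i dt\<close>.
\<close>
definition meijer_G :: "complex list \<Rightarrow> real \<Rightarrow> real \<Rightarrow> complex" where
  "meijer_G bs \<rho> \<theta> = 1 / (2 * of_real pi * \<i>) *
     (LINT t|lborel. (let s = Complex (line_abscissa bs) t in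
        (\<Prod>b\<leftarrow>bs. Gamma (b + s)) * exp (- s * (of_real (ln \<rho>) + \<i> * of_real \<theta>)) * \<i>))"

text \<open>For arguments in \<open>(-\<pi>, \<pi>]\<close> the power in \<open>meijer_G\<close> is the principal one.\<close>
lemma polar_power_principal:
  assumes "\<rho> > 0" "-pi < \<theta>" "\<theta> \<le> pi"
  shows "exp (- s * (of_real (ln \<rho>) + \<i> * of_real \<theta>)) = (of_real \<rho> * exp (\<i> * of_real \<theta>)) powr (- s)"
proof -
  have "of_real \<rho> * exp (\<i> * of_real \<theta>) = exp (of_real (ln \<rho>) + \<i> * of_real \<theta> :: complex)"
    using assms(1) by (simp add: exp_add exp_of_real)
  moreover have "Ln (exp (of_real (ln \<rho>) + \<i> * of_real \<theta>)) = of_real (ln \<rho>) + \<i> * of_real \<theta>"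
    using assms by (intro Ln_exp) auto
  ultimately show ?thesis by (simp add: powr_def)
qed

text \<open>
  The residue of \<open>\<Gamma>(s) \<zeta>(k s) \<zeta>(s - r) x\<^sup>-\<^sup>s\<close> at \<open>s = 1 + r\<close>; for negative \<open>r\<close> the double pole is
  reduced to a simple one by the trivial zero of \<open>\<zeta>(k s)\<close>.
\<close>
definition residue_term :: "nat \<Rightarrow> int \<Rightarrow> real \<Rightarrow> complex" where
  "residue_term k r x =
     (if r \<ge> 0
      then fact (nat r) * zeta (of_int (int k * (1 + r))) * of_real (x powi (-(1 + r)))
      else (-1) powi (1 + r) / fact (nat (-(1 + r))) * of_nat k
             * deriv zeta (of_int (int k * (1 + r))) * of_real (x powi (-(1 + r))))"

definition G_params :: "nat \<Rightarrow> int \<Rightarrow> complex list" where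
  "G_params k r = of_int r # map (\<lambda>m. - (of_nat m / of_nat k)) [1..<k]"

definition j_indices :: "nat \<Rightarrow> int set" where
  "j_indices k = {j. - (int k - 1) \<le> j \<and> j \<le> int k - 1 \<and> j mod 2 = (int k - 1) mod 2}"

text \<open>
  Modulus and argument of \<open>X(j) = exp (- i \<pi> j / 2) (2 \<pi>)\<^sup>k\<^sup>+\<^sup>1 n / (k\<^sup>k x)\<close>. The argument \<open>- \<pi> j / 2\<close> satisfies
  \<open>\<bar>- \<pi> j / 2\<bar> \<le> (k - 1) \<pi> / 2 < k \<pi> / 2\<close> and must not be reduced modulo \<open>2 \<pi>\<close>.
\<close>
definition X_modulus :: "nat \<Rightarrow> real \<Rightarrow> nat \<Rightarrow> real" where
  "X_modulus k x n = (2 * pi) ^ (k + 1) * real n / (real k ^ k * x)"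

definition X_arg :: "int \<Rightarrow> real" where
  "X_arg j = - (pi * of_int j / 2)"

end

theory Submission
  imports Defs
begin

text \<open>
  By the Cahen--Mellin integral the series is the integral of
  \<open>\<Gamma>(s) \<zeta>(k s) \<zeta>(s - r) x\<^sup>-\<^sup>s / (2 \<pi> i)\<close> along a vertical line far to the right. Moving the line to
  \<open>Re s < min 0 r\<close> picks up the residues at \<open>0\<close>, \<open>1/k\<close> and \<open>1 + r\<close>; the other poles of \<open>\<Gamma>\<close> are
  cancelled by the trivial zeros of \<open>\<zeta>(k s)\<close>, as \<open>k\<close> is even. On the new line the functional equation of
  both zeta factors, the reflection and multiplication formulas of \<open>\<Gamma>\<close> and the Dirichlet kernel
  \<open>sin (k u) / sin u = \<Sum>\<^sub>j e\<^sup>i\<^sup>j\<^sup>u\<close> with \<open>u = \<pi> (1 - s) / 2\<close> turn the integrand into the Mellin--Barnes integrands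
  of the Meijer functions, and expanding \<open>\<zeta>(w + r) \<zeta>(k w - k + 1)\<close>, \<open>w = 1 - s\<close>, into its Dirichlet
  series gives the double sum.
\<close>

section \<open>Integrals along vertical lines\<close>

text \<open>All estimates are kept at the level of exponential rates in |Im s|: in every vertical
  strip \<open>Gamma\<close> has each rate above -pi/2, \<open>zeta\<close> each rate above 0, and
  exp(-s (l + i theta)) the rate |theta|. Rates of factors add, so contour shifts and interchanges
  reduce to checking that a sum of rates is negative. Evenness of k makes sin(pi k s / 2) a signed
  sin(k u), and evenness of r makes sin(pi (s - r) / 2) a signed sin(pi s / 2). The latter meets
  Gamma(s) and leaves a multiple of 1 / (sin u Gamma(1 - s)). The Dirichlet kernel removes sin u,
  and Gamma(1 - s) is the one factor of the multiplication formula that does not belong to the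
  Meijer function, so it cancels as well. Each exponential of the kernel becomes an argument -pi j /
  2 of X(j); as |j| is at most k - 1, the k Gamma factors, with total rate near -k pi / 2, still win
  by about pi / 2.\<close>

text \<open>The points with \<open>\<bar>Im s\<bar> < 1\<close> are left out so that poles on the real axis do not matter.\<close>
definition strip :: "real \<Rightarrow> real \<Rightarrow> complex set" where
  "strip a b = {s. a \<le> Re s \<and> Re s \<le> b \<and> 1 \<le> \<bar>Im s\<bar>}"

text \<open>Only the exponential rate matters for moving contours. The constant is existential so
  that rates can simply be added, and a polynomial factor is absorbed by an arbitrarily small
  positive rate.\<close>

definition strip_growth :: "(complex \<Rightarrow> complex) \<Rightarrow> real \<Rightarrow> real \<Rightarrow> real \<Rightarrow> bool" where
  "strip_growth f a b \<kappa> \<longleftrightarrow> (\<exists>C. \<forall>s\<in>strip a b. norm (f s) \<le> C * exp (\<kappa> * \<bar>Im s\<bar>))"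

text \<open>The measure is dt and not ds = i dt; hence the factor 2 pi instead of 2 pi i in all
  residue formulas for these integrals.\<close>

definition line_integral :: "(complex \<Rightarrow> complex) \<Rightarrow> real \<Rightarrow> complex" where
  "line_integral f c = (LINT t|lborel. f (Complex c t))"

lemma strip_growthI:
  assumes "\<And>s. a \<le> Re s \<Longrightarrow> Re s \<le> b \<Longrightarrow> 1 \<le> \<bar>Im s\<bar> \<Longrightarrow> norm (f s) \<le> C * exp (\<kappa> * \<bar>Im s\<bar>)"
  shows "strip_growth f a b \<kappa>"
  using assms unfolding strip_growth_def strip_def by blast

lemma strip_growthE:
  assumes "strip_growth f a b \<kappa>"
  obtains C where "C > 0" "\<And>s. s \<in> strip a b \<Longrightarrow> norm (f s) \<le> C * exp (\<kappa> * \<bar>Im s\<bar>)"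
proof -
  from assms obtain C where C: "\<And>s. s \<in> strip a b \<Longrightarrow> norm (f s) \<le> C * exp (\<kappa> * \<bar>Im s\<bar>)"
    unfolding strip_growth_def by blast
  have "C * exp (\<kappa> * \<bar>Im s\<bar>) \<le> (\<bar>C\<bar> + 1) * exp (\<kappa> * \<bar>Im s\<bar>)" for s
    by (intro mult_right_mono) auto
  hence "norm (f s) \<le> (\<bar>C\<bar> + 1) * exp (\<kappa> * \<bar>Im s\<bar>)" if "s \<in> strip a b" for s
    using C[OF that] order_trans by blast
  thus ?thesis by (intro that[of "\<bar>C\<bar> + 1"]) auto
qed

lemma strip_growth_cong:
  assumes "strip_growth f a b \<kappa>"
    "\<And>s. a \<le> Re s \<Longrightarrow> Re s \<le> b \<Longrightarrow> 1 \<le> \<bar>Im s\<bar> \<Longrightarrow> norm (g s) \<le> norm (f s)"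
  shows "strip_growth g a b \<kappa>"
  using assms unfolding strip_growth_def strip_def mem_Collect_eq Ball_def by (meson order_trans)

lemma strip_growth_subset:
  assumes "strip_growth f a b \<kappa>" "a \<le> a'" "b' \<le> b"
  shows "strip_growth f a' b' \<kappa>"
proof -
  have "strip a' b' \<subseteq> strip a b" using assms(2,3) by (auto simp: strip_def)
  thus ?thesis using assms(1) unfolding strip_growth_def by blast
qed

lemma strip_growth_mult:
  assumes "strip_growth f a b \<kappa>" "strip_growth g a b \<kappa>'"
  shows "strip_growth (\<lambda>s. f s * g s) a b (\<kappa> + \<kappa>')"
proof -
  obtain C where C: "C > 0" "\<And>s. s \<in> strip a b \<Longrightarrow> norm (f s) \<le> C * exp (\<kappa> * \<bar>Im s\<bar>)"
    using strip_growthE[OF assms(1)] by metis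
  obtain D where D: "D > 0" "\<And>s. s \<in> strip a b \<Longrightarrow> norm (g s) \<le> D * exp (\<kappa>' * \<bar>Im s\<bar>)"
    using strip_growthE[OF assms(2)] by metis
  have "norm (f s * g s) \<le> (C * D) * exp ((\<kappa> + \<kappa>') * \<bar>Im s\<bar>)" if "s \<in> strip a b" for s
  proof -
    have "norm (f s * g s) \<le> (C * exp (\<kappa> * \<bar>Im s\<bar>)) * (D * exp (\<kappa>' * \<bar>Im s\<bar>))"
      unfolding norm_mult using C D that by (intro mult_mono) auto
    thus ?thesis by (simp add: exp_add algebra_simps)
  qed
  thus ?thesis unfolding strip_growth_def by blast
qed

lemma strip_growth_add:
  assumes "strip_growth f a b \<kappa>" "strip_growth g a b \<kappa>"
  shows "strip_growth (\<lambda>s. f s + g s) a b \<kappa>"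
proof -
  obtain C where C: "C > 0" "\<And>s. s \<in> strip a b \<Longrightarrow> norm (f s) \<le> C * exp (\<kappa> * \<bar>Im s\<bar>)"
    using strip_growthE[OF assms(1)] by metis
  obtain D where D: "D > 0" "\<And>s. s \<in> strip a b \<Longrightarrow> norm (g s) \<le> D * exp (\<kappa> * \<bar>Im s\<bar>)"
    using strip_growthE[OF assms(2)] by metis
  have "norm (f s + g s) \<le> (C + D) * exp (\<kappa> * \<bar>Im s\<bar>)" if "s \<in> strip a b" for s
    using C(2)[OF that] D(2)[OF that] norm_triangle_ineq[of "f s" "g s"] by (simp add: algebra_simps)
  thus ?thesis unfolding strip_growth_def by blast
qed

lemma strip_growth_const: "0 \<le> \<kappa> \<Longrightarrow> strip_growth (\<lambda>_. c) a b \<kappa>"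
  by (rule strip_growthI[where C = "norm c"]) (simp add: mult_le_cancel_left1)

lemma strip_growth_ident:
  assumes "0 < \<kappa>"
  shows "strip_growth (\<lambda>s. s) a b \<kappa>"
proof (rule strip_growthI[where C = "\<bar>a\<bar> + \<bar>b\<bar> + 1 / \<kappa>"])
  fix s :: complex assume s: "a \<le> Re s" "Re s \<le> b"
  have 1: "norm s \<le> \<bar>Re s\<bar> + \<bar>Im s\<bar>" by (rule cmod_le)
  have "\<bar>Re s\<bar> \<le> (\<bar>a\<bar> + \<bar>b\<bar>) * 1" using s by auto
  also have "\<dots> \<le> (\<bar>a\<bar> + \<bar>b\<bar>) * exp (\<kappa> * \<bar>Im s\<bar>)" using assms by (intro mult_left_mono) auto
  finally have 2: "\<bar>Re s\<bar> \<le> (\<bar>a\<bar> + \<bar>b\<bar>) * exp (\<kappa> * \<bar>Im s\<bar>)" .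
  have "\<kappa> * \<bar>Im s\<bar> \<le> exp (\<kappa> * \<bar>Im s\<bar>)" using exp_ge_add_one_self[of "\<kappa> * \<bar>Im s\<bar>"] by linarith
  hence 3: "\<bar>Im s\<bar> \<le> 1 / \<kappa> * exp (\<kappa> * \<bar>Im s\<bar>)" using assms by (simp add: field_simps)
  have "norm s \<le> (\<bar>a\<bar> + \<bar>b\<bar>) * exp (\<kappa> * \<bar>Im s\<bar>) + 1 / \<kappa> * exp (\<kappa> * \<bar>Im s\<bar>)"
    using 1 2 3 by linarith
  thus "norm s \<le> (\<bar>a\<bar> + \<bar>b\<bar> + 1 / \<kappa>) * exp (\<kappa> * \<bar>Im s\<bar>)" by (simp only: distrib_right)
qed

text \<open>The scaling multiplies Im s, and with it the rate, by m; the condition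
  \<open>m \<ge> 1\<close> makes sure that points with |Im s| >= 1 are sent to such points. This
  serves factors like zeta(k s).\<close>

lemma strip_growth_affine:
  assumes "strip_growth f (m * a + c) (m * b + c) \<kappa>" "m \<ge> 1"
  shows "strip_growth (\<lambda>s. f (of_real m * s + of_real c)) a b (m * \<kappa>)"
proof -
  obtain C where C: "\<And>s. s \<in> strip (m * a + c) (m * b + c) \<Longrightarrow> norm (f s) \<le> C * exp (\<kappa> * \<bar>Im s\<bar>)"
    using strip_growthE[OF assms(1)] by metis
  show ?thesis
  proof (rule strip_growthI[where C = C])
    fix s :: complex assume s: "a \<le> Re s" "Re s \<le> b" "1 \<le> \<bar>Im s\<bar>"
    have "1 * 1 \<le> m * \<bar>Im s\<bar>" using s assms(2) by (intro mult_mono) auto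
    hence "of_real m * s + of_real c \<in> strip (m * a + c) (m * b + c)"
      using s assms(2) by (auto simp: strip_def abs_mult)
    from C[OF this] show "norm (f (of_real m * s + of_real c)) \<le> C * exp (m * \<kappa> * \<bar>Im s\<bar>)"
      using assms(2) by (simp add: abs_mult mult_ac)
  qed
qed

lemma strip_growth_shift:
  assumes "strip_growth f (a + c) (b + c) \<kappa>"
  shows "strip_growth (\<lambda>s. f (s + of_real c)) a b \<kappa>"
  using strip_growth_affine[of f 1 a c b \<kappa>] assms by simp

lemma strip_growth_prod_list:
  assumes "\<And>x. x \<in> set xs \<Longrightarrow> strip_growth (f x) a b \<kappa>"
  shows "strip_growth (\<lambda>s. \<Prod>x\<leftarrow>xs. f x s) a b (real (length xs) * \<kappa>)"
  using assms
proof (induction xs)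
  case Nil
  thus ?case by (simp add: strip_growth_const)
next
  case (Cons x xs)
  have "strip_growth (\<lambda>s. f x s * (\<Prod>x\<leftarrow>xs. f x s)) a b (\<kappa> + real (length xs) * \<kappa>)"
    by (rule strip_growth_mult) (use Cons in auto)
  thus ?case by (simp add: algebra_simps)
qed

text \<open>For s = sigma + i t the modulus is exp(-sigma l + t theta). As sigma is bounded,
  \<open>l\<close> enters only the constant, while the argument \<open>\<theta>\<close> determines
  the rate.\<close>

lemma strip_growth_exp:
  "strip_growth (\<lambda>s. exp (- s * (of_real l + \<i> * of_real \<theta>))) a b \<bar>\<theta>\<bar>"
proof (rule strip_growthI[where C = "exp ((\<bar>a\<bar> + \<bar>b\<bar>) * \<bar>l\<bar>)"])
  fix s :: complex assume s: "a \<le> Re s" "Re s \<le> b" "1 \<le> \<bar>Im s\<bar>"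
  have "- (Re s * l) \<le> \<bar>Re s\<bar> * \<bar>l\<bar>" by (metis abs_ge_minus_self abs_mult)
  also have "\<dots> \<le> (\<bar>a\<bar> + \<bar>b\<bar>) * \<bar>l\<bar>" using s by (intro mult_right_mono) auto
  finally have 1: "- (Re s * l) \<le> (\<bar>a\<bar> + \<bar>b\<bar>) * \<bar>l\<bar>" .
  have 2: "Im s * \<theta> \<le> \<bar>\<theta>\<bar> * \<bar>Im s\<bar>" by (metis abs_ge_self abs_mult mult.commute)
  from 1 2 show "norm (exp (- s * (of_real l + \<i> * of_real \<theta>))) \<le> exp ((\<bar>a\<bar> + \<bar>b\<bar>) * \<bar>l\<bar>) * exp (\<bar>\<theta>\<bar> * \<bar>Im s\<bar>)"
    by (simp add: norm_exp_eq_Re flip: exp_add)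
qed

lemma integrable_exp_neg_abs:
  assumes "\<kappa> < (0 :: real)"
  shows "integrable lborel (\<lambda>t::real. exp (\<kappa> * \<bar>t\<bar>))"
proof -
  have "(\<lambda>t. exp (- (-\<kappa>) * t)) absolutely_integrable_on {0..}"
    using has_integral_exp_minus_to_infinity[of "-\<kappa>" 0] assms
    by (intro nonnegative_absolutely_integrable_1) (auto simp: integrable_on_def)
  hence 1: "integrable lborel (\<lambda>t. indicator {0..} t *\<^sub>R exp (\<kappa> * t))"
    unfolding set_integrable_def by (subst (asm) integrable_completion) auto
  have 2: "integrable lborel (\<lambda>t. indicator {0..} (-t) *\<^sub>R exp (\<kappa> * (-t)))"
    using lborel_integrable_real_affine[OF 1, of "-1" 0] by simp
  show ?thesis
    by (rule Bochner_Integration.integrable_bound[OF Bochner_Integration.integrable_add[OF 1 2]])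
       (auto simp: indicator_def)
qed

lemma integrable_line:
  assumes "continuous_on {s. Re s = c} f" "strip_growth f c c \<kappa>" "\<kappa> < 0"
  shows "integrable lborel (\<lambda>t. f (Complex c t))"
proof -
  have Complex: "continuous_on A (\<lambda>t. Complex c t)" for A
    unfolding Complex_eq by (intro continuous_intros)
  have cont: "continuous_on UNIV (\<lambda>t. f (Complex c t))"
    by (rule continuous_on_compose2[OF assms(1) Complex]) auto
  obtain C where C: "C > 0"
    "\<And>s. s \<in> strip c c \<Longrightarrow> norm (f s) \<le> C * exp (\<kappa> * \<bar>Im s\<bar>)"
    using strip_growthE[OF assms(2)] by metis
  have "compact ((\<lambda>t. f (Complex c t)) ` {-1..1})"
    by (intro compact_continuous_image continuous_on_subset[OF cont]) auto
  then obtain M where M: "\<And>t. t \<in> {-1..1} \<Longrightarrow> norm (f (Complex c t)) \<le> M"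
    using compact_imp_bounded bounded_iff by (metis (no_types, lifting) imageI)
  have "norm (f (Complex c 0)) \<le> M" by (rule M) auto
  hence "M \<ge> 0" using norm_ge_zero order_trans by blast
  show ?thesis
  proof (rule Bochner_Integration.integrable_bound)
    \<comment> \<open>On |t| <= 1 only the compactness bound \<open>M\<close> is at hand; the factor
      \<open>exp (-\<kappa>)\<close> offsets the smallest value exp(kappa) of the majorant
      there.\<close>
    show "integrable lborel (\<lambda>t. (C + M * exp (-\<kappa>)) * exp (\<kappa> * \<bar>t\<bar>))"
      using integrable_exp_neg_abs[OF assms(3)] by auto
    show "(\<lambda>t. f (Complex c t)) \<in> borel_measurable lborel"
      using borel_measurable_continuous_onI[OF cont] by simp
    have "norm (f (Complex c t)) \<le> norm ((C + M * exp (-\<kappa>)) * exp (\<kappa> * \<bar>t\<bar>))" for t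
    proof (cases "1 \<le> \<bar>t\<bar>")
      case True
      have "norm (f (Complex c t)) \<le> C * exp (\<kappa> * \<bar>t\<bar>)" using C(2)[of "Complex c t"] True by (simp add: strip_def)
      also have "\<dots> \<le> (C + M * exp (-\<kappa>)) * exp (\<kappa> * \<bar>t\<bar>)" using \<open>M \<ge> 0\<close> by (intro mult_right_mono) auto
      also have "\<dots> = norm \<dots>" using \<open>M \<ge> 0\<close> C(1) by (simp add: abs_mult)
      finally show ?thesis .
    next
      case False
      have "norm (f (Complex c t)) \<le> M" using False by (intro M) auto
      also have "\<dots> = M * exp (-\<kappa>) * exp (\<kappa> * 1)" by (simp add: flip: exp_add)
      also have "\<dots> \<le> M * exp (-\<kappa>) * exp (\<kappa> * \<bar>t\<bar>)" using False \<open>M \<ge> 0\<close> assms(3)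
        by (intro mult_left_mono) (auto intro!: mult_left_mono_neg)
      also have "\<dots> \<le> (C + M * exp (-\<kappa>)) * exp (\<kappa> * \<bar>t\<bar>)" using C(1) by (intro mult_right_mono) auto
      also have "\<dots> = norm \<dots>" using \<open>M \<ge> 0\<close> C(1) by (simp add: abs_mult)
      finally show ?thesis .
    qed
    thus "AE t in lborel. norm (f (Complex c t)) \<le> norm ((C + M * exp (-\<kappa>)) * exp (\<kappa> * \<bar>t\<bar>))" by simp
  qed
qed

lemma line_integral_limit:
  assumes "continuous_on {s. Re s = c} f" "strip_growth f c c \<kappa>" "\<kappa> < 0"
  shows "((\<lambda>T. integral {-T..T} (\<lambda>t. f (Complex c t))) \<longlongrightarrow> line_integral f c) at_top"
proof -
  have int: "integrable lborel (\<lambda>t. f (Complex c t))" by (rule integrable_line[OF assms])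
  have "((\<lambda>T. LINT t|lborel. indicator {-T..T} t *\<^sub>R f (Complex c t)) \<longlongrightarrow> line_integral f c) at_top"
    unfolding line_integral_def
  proof (rule integral_dominated_convergence_at_top)
    show "integrable lborel (\<lambda>t. norm (f (Complex c t)))" using int by auto
    show "AE t in lborel. ((\<lambda>T. indicator {-T..T} t *\<^sub>R f (Complex c t)) \<longlongrightarrow> f (Complex c t)) at_top"
    proof (rule AE_I2, rule tendsto_eventually)
      fix t :: real
      show "\<forall>\<^sub>F T in at_top. indicator {-T..T} t *\<^sub>R f (Complex c t) = f (Complex c t)"
        using eventually_ge_at_top[of "\<bar>t\<bar>"] by eventually_elim (auto simp: indicator_def)
    qed
    show "\<forall>\<^sub>F T in at_top. AE t in lborel. norm (indicator {-T..T} t *\<^sub>R f (Complex c t)) \<le> norm (f (Complex c t))"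
      by (auto simp: indicator_def)
  qed (use int in auto)
  moreover have "(LINT t|lborel. indicator {-T..T} t *\<^sub>R f (Complex c t)) = integral {-T..T} (\<lambda>t. f (Complex c t))" for T
  proof -
    have "set_integrable lborel {-T..T} (\<lambda>t. f (Complex c t))"
      unfolding set_integrable_def by (rule integrable_mult_indicator[OF _ int]) auto
    from set_borel_integral_eq_integral(2)[OF this] show ?thesis
      by (simp add: set_lebesgue_integral_def)
  qed
  ultimately show ?thesis by simp
qed

text \<open>This is the residue theorem on rectangles with vertical sides on Re s = a and Re s = b,
  cut off at height T; the horizontal sides vanish in the limit because the rate is negative. The
  half-plane beyond \<open>a'\<close> supplies an open connected domain around all these
  rectangles.\<close>

lemma line_integral_shift:
  assumes holo: "f holomorphic_on {s. Re s > a'} - P" and "a' < a" "a < b" "finite P"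
    and P: "\<And>p. p \<in> P \<Longrightarrow> a < Re p \<and> Re p < b"
    and growth: "strip_growth f a b \<kappa>" "\<kappa> < 0"
  shows "line_integral f b - line_integral f a = 2 * of_real pi * (\<Sum>p\<in>P. residue f p)"
proof -
  define L where "L = 2 * pi * \<i> * (\<Sum>p\<in>P. residue f p)"
  have cont: "continuous_on ({s. Re s > a'} - P) f" using holo by (rule holomorphic_on_imp_continuous_on)
  obtain C where C: "C > 0"
    "\<And>s. s \<in> strip a b \<Longrightarrow> norm (f s) \<le> C * exp (\<kappa> * \<bar>Im s\<bar>)"
    using strip_growthE[OF growth(1)] by metis
  \<comment> \<open>Beyond height \<open>B\<close> the horizontal sides avoid every pole, and
    \<open>B \<ge> 1\<close> puts them where the growth bound applies.\<close>
  define B where "B = Max (insert 1 ((\<lambda>p. \<bar>Im p\<bar>) ` P))"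
  have B: "B \<ge> 1" "\<And>p. p \<in> P \<Longrightarrow> \<bar>Im p\<bar> \<le> B" using \<open>finite P\<close> by (auto simp: B_def)
  define h where "h = (\<lambda>y. contour_integral (linepath (Complex a y) (Complex b y)) f)"
  have h_bound: "norm (h y) \<le> C * (b - a) * exp (\<kappa> * \<bar>y\<bar>)" if "\<bar>y\<bar> > B" for y
  proof -
    have seg: "z \<in> {s. Re s > a'} - P \<and> a \<le> Re z \<and> Re z \<le> b \<and> Im z = y"
      if "z \<in> closed_segment (Complex a y) (Complex b y)" for z
    proof -
      have "Im z = y" "a \<le> Re z" "Re z \<le> b"
        using that \<open>a < b\<close> by (auto simp: closed_segment_same_Im closed_segment_eq_real_ivl)
      moreover have "z \<notin> P" using B(2)[of z] \<open>\<bar>y\<bar> > B\<close> calculation by auto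
      ultimately show ?thesis using \<open>a' < a\<close> by auto
    qed
    have "f contour_integrable_on linepath (Complex a y) (Complex b y)"
      by (rule contour_integrable_continuous_linepath, rule continuous_on_subset[OF cont]) (use seg in blast)
    hence "norm (h y) \<le> C * exp (\<kappa> * \<bar>y\<bar>) * norm (Complex b y - Complex a y)"
      unfolding h_def
    proof (rule contour_integral_bound_linepath)
      fix z assume "z \<in> closed_segment (Complex a y) (Complex b y)"
      from seg[OF this] show "norm (f z) \<le> C * exp (\<kappa> * \<bar>y\<bar>)"
        using C(2)[of z] B(1) \<open>\<bar>y\<bar> > B\<close> by (auto simp: strip_def)
    qed (use C in auto)
    also have "norm (Complex b y - Complex a y) = b - a"
      using \<open>a < b\<close> by (simp add: cmod_def)
    finally show ?thesis by (simp add: mult_ac)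
  qed
  have key: "\<i> * integral {-T..T} (\<lambda>t. f (Complex b t)) - \<i> * integral {-T..T} (\<lambda>t. f (Complex a t)) - L
      = h T - h (-T)" if T: "T > B" for T
  proof -
    define c1 c3 where "c1 = Complex a (-T)" and "c3 = Complex b T"
    let ?g = "rectpath c1 c3"
    have le: "Re c1 \<le> Re c3" "Im c1 \<le> Im c3" using T B \<open>a < b\<close> by (auto simp: c1_def c3_def)
    have img: "path_image ?g \<subseteq> {s. Re s > a'} - P"
    proof
      fix z assume "z \<in> path_image ?g"
      hence z: "Re z \<in> {a, b} \<and> Im z \<in> {-T..T} \<or> Im z \<in> {-T, T} \<and> Re z \<in> {a..b}"
        using path_image_rectpath[OF le] by (auto simp: c1_def c3_def)
      hence "z \<notin> P" using P[of z] B(2)[of z] T by (auto simp: abs_if split: if_splits)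
      thus "z \<in> {s. Re s > a'} - P" using z \<open>a' < a\<close> \<open>a < b\<close> by auto
    qed
    have "contour_integral ?g f = 2 * pi * \<i> * (\<Sum>p\<in>P. winding_number ?g p * residue f p)"
    proof (rule Residue_theorem[where S = "{s. Re s > a'}"])
      show "open {s. Re s > a'}" by (rule open_halfspace_Re_gt)
      show "connected {s. Re s > a'}" by (intro convex_connected convex_halfspace_Re_gt)
      show "\<forall>z. z \<notin> {s. a' < Re s} \<longrightarrow> winding_number ?g z = 0"
        using le \<open>a' < a\<close> by (auto intro!: winding_number_rectpath_outside simp: c1_def in_cbox_complex_iff)
    qed (use assms img in auto)
    also have "(\<Sum>p\<in>P. winding_number ?g p * residue f p) = (\<Sum>p\<in>P. residue f p)"
    proof (rule sum.cong)
      fix p assume "p \<in> P"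
      hence "p \<in> box c1 c3" using P[of p] B(2)[of p] T by (auto simp: in_box_complex_iff c1_def c3_def)
      thus "winding_number ?g p * residue f p = residue f p" by (simp add: winding_number_rectpath)
    qed auto
    finally have 1: "contour_integral ?g f = L" by (simp add: L_def)
    let ?c2 = "Complex b (-T)" and ?c4 = "Complex a T"
    have sub: "closed_segment c1 ?c2 \<union> closed_segment ?c2 c3 \<union> closed_segment c3 ?c4 \<union> closed_segment ?c4 c1
      \<subseteq> path_image ?g"
      by (simp add: rectpath_def Let_def path_image_join c1_def c3_def) blast
    have ci: "f contour_integrable_on linepath c1 ?c2" "f contour_integrable_on linepath ?c2 c3"
      "f contour_integrable_on linepath c3 ?c4" "f contour_integrable_on linepath ?c4 c1"
      using sub img by (auto intro!: contour_integrable_continuous_linepath continuous_on_subset[OF cont])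
    have "contour_integral ?g f = contour_integral (linepath c1 ?c2) f + (contour_integral (linepath ?c2 c3) f
        + (contour_integral (linepath c3 ?c4) f + contour_integral (linepath ?c4 c1) f))"
      using ci by (simp add: rectpath_def Let_def c1_def c3_def contour_integrable_join)
    also have "contour_integral (linepath c1 ?c2) f = h (-T)" by (simp add: h_def c1_def)
    also have "contour_integral (linepath ?c2 c3) f = \<i> * integral {-T..T} (\<lambda>t. f (Complex b t))"
      by (rule contour_integral_linepath_same_Re) (use T B in \<open>auto simp: c3_def\<close>)
    also have "contour_integral (linepath c3 ?c4) f = - h T"
      unfolding h_def c3_def by (rule contour_integral_reverse_linepath)
        (use sub img in \<open>auto intro!: continuous_on_subset[OF cont] simp: c3_def closed_segment_commute\<close>)
    also have "contour_integral (linepath ?c4 c1) f = - contour_integral (linepath c1 ?c4) f"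
      by (rule contour_integral_reverse_linepath)
        (use sub img in \<open>auto intro!: continuous_on_subset[OF cont] simp: closed_segment_commute\<close>)
    also have "contour_integral (linepath c1 ?c4) f = \<i> * integral {-T..T} (\<lambda>t. f (Complex a t))"
      by (rule contour_integral_linepath_same_Re) (use T B in \<open>auto simp: c1_def\<close>)
    finally show ?thesis using 1 by (simp add: algebra_simps)
  qed
  have lim: "((\<lambda>T. integral {-T..T} (\<lambda>t. f (Complex c t))) \<longlongrightarrow> line_integral f c) at_top" if "c \<in> {a, b}" for c
  proof (rule line_integral_limit)
    show "continuous_on {s. Re s = c} f"
      by (rule continuous_on_subset[OF cont]) (use that P \<open>a' < a\<close> \<open>a < b\<close> in force)
    show "strip_growth f c c \<kappa>" by (rule strip_growth_subset[OF growth(1)]) (use that \<open>a < b\<close> in auto)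
  qed fact
  have "((\<lambda>T. \<i> * integral {-T..T} (\<lambda>t. f (Complex b t)) - \<i> * integral {-T..T} (\<lambda>t. f (Complex a t)) - L)
     \<longlongrightarrow> \<i> * line_integral f b - \<i> * line_integral f a - L) at_top"
    by (intro tendsto_intros lim) auto
  moreover have "((\<lambda>T. \<i> * integral {-T..T} (\<lambda>t. f (Complex b t)) - \<i> * integral {-T..T} (\<lambda>t. f (Complex a t)) - L)
     \<longlongrightarrow> 0) at_top"
  proof (rule Lim_null_comparison)
    show "\<forall>\<^sub>F T in at_top. norm (\<i> * integral {-T..T} (\<lambda>t. f (Complex b t)) - \<i> * integral {-T..T} (\<lambda>t. f (Complex a t)) - L)
       \<le> 2 * C * (b - a) * exp (\<kappa> * T)"
      using eventually_gt_at_top[of B]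
    proof eventually_elim
      case (elim T)
      have "norm (h T - h (-T)) \<le> norm (h T) + norm (h (-T))" by (rule norm_triangle_ineq4)
      also have "\<dots> \<le> C * (b - a) * exp (\<kappa> * \<bar>T\<bar>) + C * (b - a) * exp (\<kappa> * \<bar>-T\<bar>)"
        using elim B(1) by (intro add_mono h_bound) auto
      finally show ?case using key[OF elim] elim B(1) by simp
    qed
    have "filterlim (\<lambda>T. \<kappa> * T) at_bot at_top"
      using growth(2) by (intro filterlim_tendsto_neg_mult_at_bot[OF tendsto_const]) (auto simp: filterlim_ident)
    hence "((\<lambda>T. exp (\<kappa> * T)) \<longlongrightarrow> 0) at_top" by (rule filterlim_compose[OF exp_at_bot])
    from tendsto_mult_left[OF this, of "2 * C * (b - a)"]
    show "((\<lambda>T. 2 * C * (b - a) * exp (\<kappa> * T)) \<longlongrightarrow> 0) at_top" by simp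
  qed
  ultimately have "\<i> * line_integral f b - \<i> * line_integral f a - L = 0"
    using tendsto_unique trivial_limit_at_top_linorder by blast
  hence "\<i> * (line_integral f b - line_integral f a) = \<i> * (2 * pi * (\<Sum>p\<in>P. residue f p))"
    by (simp add: L_def algebra_simps)
  thus ?thesis by (simp only: mult_cancel_left) (simp add: algebra_simps)
qed

section \<open>The Gamma function\<close>

lemma pochhammer_prod_upto: "pochhammer z n = (\<Prod>i<n. z + of_nat i)" for z :: "'a :: comm_semiring_1"
  by (simp add: pochhammer_prod atLeast0LessThan)

text \<open>
  The monotonicity in \<open>\<sigma>\<close>, visible on the factors of Euler's product, reduces the decay of \<open>\<Gamma>\<close> in a strip
  to the lines \<open>Re s = 1/2 + n\<close>, where it follows from the reflection formula.
\<close>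
lemma norm_Gamma_ratio_mono:
  assumes "0 < \<sigma>" "\<sigma> \<le> \<tau>"
  shows "norm (Gamma (Complex \<sigma> t)) / Gamma \<sigma> \<le> norm (Gamma (Complex \<tau> t)) / Gamma \<tau>"
proof -
  define R where "R = (\<lambda>\<sigma> n. norm (Gamma_series (Complex \<sigma> t) n) / Gamma_series \<sigma> n)"
  have lim: "R x \<longlonglongrightarrow> norm (Gamma (Complex x t)) / Gamma x" if "x > 0" for x
    unfolding R_def by (intro tendsto_intros) (use that in \<open>auto simp: Gamma_eq_zero_iff elim!: nonpos_Ints_cases\<close>)
  \<comment> \<open>The factorials cancel, and so do the powers of n, whose modulus depends on the
    real part alone; only ratios of linear factors remain.\<close>
  have R: "R x n = (\<Prod>i\<le>n. (x + real i) / norm (Complex x t + of_nat i))" if "x > 0" "n > 0" for x n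
  proof -
    have "norm (exp (Complex x t * complex_of_real (ln (real n)))) = exp (x * ln (real n))"
      by (simp add: norm_exp_eq_Re)
    moreover have "{..<Suc n} = {..n}" by auto
    ultimately show ?thesis using that
      by (simp add: R_def Gamma_series_def norm_mult norm_divide pochhammer_prod_upto prod_dividef prod_norm del: prod.lessThan_Suc)
  qed
  have ratio: "(\<sigma> + c) / norm (Complex \<sigma> t + of_real c) \<le> (\<tau> + c) / norm (Complex \<tau> t + of_real c)" if "c \<ge> 0" for c
  proof -
    have *: "norm (Complex x t + of_real c) = sqrt ((x + c)\<^sup>2 + t\<^sup>2)" for x
      by (simp add: cmod_def)
    define u v where "u = \<sigma> + c" and "v = \<tau> + c"
    have uv: "0 < u" "u \<le> v" using assms that by (auto simp: u_def v_def)
    have "(u * sqrt (v\<^sup>2 + t\<^sup>2))\<^sup>2 \<le> (v * sqrt (u\<^sup>2 + t\<^sup>2))\<^sup>2"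
    proof -
      have "u\<^sup>2 * t\<^sup>2 \<le> v\<^sup>2 * t\<^sup>2" using uv by (intro mult_right_mono power_mono) auto
      thus ?thesis by (simp add: power_mult_distrib algebra_simps)
    qed
    hence "u * sqrt (v\<^sup>2 + t\<^sup>2) \<le> v * sqrt (u\<^sup>2 + t\<^sup>2)"
      by (rule power2_le_imp_le) (use uv in auto)
    moreover have "sqrt (u\<^sup>2 + t\<^sup>2) > 0" "sqrt (v\<^sup>2 + t\<^sup>2) > 0" using uv by (auto simp: add_pos_nonneg)
    ultimately show ?thesis unfolding * u_def [symmetric] v_def [symmetric]
      by (simp add: divide_simps mult.commute)
  qed
  show ?thesis
  proof (rule LIMSEQ_le[OF lim lim])
    show "\<exists>N. \<forall>n\<ge>N. R \<sigma> n \<le> R \<tau> n"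
    proof (intro exI allI impI)
      fix n :: nat assume "n \<ge> 1"
      have "(\<Prod>i\<le>n. (\<sigma> + real i) / norm (Complex \<sigma> t + of_nat i)) \<le> (\<Prod>i\<le>n. (\<tau> + real i) / norm (Complex \<tau> t + of_nat i))"
        using ratio[of "real i" for i] assms by (intro prod_mono) (auto intro!: divide_nonneg_nonneg)
      thus "R \<sigma> n \<le> R \<tau> n" using \<open>n \<ge> 1\<close> assms by (simp add: R)
    qed
  qed (use assms in auto)
qed

lemma norm_Gamma_half_line:
  "norm (Gamma (Complex (1/2) t)) \<le> sqrt (2 * pi) * exp (- (pi / 2) * \<bar>t\<bar>)"
proof -
  define z where "z = Complex (1/2) t"
  have cnj: "1 - z = cnj z" by (simp add: z_def complex_eq_iff)
  have z: "z \<notin> \<int>\<^sub>\<le>\<^sub>0" "cnj z \<notin> \<int>\<^sub>\<le>\<^sub>0" by (auto simp: z_def complex_eq_iff elim!: nonpos_Ints_cases)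
  have "Gamma z * Gamma (cnj z) = of_real pi / sin (of_real pi * z)"
    using Gamma_reflection_complex[of z] by (simp add: cnj)
  hence "norm (Gamma z * cnj (Gamma z)) = norm (of_real pi / sin (of_real pi * z))"
    by (simp add: cnj_Gamma)
  hence 1: "norm (Gamma z) ^ 2 = pi / norm (sin (of_real pi * z))"
    by (simp add: norm_mult norm_divide power2_eq_square)
  have "of_real pi * z = of_real pi / 2 - (- \<i> * of_real (pi * t))" by (simp add: z_def complex_eq_iff)
  hence "sin (of_real pi * z) = cos (- \<i> * of_real (pi * t))" by (simp only: sin_cos_eq) (simp)
  also have "\<dots> = of_real (cosh (pi * t))" by (simp add: cos_conv_cosh cosh_def scaleR_conv_of_real flip: exp_of_real)
  finally have 2: "norm (sin (of_real pi * z)) = cosh (pi * t)" using cosh_real_ge_1[of "pi * t"] by simp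
  have "exp (pi * \<bar>t\<bar>) / 2 \<le> cosh (pi * \<bar>t\<bar>)" by (simp add: cosh_field_def)
  also have "\<dots> = cosh (pi * t)" by (cases "t \<ge> 0") auto
  finally have "pi / cosh (pi * t) \<le> pi / (exp (pi * \<bar>t\<bar>) / 2)" by (intro divide_left_mono) auto
  also have "\<dots> = (sqrt (2 * pi) * exp (- (pi / 2) * \<bar>t\<bar>)) ^ 2"
    by (simp add: power_mult_distrib exp_minus field_simps flip: exp_of_nat_mult)
  finally have "norm (Gamma z) ^ 2 \<le> (sqrt (2 * pi) * exp (- (pi / 2) * \<bar>t\<bar>)) ^ 2"
    by (simp add: 1 2)
  thus ?thesis unfolding z_def by (rule power2_le_imp_le) auto
qed

text \<open>Each use of the recurrence Gamma(s + 1) = s Gamma(s) costs a linear factor, which is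
  paid for with half of \<open>\<epsilon>\<close>; this is why \<open>\<epsilon>\<close> stays
  arbitrary in the induction.\<close>

lemma strip_growth_Gamma_half:
  assumes "0 < \<epsilon>"
  shows "strip_growth Gamma (1/2 + real n) (1/2 + real n) (\<epsilon> - pi / 2)"
  using assms
proof (induction n arbitrary: \<epsilon>)
  case 0
  show ?case
  proof (rule strip_growthI[where C = "sqrt (2 * pi)"])
    fix s assume "1 / 2 + real 0 \<le> Re s" "Re s \<le> 1 / 2 + real 0"
    hence "s = Complex (1/2) (Im s)" by (simp add: complex_eq_iff)
    hence "norm (Gamma s) \<le> sqrt (2 * pi) * exp (- (pi / 2) * \<bar>Im s\<bar>)" using norm_Gamma_half_line by metis
    also have "\<dots> \<le> sqrt (2 * pi) * exp ((\<epsilon> - pi / 2) * \<bar>Im s\<bar>)"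
    proof (intro mult_left_mono)
      have "- (pi / 2) * \<bar>Im s\<bar> \<le> (\<epsilon> - pi / 2) * \<bar>Im s\<bar>" using 0 by (intro mult_right_mono) auto
      thus "exp (- (pi / 2) * \<bar>Im s\<bar>) \<le> exp ((\<epsilon> - pi / 2) * \<bar>Im s\<bar>)" by simp
    qed auto
    finally show "norm (Gamma s) \<le> sqrt (2 * pi) * exp ((\<epsilon> - pi / 2) * \<bar>Im s\<bar>)" .
  qed
next
  case (Suc n)
  define c where "c = 1/2 + real n"
  have "strip_growth (\<lambda>s. s * Gamma s) c c (\<epsilon> / 2 + (\<epsilon> / 2 - pi / 2))"
    using Suc by (intro strip_growth_mult strip_growth_ident Suc.IH[folded c_def]) auto
  hence "strip_growth (\<lambda>s. s * Gamma s) (c + 1 + of_real (-1)) (c + 1 + of_real (-1)) (\<epsilon> - pi / 2)"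
    by (simp add: algebra_simps)
  from strip_growth_shift[OF this]
  have "strip_growth (\<lambda>s. (s + of_real (-1)) * Gamma (s + of_real (-1))) (c + 1) (c + 1) (\<epsilon> - pi / 2)" by simp
  hence "strip_growth Gamma (c + 1) (c + 1) (\<epsilon> - pi / 2)"
  proof (rule strip_growth_cong)
    fix s assume "1 \<le> \<bar>Im s\<bar>"
    hence "s - 1 \<notin> \<int>\<^sub>\<le>\<^sub>0" by (auto simp: complex_eq_iff elim!: nonpos_Ints_cases)
    from Gamma_plus1[OF this] show "norm (Gamma s) \<le> norm ((s + of_real (-1)) * Gamma (s + of_real (-1)))" by simp
  qed
  thus ?case by (simp add: c_def add_ac)
qed

text \<open>The whole strip is compared with a single line Re s = tau to its right: the ratio of
  |Gamma s| to Gamma(Re s) increases with Re s, and Gamma(Re s) is bounded on the compact interval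
  \<open>{a..b}\<close>.\<close>

lemma strip_growth_Gamma_pos:
  assumes "0 < \<epsilon>" "0 < a"
  shows "strip_growth Gamma a b (\<epsilon> - pi / 2)"
proof -
  obtain n where n: "b \<le> real n" using real_arch_simple by blast
  define \<tau> where "\<tau> = 1/2 + real n"
  obtain C where C: "C > 0"
    "\<And>s. s \<in> strip \<tau> \<tau> \<Longrightarrow> norm (Gamma s) \<le> C * exp ((\<epsilon> - pi / 2) * \<bar>Im s\<bar>)"
    using strip_growthE[OF strip_growth_Gamma_half[OF assms(1), of n, folded \<tau>_def]] by metis
  have "continuous_on {a..b} (Gamma :: real \<Rightarrow> real)"
    using assms by (intro continuous_on_Gamma) (auto elim!: nonpos_Ints_cases)
  hence "bounded (Gamma ` {a..b})" by (intro compact_imp_bounded compact_continuous_image) auto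
  then obtain M where M: "\<forall>x\<in>{a..b}. norm (Gamma x) \<le> M" unfolding bounded_iff by blast
  have G\<tau>: "Gamma \<tau> > 0" by (intro Gamma_real_pos) (simp add: \<tau>_def add_pos_nonneg)
  show ?thesis
  proof (rule strip_growthI)
    fix s assume s: "a \<le> Re s" "Re s \<le> b" "1 \<le> \<bar>Im s\<bar>"
    have pos: "Gamma (Re s) > 0" using s assms by (intro Gamma_real_pos) auto
    have "norm (Gamma s) / Gamma (Re s) \<le> norm (Gamma (Complex \<tau> (Im s))) / Gamma \<tau>"
      using norm_Gamma_ratio_mono[of "Re s" \<tau> "Im s"] s assms n by (simp add: \<tau>_def)
    hence "norm (Gamma s) \<le> norm (Gamma (Complex \<tau> (Im s))) / Gamma \<tau> * Gamma (Re s)"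
      using pos by (simp add: field_simps)
    also have "\<dots> \<le> (C * exp ((\<epsilon> - pi / 2) * \<bar>Im s\<bar>)) / Gamma \<tau> * M"
      using C(2)[of "Complex \<tau> (Im s)"] bspec[OF M, of "Re s"] s G\<tau> pos C(1) by (intro mult_mono divide_right_mono) (auto simp: strip_def)
    finally show "norm (Gamma s) \<le> (C / Gamma \<tau> * M) * exp ((\<epsilon> - pi / 2) * \<bar>Im s\<bar>)" by (simp add: mult_ac)
  qed
qed

text \<open>Passing from s + n to s + n + 1 multiplies Gamma by a number of modulus at least |Im s|
  >= 1. This carries the decay from the right half-plane to strips reaching arbitrarily far to the
  left.\<close>

lemma norm_Gamma_le_shift:
  assumes "1 \<le> \<bar>Im s\<bar>"
  shows "norm (Gamma s) \<le> norm (Gamma (s + of_nat n))"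
proof (induction n)
  case (Suc n)
  have "s + of_nat n \<notin> \<int>\<^sub>\<le>\<^sub>0" using assms by (auto simp: complex_eq_iff elim!: nonpos_Ints_cases)
  hence "Gamma (s + of_nat (Suc n)) = (s + of_nat n) * Gamma (s + of_nat n)"
    using Gamma_plus1 by (metis add.commute add.left_commute of_nat_Suc)
  moreover have "1 \<le> norm (s + of_nat n)" using abs_Im_le_cmod[of "s + of_nat n"] assms by simp
  hence "1 * norm (Gamma (s + of_nat n)) \<le> norm (s + of_nat n) * norm (Gamma (s + of_nat n))"
    by (intro mult_right_mono) auto
  ultimately show ?case using Suc by (simp add: norm_mult)
qed auto

lemma strip_growth_Gamma:
  assumes "0 < \<epsilon>"
  shows "strip_growth Gamma a b (\<epsilon> - pi / 2)"
proof -
  obtain n where n: "- a < real n" using reals_Archimedean2 by blast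
  have "strip_growth Gamma (a + real n) (b + real n) (\<epsilon> - pi / 2)"
    using n assms by (intro strip_growth_Gamma_pos) auto
  from strip_growth_shift[OF this] show ?thesis
    by (rule strip_growth_cong) (use norm_Gamma_le_shift in simp)
qed

section \<open>Gauss's multiplication formula\<close>

text \<open>This is the finite form of the multiplication formula: increasing n by one appends the k
  factors k z + k n + l with l < k, each of which is k times z + l / k + n.\<close>

lemma pochhammer_multiplication:
  fixes z :: "'a :: field_char_0"
  assumes "k > 0"
  shows "pochhammer (of_nat k * z) (k * n) = of_nat k ^ (k * n) * (\<Prod>l<k. pochhammer (z + of_nat l / of_nat k) n)"
proof (induction n)
  case (Suc n)
  have "pochhammer (of_nat k * z) (k * Suc n) = pochhammer (of_nat k * z) (k * n) * pochhammer (of_nat k * z + of_nat (k * n)) k"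
    using pochhammer_product'[of "of_nat k * z" "k * n" k] by (simp add: add.commute)
  also have "pochhammer (of_nat k * z + of_nat (k * n)) k = (\<Prod>l<k. of_nat k * (z + of_nat l / of_nat k + of_nat n))"
    unfolding pochhammer_prod_upto using assms by (intro prod.cong) (auto simp: field_simps)
  also have "\<dots> = of_nat k ^ k * (\<Prod>l<k. z + of_nat l / of_nat k + of_nat n)"
    by (simp add: prod.distrib)
  finally show ?case
    unfolding Suc.IH by (simp add: pochhammer_Suc prod.distrib power_add mult_ac)
qed auto

text \<open>The polynomial 1 + X + ... + X^(k-1) is the product of X - \<open>w l\<close> over the
  nontrivial k-th roots of unity. Its value at 1 is k, and |1 - \<open>w l\<close>| = 2 sin(pi l /
  k).\<close>

lemma prod_sin_div:
  assumes "k > 0"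
  shows "(\<Prod>l=1..<k. 2 * sin (pi * real l / real k)) = real k"
proof -
  define w where "w = (\<lambda>l. cis (2 * pi * real l / real k))"
  define p q :: "complex poly" where "p = (\<Sum>i<k. monom 1 i)" and "q = (\<Prod>l=1..<k. [:- w l, 1:])"
  have bij: "bij_betw w {..<k} {z. z ^ k = 1}"
    unfolding w_def using Complex.bij_betw_roots_unity[OF assms] by simp
  have w0: "w 0 = 1" by (simp add: w_def)
  have inj: "inj_on w {..<k}" using bij by (rule bij_betw_imp_inj_on)
  have pw: "poly p z = (\<Sum>i<k. z ^ i)" for z by (simp add: p_def poly_sum poly_monom)
  have roots: "poly p (w l) = 0" if "l \<in> {1..<k}" for l
  proof -
    have "w l \<noteq> 1" using inj_onD[OF inj, of l 0] that w0 by auto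
    moreover have "w l ^ k = 1" using bij that by (auto simp: bij_betw_def)
    ultimately show ?thesis by (simp add: pw sum_gp_strict)
  qed
  \<comment> \<open>Both polynomials are monic of degree k - 1 and share k - 1 distinct zeros, so a
    nonzero difference would have more zeros than its degree allows.\<close>
  have "p = q"
  proof (rule ccontr)
    assume "p \<noteq> q"
    hence nz: "p - q \<noteq> 0" by simp
    have "degree q = k - 1" by (simp add: q_def degree_prod_eq_sum_degree)
    moreover have "lead_coeff q = (\<Prod>l=1..<k. lead_coeff [:- w l, 1:])" unfolding q_def by (rule lead_coeff_prod)
    ultimately have dq: "degree q = k - 1" "lead_coeff q = 1" by simp_all
    have cp: "coeff p i = (if i < k then 1 else 0)" for i by (simp add: p_def coeff_sum)
    have "degree (p - q) < k - 1 \<or> p - q = 0"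
    proof -
      have "coeff (p - q) i = 0" if "i \<ge> k - 1" for i
        using that cp[of i] dq coeff_eq_0[of q i] assms by (cases "i = k - 1") auto
      thus ?thesis by (metis leading_coeff_neq_0 not_le)
    qed
    with nz have d: "degree (p - q) < k - 1" by simp
    have "w ` {1..<k} \<subseteq> {z. poly (p - q) z = 0}"
    proof clarify
      fix l assume l: "l \<in> {1..<k}"
      have "poly q (w l) = 0" unfolding q_def poly_prod using l by (intro prod_zero) auto
      thus "poly (p - q) (w l) = 0" using roots[OF l] by simp
    qed
    hence "card (w ` {1..<k}) \<le> card {z. poly (p - q) z = 0}"
      by (intro card_mono poly_roots_finite nz)
    also have "\<dots> \<le> degree (p - q)" using nz by (rule card_poly_roots_bound)
    finally show False using d inj by (subst (asm) card_image) (auto intro: inj_on_subset)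
  qed
  hence "poly p 1 = poly q 1" by simp
  hence "of_nat k = (\<Prod>l=1..<k. 1 - w l)" by (simp add: pw q_def poly_prod)
  hence "real k = norm (\<Prod>l=1..<k. 1 - w l)" by (metis norm_of_nat)
  also have "\<dots> = (\<Prod>l=1..<k. norm (1 - w l))" by (simp add: prod_norm)
  also have "\<dots> = (\<Prod>l=1..<k. 2 * sin (pi * real l / real k))"
  proof (rule prod.cong)
    fix l assume l: "l \<in> {1..<k}"
    define x where "x = pi * real l / real k"
    have x: "0 \<le> x" "x \<le> pi" using l by (auto simp: x_def divide_simps)
    have "1 - w l = cis x * (cis (-x) - cis x)"
      by (simp add: w_def x_def algebra_simps cis_mult)
    also have "cis (-x) - cis x = - 2 * \<i> * of_real (sin x)" by (simp add: complex_eq_iff)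
    finally show "norm (1 - w l) = 2 * sin x" using sin_ge_zero[OF x] by (simp add: norm_mult)
  qed auto
  finally show ?thesis ..
qed

text \<open>The product is invariant under the exchange of l and k - l, so its square pairs Gamma(l
  / k) with Gamma(1 - l / k), and the reflection formula turns it into a product of sines.\<close>

lemma prod_Gamma_div:
  assumes "k > 0"
  shows "(\<Prod>l=1..<k. Gamma (real l / real k)) = (2 * pi) powr ((real k - 1) / 2) / sqrt (real k)"
proof -
  define G where "G = (\<Prod>l=1..<k. Gamma (real l / real k))"
  have "G = (\<Prod>l=1..<k. Gamma (1 - real l / real k))"
    unfolding G_def
    by (rule prod.reindex_bij_witness[of _ "\<lambda>l. k - l" "\<lambda>l. k - l"]) (auto simp: of_nat_diff field_simps)
  hence "G ^ 2 = (\<Prod>l=1..<k. Gamma (real l / real k) * Gamma (1 - real l / real k))"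
    by (simp add: power2_eq_square prod.distrib) (simp add: G_def)
  also have "\<dots> = (\<Prod>l=1..<k. 2 * pi / (2 * sin (pi * real l / real k)))"
  proof (rule prod.cong)
    fix l
    have "of_real (Gamma (real l / real k) * Gamma (1 - real l / real k)) = (of_real (pi / sin (pi * (real l / real k))) :: complex)"
      using Gamma_reflection_complex[of "of_real (real l / real k)"]
      by (simp add: Gamma_complex_of_real[symmetric] sin_of_real[symmetric])
    thus "Gamma (real l / real k) * Gamma (1 - real l / real k) = 2 * pi / (2 * sin (pi * real l / real k))"
      by (subst (asm) of_real_eq_iff) simp
  qed auto
  also have "\<dots> = (\<Prod>l=1..<k. 2 * pi) / (\<Prod>l=1..<k. 2 * sin (pi * real l / real k))"
    by (rule prod_dividef)
  also have "\<dots> = (2 * pi) ^ (k - 1) / real k"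
    unfolding prod_sin_div[OF assms] by simp
  also have "(2 * pi) ^ (k - 1) = (2 * pi) powr real (k - 1)"
    by (rule powr_realpow[symmetric]) simp
  also have "\<dots> = (2 * pi) powr ((real k - 1) / 2 + (real k - 1) / 2)"
    using assms by (simp add: of_nat_diff)
  also have "\<dots> = ((2 * pi) powr ((real k - 1) / 2)) ^ 2"
    by (simp only: powr_add power2_eq_square)
  also have "\<dots> / real k = ((2 * pi) powr ((real k - 1) / 2) / sqrt (real k)) ^ 2"
    by (simp add: power_divide)
  finally have "G ^ 2 = ((2 * pi) powr ((real k - 1) / 2) / sqrt (real k)) ^ 2" .
  moreover have "G \<ge> 0" unfolding G_def by (intro prod_nonneg) (auto intro!: less_imp_le Gamma_real_pos)
  ultimately show ?thesis unfolding G_def by (subst (asm) power2_eq_iff_nonneg) auto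
qed

text \<open>By the limit formula for Gamma and the finite version for Pochhammer symbols, the
  quotient of the z-dependent parts of both sides is the limit of a sequence \<open>c\<close> in
  which z does not occur. It is therefore constant and can be evaluated at one point.\<close>

theorem Gamma_multiplication:
  fixes z :: complex
  assumes "k > 0" "of_nat k * z \<notin> \<int>\<^sub>\<le>\<^sub>0"
  shows "(\<Prod>l<k. Gamma (z + of_nat l / of_nat k)) =
    of_real ((2 * pi) powr ((real k - 1) / 2) * sqrt (real k)) * exp (- (of_nat k * z * of_real (ln (real k)))) * Gamma (of_nat k * z)"
proof -
  define c :: "nat \<Rightarrow> complex" where "c = (\<lambda>n. fact (n - 1) ^ k * exp ((of_nat k - 1) / 2 * of_real (ln (real n))) * of_nat k ^ (k * n) / fact (k * n - 1))"
  have k: "(of_nat k :: complex) \<noteq> 0" using assms(1) by simp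
  have lim: "c \<longlonglongrightarrow> (\<Prod>l<k. Gamma (z + of_nat l / of_nat k)) / (exp (- (of_nat k * z * of_real (ln (real k)))) * Gamma (of_nat k * z))"
    if z: "of_nat k * z \<notin> \<int>\<^sub>\<le>\<^sub>0" for z
  proof -
    have sub: "strict_mono (\<lambda>n. k * n)" using assms(1) by (simp add: strict_mono_def)
    have "(\<lambda>n. (\<Prod>l<k. Gamma_series' (z + of_nat l / of_nat k) n) /
         (exp (- (of_nat k * z * of_real (ln (real k)))) * Gamma_series' (of_nat k * z) (k * n)))
       \<longlonglongrightarrow> (\<Prod>l<k. Gamma (z + of_nat l / of_nat k)) / (exp (- (of_nat k * z * of_real (ln (real k)))) * Gamma (of_nat k * z))"
      using LIMSEQ_subseq_LIMSEQ[OF Gamma_series'_LIMSEQ[of "of_nat k * z"] sub] z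
      by (intro tendsto_intros Gamma_series'_LIMSEQ) (auto simp: o_def Gamma_eq_zero_iff)
    moreover have "eventually (\<lambda>n. (\<Prod>l<k. Gamma_series' (z + of_nat l / of_nat k) n) /
         (exp (- (of_nat k * z * of_real (ln (real k)))) * Gamma_series' (of_nat k * z) (k * n)) = c n) sequentially"
      using eventually_gt_at_top[of 0]
    proof eventually_elim
      case (elim n)
      define P where "P = (\<Prod>l<k. pochhammer (z + of_nat l / of_nat k) n)"
      have poch: "pochhammer (of_nat k * z) (k * n) = of_nat k ^ (k * n) * P"
        unfolding P_def by (rule pochhammer_multiplication[OF assms(1)])
      have "pochhammer (of_nat k * z) (k * n) \<noteq> 0" using z by (auto dest: pochhammer_eq_0_imp_nonpos_Int)
      hence P: "P \<noteq> 0" using poch by auto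
      have S: "(\<Sum>l<k. z + of_nat l / of_nat k) = of_nat k * z + (of_nat k - 1) / 2"
      proof -
        have "(\<Sum>l<k. of_nat l :: complex) = of_nat k * (of_nat k - 1) / 2" by (induction k) (auto simp: field_simps)
        thus ?thesis using k by (simp add: sum.distrib flip: sum_divide_distrib)
      qed
      define A B E where "A = exp (of_nat k * z * complex_of_real (ln (real n)))"
        and "B = exp ((of_nat k - 1) / 2 * complex_of_real (ln (real n)))"
        and "E = exp (of_nat k * z * complex_of_real (ln (real k)))"
      have nz: "A \<noteq> 0" "B \<noteq> 0" "E \<noteq> 0" by (auto simp: A_def B_def E_def)
      have "(\<Prod>l<k. Gamma_series' (z + of_nat l / of_nat k) n) = fact (n - 1) ^ k * exp ((of_nat k * z + (of_nat k - 1) / 2) * of_real (ln (real n))) / P"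
        unfolding Gamma_series'_def P_def
        by (simp add: prod.distrib prod_dividef sum_distrib_right flip: exp_sum S)
      hence 1: "(\<Prod>l<k. Gamma_series' (z + of_nat l / of_nat k) n) = fact (n - 1) ^ k * (A * B) / P"
        by (simp only: A_def B_def distrib_right exp_add)
      have "Gamma_series' (of_nat k * z) (k * n) = fact (k * n - 1) * exp (of_nat k * z * (of_real (ln (real k)) + of_real (ln (real n)))) / (of_nat k ^ (k * n) * P)"
        using assms(1) elim by (simp add: Gamma_series'_def poch ln_mult)
      hence 2: "Gamma_series' (of_nat k * z) (k * n) = fact (k * n - 1) * (E * A) / (of_nat k ^ (k * n) * P)"
        by (simp only: A_def E_def distrib_left exp_add)
      have 3: "exp (- (of_nat k * z * complex_of_real (ln (real k)))) = 1 / E"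
        by (simp add: E_def exp_minus field_simps)
      have 4: "c n = fact (n - 1) ^ k * B * of_nat k ^ (k * n) / fact (k * n - 1)"
        by (simp add: c_def B_def)
      show ?case unfolding 1 2 3 4 using P k nz by (simp add: field_simps)
    qed
    ultimately show ?thesis by (rule Lim_transform_eventually)
  qed
  \<comment> \<open>At z = 1 / k one has Gamma(k z) = 1, and the product runs over Gamma(l / k) for
    l from 1 to k, whose value is known.\<close>
  have "of_nat k * (1 / of_nat k) \<notin> (\<int>\<^sub>\<le>\<^sub>0 :: complex set)" using k by simp
  from LIMSEQ_unique[OF lim[OF assms(2)] lim[OF this]]
  have "(\<Prod>l<k. Gamma (z + of_nat l / of_nat k)) / (exp (- (of_nat k * z * of_real (ln (real k)))) * Gamma (of_nat k * z))
     = (\<Prod>l<k. Gamma (1 / of_nat k + of_nat l / of_nat k)) /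
        (exp (- (of_nat k * (1 / of_nat k) * of_real (ln (real k)))) * Gamma (of_nat k * (1 / of_nat k)))" .
  also have "of_nat k * (1 / of_nat k) = (1 :: complex)" using k by simp
  also have "exp (- (1 * of_real (ln (real k)))) = (1 / of_nat k :: complex)"
    using assms(1) by (simp add: exp_minus exp_of_real inverse_eq_divide)
  also have "(\<Prod>l<k. Gamma (1 / of_nat k + of_nat l / of_nat k)) / (1 / of_nat k * Gamma 1)
     = (\<Prod>l<k. Gamma (1 / of_nat k + of_nat l / of_nat k :: complex)) * of_nat k"
    by (simp only: Gamma_1 mult_1_right divide_divide_eq_right div_by_1)
  also have "(\<Prod>l<k. Gamma (1 / of_nat k + of_nat l / of_nat k)) = (\<Prod>l=1..k. Gamma (complex_of_real (real l / real k)))"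
    by (rule prod.reindex_bij_witness[of _ "\<lambda>l. l - 1" Suc]) (auto simp: add_divide_distrib)
  also have "{1..k} = insert k {1..<k}" using assms(1) by auto
  also have "(\<Prod>l\<in>insert k {1..<k}. Gamma (complex_of_real (real l / real k))) = of_real (\<Prod>l=1..<k. Gamma (real l / real k))"
    using k by (simp add: Gamma_complex_of_real flip: of_real_divide)
  also have "of_real (\<Prod>l=1..<k. Gamma (real l / real k)) * of_nat k =
      complex_of_real ((\<Prod>l=1..<k. Gamma (real l / real k)) * real k)" by simp
  also have "(\<Prod>l=1..<k. Gamma (real l / real k)) * real k = (2 * pi) powr ((real k - 1) / 2) * (real k / sqrt (real k))"
    unfolding prod_Gamma_div[OF assms(1)] by simp
  also have "real k / sqrt (real k) = sqrt (real k)" by (simp add: real_div_sqrt)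
  finally have "(\<Prod>l<k. Gamma (z + of_nat l / of_nat k)) = of_real ((2 * pi) powr ((real k - 1) / 2) * sqrt (real k)) *
     (exp (- (of_nat k * z * of_real (ln (real k)))) * Gamma (of_nat k * z))"
    by (subst (asm) nonzero_divide_eq_eq) (use assms(2) in \<open>auto simp: Gamma_eq_zero_iff\<close>)
  thus ?thesis by (simp only: mult.assoc)
qed

section \<open>Analytic continuation and functional equation of the zeta function\<close>

text \<open>Up to the factor s (s + 1) / 2 this is the second-order Euler-Maclaurin remainder of
  y^(-s) on [n, n + 1]. The power y^(-s-2) is written as an exponential of a real logarithm, which
  makes it visibly entire in s.\<close>

definition zeta_summand :: "nat \<Rightarrow> complex \<Rightarrow> complex" where
  "zeta_summand n s = integral {0..1} (\<lambda>v. of_real (v * (1 - v)) * exp (- (s + 2) * of_real (ln (real n + v))))"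

text \<open>Euler-Maclaurin summation of n^(-s): the integral from 1 contributes 1 / (s - 1), the
  endpoint 1 / 2, and the remainders converge already for Re s > -1, where the formula continues the
  Dirichlet series.\<close>

definition zeta_right :: "complex \<Rightarrow> complex" where
  "zeta_right s = 1 / (s - 1) + 1 / 2 + s * (s + 1) / 2 * (\<Sum>n. zeta_summand (Suc n) s)"

lemma zeta_integrand_integrable:
  "(\<lambda>v. complex_of_real (v * (1 - v)) * exp (- (s + 2) * of_real (ln (real (Suc n) + v)))) integrable_on {0..1}"
  by (intro integrable_continuous_real continuous_intros) auto

lemma holomorphic_zeta_summand: "zeta_summand (Suc n) holomorphic_on UNIV"
proof -
  have "(\<lambda>s. integral (cbox 0 1) (\<lambda>v. complex_of_real (v * (1 - v)) * exp (- (s + 2) * of_real (ln (real (Suc n) + v))))) holomorphic_on UNIV"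
  proof (rule leibniz_rule_holomorphic)
    fix s :: complex and v :: real
    show "((\<lambda>s. complex_of_real (v * (1 - v)) * exp (- (s + 2) * of_real (ln (real (Suc n) + v)))) has_field_derivative
        (complex_of_real (v * (1 - v)) * (exp (- (s + 2) * of_real (ln (real (Suc n) + v))) * - of_real (ln (real (Suc n) + v))))) (at s within UNIV)"
      by (auto intro!: derivative_eq_intros)
  next
    show "continuous_on (UNIV \<times> cbox 0 1) (\<lambda>(s, v). complex_of_real (v * (1 - v)) * (exp (- (s + 2) * of_real (ln (real (Suc n) + v))) * - of_real (ln (real (Suc n) + v))))"
      unfolding case_prod_unfold by (intro continuous_intros) auto
  qed (use zeta_integrand_integrable in auto)
  thus ?thesis by (simp add: zeta_summand_def[abs_def])
qed

lemma norm_zeta_summand_le: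
  assumes "Re s \<ge> -2"
  shows "norm (zeta_summand (Suc n) s) \<le> real (Suc n) powr (- (Re s + 2))"
proof -
  have "norm (zeta_summand (Suc n) s) \<le> real (Suc n) powr (- (Re s + 2)) * (1 - 0)"
    unfolding zeta_summand_def
  proof (rule integral_bound)
    show "continuous_on {0..1} (\<lambda>v. complex_of_real (v * (1 - v)) * exp (- (s + 2) * of_real (ln (real (Suc n) + v))))"
      by (intro continuous_intros) auto
    fix v :: real assume v: "v \<in> {0..1}"
    have "v * (1 - v) \<le> 1 * 1" using v by (intro mult_mono) auto
    moreover have "(Re s + 2) * ln (real (Suc n)) \<le> (Re s + 2) * ln (real (Suc n) + v)"
      using assms v by (intro mult_left_mono) auto
    hence "exp (- (Re s + 2) * ln (real (Suc n) + v)) \<le> real (Suc n) powr (- (Re s + 2))"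
      by (simp add: powr_def algebra_simps del: of_nat_Suc)
    ultimately have "\<bar>v * (1 - v)\<bar> * exp (- (Re s + 2) * ln (real (Suc n) + v)) \<le> 1 * real (Suc n) powr (- (Re s + 2))"
      using v by (intro mult_mono) auto
    thus "norm (complex_of_real (v * (1 - v)) * exp (- (s + 2) * of_real (ln (real (Suc n) + v)))) \<le> real (Suc n) powr (- (Re s + 2))"
      by (simp add: norm_mult norm_exp_eq_Re abs_mult del: of_real_mult)
  qed auto
  thus ?thesis by simp
qed

lemma summable_Suc_powr: "(a::real) < -1 \<Longrightarrow> summable (\<lambda>n. real (Suc n) powr a)"
  using summable_Suc_iff[of "\<lambda>n. real n powr a"] by (simp add: summable_real_powr_iff del: of_nat_Suc)

lemma summable_zeta_summand:
  assumes "Re s > -1"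
  shows "summable (\<lambda>n. zeta_summand (Suc n) s)"
proof (rule summable_norm_cancel, rule summable_comparison_test)
  show "\<exists>N. \<forall>n\<ge>N. norm (norm (zeta_summand (Suc n) s)) \<le> real (Suc n) powr (- (Re s + 2))"
    using norm_zeta_summand_le[of s] assms by auto
  show "summable (\<lambda>n. real (Suc n) powr (- (Re s + 2)))" using assms by (intro summable_Suc_powr) auto
qed

lemma holomorphic_zeta_summand_suminf: "(\<lambda>s. \<Sum>n. zeta_summand (Suc n) s) holomorphic_on {s. Re s > -1}"
proof (rule holomorphic_uniform_sequence)
  show "open {s. Re s > -1}" by (rule open_halfspace_Re_gt)
  show "(\<lambda>s. \<Sum>n<N. zeta_summand (Suc n) s) holomorphic_on {s. Re s > -1}" for N
    by (intro holomorphic_intros holomorphic_on_subset[OF holomorphic_zeta_summand]) auto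
  fix x assume x: "x \<in> {s. Re s > -1}"
  \<comment> \<open>Half the distance of x from the boundary line, so that
    \<open>Re s \<ge> -1 + d\<close> on the whole ball and n^(-1-d) is a common majorant.\<close>
  define d where "d = (Re x + 1) / 2"
  have d: "d > 0" using x by (simp add: d_def)
  have ge: "Re s \<ge> -1 + d" if "s \<in> cball x d" for s
  proof -
    have "\<bar>Re x - Re s\<bar> \<le> norm (x - s)" using abs_Re_le_cmod[of "x - s"] by simp
    also have "\<dots> \<le> d" using that by (simp add: dist_norm)
    finally have "Re x - Re s \<le> d" by (rule abs_le_D1)
    thus ?thesis by (simp add: d_def field_simps)
  qed
  have "uniform_limit (cball x d) (\<lambda>N s. \<Sum>n<N. zeta_summand (Suc n) s) (\<lambda>s. \<Sum>n. zeta_summand (Suc n) s) sequentially"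
  proof (rule Weierstrass_m_test)
    fix n s assume "s \<in> cball x d"
    from ge[OF this] have s: "Re s \<ge> -1 + d" .
    have "norm (zeta_summand (Suc n) s) \<le> real (Suc n) powr (- (Re s + 2))"
      using s d by (intro norm_zeta_summand_le) auto
    also have "\<dots> \<le> real (Suc n) powr (- (1 + d))" using s by (intro powr_mono) auto
    finally show "norm (zeta_summand (Suc n) s) \<le> real (Suc n) powr (- (1 + d))" .
  next
    show "summable (\<lambda>n. real (Suc n) powr (- (1 + d)))" using d by (intro summable_Suc_powr) auto
  qed
  moreover have "cball x d \<subseteq> {s. Re s > -1}" using ge d by force
  ultimately show "\<exists>d>0. cball x d \<subseteq> {s. Re s > -1} \<and> uniform_limit (cball x d) (\<lambda>N s. \<Sum>n<N. zeta_summand (Suc n) s) (\<lambda>s. \<Sum>n. zeta_summand (Suc n) s) sequentially"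
    using d by blast
qed

lemma holomorphic_zeta_right: "zeta_right holomorphic_on {s. Re s > -1} - {1}"
proof -
  have "(\<lambda>s. 1 / (s - 1) + 1 / 2 + s * (s + 1) / 2 * (\<Sum>n. zeta_summand (Suc n) s)) holomorphic_on {s. Re s > -1} - {1}"
    by (intro holomorphic_intros holomorphic_on_subset[OF holomorphic_zeta_summand_suminf]) auto
  thus ?thesis by (simp add: zeta_right_def[abs_def])
qed

lemma zeta_right_residue: "((\<lambda>s. (s - 1) * zeta_right s) \<longlongrightarrow> 1) (at 1)"
proof -
  have "continuous_on {s. Re s > -1} (\<lambda>s. \<Sum>n. zeta_summand (Suc n) s)"
    using holomorphic_zeta_summand_suminf by (rule holomorphic_on_imp_continuous_on)
  hence "isCont (\<lambda>s. \<Sum>n. zeta_summand (Suc n) s) 1"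
    by (rule continuous_on_interior) (simp add: interior_open open_halfspace_Re_gt)
  hence "((\<lambda>s. 1 + (s - 1) * (1 / 2 + s * (s + 1) / 2 * (\<Sum>n. zeta_summand (Suc n) s))) \<longlongrightarrow>
     1 + (1 - 1) * (1 / 2 + 1 * (1 + 1) / 2 * (\<Sum>n. zeta_summand (Suc n) 1))) (at 1)"
    by (intro tendsto_intros) (auto simp: isCont_def)
  hence "((\<lambda>s. 1 + (s - 1) * (1 / 2 + s * (s + 1) / 2 * (\<Sum>n. zeta_summand (Suc n) s))) \<longlongrightarrow> 1) (at 1)" by simp
  moreover have "eventually (\<lambda>s. 1 + (s - 1) * (1 / 2 + s * (s + 1) / 2 * (\<Sum>n. zeta_summand (Suc n) s)) = (s - 1) * zeta_right s) (at (1::complex))"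
    unfolding eventually_at_filter by (intro always_eventually) (auto simp: zeta_right_def field_simps)
  ultimately show ?thesis by (rule Lim_transform_eventually)
qed

lemma zeta_right_0: "zeta_right 0 = -1/2"
  by (simp add: zeta_right_def)

text \<open>Integration by parts twice turns the summand into the error of the trapezoidal rule for \<open>y\<^sup>-\<^sup>s\<close>.\<close>
lemma zeta_summand_trapezoid:
  fixes s :: complex
  assumes "s \<noteq> 1"
  defines "e \<equiv> \<lambda>m. exp (- s * of_real (ln (real m)))"
  shows "s * (s + 1) / 2 * zeta_summand (Suc n) s =
     (e (Suc n) + e (Suc (Suc n))) / 2 - (of_nat (Suc (Suc n)) * e (Suc (Suc n)) - of_nat (Suc n) * e (Suc n)) / (1 - s)"
proof -
  define E where "E = (\<lambda>w. exp (- s * Ln (of_nat (Suc n) + w)))"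
  \<comment> \<open>The antiderivative collected from the two integrations by parts. Its first term
    vanishes at 0 and 1, which leaves the trapezoidal mean and the exact integral of y^(-s).\<close>
  define H where "H = (\<lambda>w. - s * (w * (1 - w) / 2) * E w / (of_nat (Suc n) + w) - (1 - 2 * w) / 2 * E w - (of_nat (Suc n) + w) * E w / (1 - s))"
  have int: "((\<lambda>v. s * (s + 1) * (of_real v * (1 - of_real v) / 2) * E (of_real v) / (of_nat (Suc n) + of_real v)^2) has_integral
      (H (of_real 1) - H (of_real 0))) {0..1}"
  proof (rule fundamental_theorem_of_calculus)
    fix v :: real assume v: "v \<in> {0..1}"
    define y :: complex where "y = of_nat (Suc n) + of_real v"
    have yr: "y = of_real (real (Suc n) + v)" by (simp add: y_def)
    have y: "y \<noteq> 0" "y \<notin> \<real>\<^sub>\<le>\<^sub>0"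
      unfolding yr using v by (auto simp del: of_real_add)
    have s: "1 - s \<noteq> 0" using assms by auto
    have dE: "(E has_field_derivative - s * E v / y) (at (of_real v))"
      unfolding E_def using y(2) unfolding y_def
      by (auto intro!: derivative_eq_intros simp: field_simps)
    have dy: "((\<lambda>w. of_nat (Suc n) + w) has_field_derivative 1) (at (of_real v))"
      by (auto intro!: derivative_eq_intros)
    have dp: "((\<lambda>w. - s * (w * (1 - w) / 2)) has_field_derivative - s * ((1 - 2 * of_real v) / 2)) (at (of_real v))"
      by (auto intro!: derivative_eq_intros simp: field_simps)
    have dq: "((\<lambda>w. (1 - 2 * w) / 2) has_field_derivative (-1 :: complex)) (at (of_real v))"
      by (auto intro!: derivative_eq_intros simp: field_simps)
    have "(H has_field_derivative s * (s + 1) * (of_real v * (1 - of_real v) / 2) * E (of_real v) / y^2) (at (of_real v))"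
      unfolding H_def
      by (rule DERIV_cong[OF DERIV_diff[OF DERIV_diff[OF DERIV_divide[OF DERIV_mult[OF dp dE] dy y(1)[unfolded y_def]]
           DERIV_mult[OF dq dE]] DERIV_cdivide[OF DERIV_mult[OF dy dE]]]])
         (unfold y_def[symmetric], use y(1) s in \<open>simp add: divide_simps\<close>, simp add: power2_eq_square algebra_simps)
    thus "((\<lambda>v. H (of_real v)) has_vector_derivative s * (s + 1) * (of_real v * (1 - of_real v) / 2) * E (of_real v) / (of_nat (Suc n) + of_real v)^2) (at v within {0..1})"
      unfolding y_def by (rule has_vector_derivative_real_field)
  qed auto
  have "((\<lambda>v. s * (s + 1) / 2 * (of_real (v * (1 - v)) * exp (- (s + 2) * of_real (ln (real (Suc n) + v))))) has_integral
      (H (of_real 1) - H (of_real 0))) {0..1}"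
  proof (rule has_integral_eq[OF _ int])
    fix v :: real assume v: "v \<in> {0..1}"
    define Y where "Y = real (Suc n) + v"
    have Y: "Y > 0" using v by (simp add: Y_def)
    have "Ln (of_nat (Suc n) + of_real v) = of_real (ln Y)"
      using Ln_of_real[OF Y] by (simp add: Y_def)
    hence E: "E (of_real v) = exp (- s * of_real (ln Y))" by (simp add: E_def)
    have "exp (- (s + 2) * of_real (ln Y)) = exp (- s * of_real (ln Y) - (of_real (ln Y) + of_real (ln Y)))"
      by (rule arg_cong[of _ _ exp]) (simp add: algebra_simps)
    also have "\<dots> = exp (- s * of_real (ln Y)) / (of_real Y)^2"
      using Y by (simp only: exp_diff exp_add exp_of_real exp_ln power2_eq_square of_real_mult)
    finally have "exp (- (s + 2) * of_real (ln Y)) = exp (- s * of_real (ln Y)) / (of_real Y)^2" .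
    thus "s * (s + 1) * (of_real v * (1 - of_real v) / 2) * E (of_real v) / (of_nat (Suc n) + of_real v)^2 =
       s * (s + 1) / 2 * (of_real (v * (1 - v)) * exp (- (s + 2) * of_real (ln (real (Suc n) + v))))"
      unfolding E unfolding Y_def by simp
  qed
  hence "integral {0..1} (\<lambda>v. s * (s + 1) / 2 * (of_real (v * (1 - v)) * exp (- (s + 2) * of_real (ln (real (Suc n) + v))))) = H (of_real 1) - H (of_real 0)"
    by (rule integral_unique)
  hence zs: "s * (s + 1) / 2 * zeta_summand (Suc n) s = H 1 - H 0"
    unfolding zeta_summand_def by simp
  have rearrange: "B / 2 - D / q - (- (A / 2) - C / q) = (A + B) / 2 - (D - C) / q" for A B C D q :: complex
    by (simp add: diff_divide_distrib add_divide_distrib)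
  have E0: "E 0 = e (Suc n)" unfolding E_def e_def using Ln_of_nat[of "Suc n"] by simp
  have E1: "E 1 = e (Suc (Suc n))" unfolding E_def e_def using Ln_of_nat[of "Suc (Suc n)"] by (simp add: add_ac)
  have H0: "H 0 = - (e (Suc n) / 2) - of_nat (Suc n) * e (Suc n) / (1 - s)"
    by (simp add: H_def E0)
  have H1: "H 1 = e (Suc (Suc n)) / 2 - of_nat (Suc (Suc n)) * e (Suc (Suc n)) / (1 - s)"
    by (simp add: H_def E1 add_ac)
  have "s * (s + 1) / 2 * zeta_summand (Suc n) s =
     e (Suc (Suc n)) / 2 - of_nat (Suc (Suc n)) * e (Suc (Suc n)) / (1 - s) - (- (e (Suc n) / 2) - of_nat (Suc n) * e (Suc n) / (1 - s))"
    by (simp only: zs H0 H1)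
  also have "\<dots> = (e (Suc n) + e (Suc (Suc n))) / 2 - (of_nat (Suc (Suc n)) * e (Suc (Suc n)) - of_nat (Suc n) * e (Suc n)) / (1 - s)"
    by (rule rearrange)
  finally show ?thesis .
qed

lemma powr_complex_nat: "of_nat (Suc n) powr s = exp (s * of_real (ln (real (Suc n))))" for s :: complex
  using Ln_of_nat[of "Suc n"] by (simp add: powr_def del: of_nat_Suc)

lemma exp_ln_tendsto_0:
  assumes "Re s > 0"
  shows "(\<lambda>N. exp (- s * of_real (ln (real (Suc N))))) \<longlonglongrightarrow> 0"
proof -
  have "(\<lambda>N. real (Suc N) powr (- Re s)) \<longlonglongrightarrow> 0"
    using tendsto_neg_powr[OF _ filterlim_compose[OF filterlim_real_sequentially filterlim_Suc], of "- Re s"] assms by simp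
  thus ?thesis
    by (rule Lim_null_comparison[rotated]) (simp add: norm_exp_eq_Re powr_def)
qed

text \<open>The trapezoidal errors telescope: the partial sums of n^(-s) differ from those in
  \<open>zeta_right\<close> by boundary terms of order N^(-s) and N^(1-s), which tend to 0 for Re s
  > 1.\<close>

lemma zeta_right_sums:
  assumes "Re s > 1"
  shows "(\<lambda>n. of_nat (Suc n) powr (- s)) sums zeta_right s"
proof -
  define e where "e = (\<lambda>m. exp (- s * of_real (ln (real m))))"
  have s: "1 - s \<noteq> 0" "s \<noteq> 1" using assms by auto
  have rearrange: "X + 1 / 2 + A / 2 + (C - 1) / q = X + ((A + B) / 2 - (D - C) / q) + 1 / 2 - B / 2 + (D - 1) / q"
    for A B C D X q :: complex
    by (simp add: diff_divide_distrib add_divide_distrib)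
  have partial: "(\<Sum>n<N. e (Suc n)) = (\<Sum>n<N. s * (s + 1) / 2 * zeta_summand (Suc n) s)
     + 1 / 2 - e (Suc N) / 2 + (of_nat (Suc N) * e (Suc N) - 1) / (1 - s)" for N
  proof (induction N)
    case (Suc N)
    have "(\<Sum>n<Suc N. e (Suc n)) = (\<Sum>n<N. e (Suc n)) + e (Suc N)" by simp
    also have "\<dots> = (\<Sum>n<N. s * (s + 1) / 2 * zeta_summand (Suc n) s)
     + 1 / 2 + e (Suc N) / 2 + (of_nat (Suc N) * e (Suc N) - 1) / (1 - s)" by (simp add: Suc.IH)
    also have "\<dots> = (\<Sum>n<N. s * (s + 1) / 2 * zeta_summand (Suc n) s) + ((e (Suc N) + e (Suc (Suc N))) / 2 - (of_nat (Suc (Suc N)) * e (Suc (Suc N)) - of_nat (Suc N) * e (Suc N)) / (1 - s))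
     + 1 / 2 - e (Suc (Suc N)) / 2 + (of_nat (Suc (Suc N)) * e (Suc (Suc N)) - 1) / (1 - s)"
      by (rule rearrange)
    also have "(e (Suc N) + e (Suc (Suc N))) / 2 - (of_nat (Suc (Suc N)) * e (Suc (Suc N)) - of_nat (Suc N) * e (Suc N)) / (1 - s)
       = s * (s + 1) / 2 * zeta_summand (Suc N) s"
      unfolding e_def by (rule zeta_summand_trapezoid[symmetric]) (rule s)
    finally show ?case by (simp add: add_ac)
  qed (simp add: e_def s)
  have e0: "(\<lambda>N. e (Suc N)) \<longlonglongrightarrow> 0"
    unfolding e_def using assms by (intro exp_ln_tendsto_0) auto
  have "(\<lambda>N. exp (- (s - 1) * of_real (ln (real (Suc N))))) \<longlonglongrightarrow> 0"
    using assms by (intro exp_ln_tendsto_0) auto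
  also have "(\<lambda>N. exp (- (s - 1) * of_real (ln (real (Suc N))))) = (\<lambda>N. of_nat (Suc N) * e (Suc N))"
  proof
    fix N
    have "exp (- (s - 1) * of_real (ln (real (Suc N)))) = exp (of_real (ln (real (Suc N))) + - s * of_real (ln (real (Suc N))))"
      by (rule arg_cong[of _ _ exp]) (simp add: algebra_simps)
    also have "\<dots> = of_nat (Suc N) * e (Suc N)" unfolding e_def exp_add by (simp add: exp_of_real)
    finally show "exp (- (s - 1) * of_real (ln (real (Suc N)))) = of_nat (Suc N) * e (Suc N)" .
  qed
  finally have ne0: "(\<lambda>N. of_nat (Suc N) * e (Suc N)) \<longlonglongrightarrow> 0" .
  have "(\<lambda>n. s * (s + 1) / 2 * zeta_summand (Suc n) s) sums (s * (s + 1) / 2 * (\<Sum>n. zeta_summand (Suc n) s))"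
    using assms by (intro sums_mult summable_sums summable_zeta_summand) auto
  hence lim: "(\<lambda>N. \<Sum>n<N. s * (s + 1) / 2 * zeta_summand (Suc n) s) \<longlonglongrightarrow> s * (s + 1) / 2 * (\<Sum>n. zeta_summand (Suc n) s)"
    by (simp only: sums_def)
  have "(\<lambda>N. \<Sum>n<N. e (Suc n)) \<longlonglongrightarrow> s * (s + 1) / 2 * (\<Sum>n. zeta_summand (Suc n) s) + 1 / 2 - 0 / 2 + (0 - 1) / (1 - s)"
    unfolding partial by (rule tendsto_add tendsto_diff tendsto_divide tendsto_const lim e0 ne0 s zero_neq_numeral[symmetric])+
  also have "s * (s + 1) / 2 * (\<Sum>n. zeta_summand (Suc n) s) + 1 / 2 - 0 / 2 + (0 - 1) / (1 - s) = zeta_right s"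
  proof -
    have "(0 - 1) / (1 - s) = 1 / (s - 1)" using s by (simp add: field_simps)
    thus ?thesis by (simp add: zeta_right_def)
  qed
  finally show ?thesis unfolding sums_def e_def powr_complex_nat .
qed

text \<open>The series of remainders is bounded on the strip, so all growth comes from the factor s
  (s + 1) / 2, each linear factor of which is granted half of \<open>\<epsilon>\<close>.\<close>

lemma strip_growth_zeta_right:
  assumes "0 < \<epsilon>" "- 1 < a"
  shows "strip_growth zeta_right a b \<epsilon>"
proof -
  define S where "S = (\<lambda>s. \<Sum>n. zeta_summand (Suc n) s)"
  have S: "strip_growth S a b 0"
  proof (rule strip_growthI[where C = "\<Sum>n. real (Suc n) powr (- (a + 2))"])
    fix s assume s: "a \<le> Re s"
    have sum: "summable (\<lambda>n. real (Suc n) powr (- (a + 2)))" using assms by (intro summable_Suc_powr) auto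
    have le: "norm (zeta_summand (Suc n) s) \<le> real (Suc n) powr (- (a + 2))" for n
    proof -
      have "norm (zeta_summand (Suc n) s) \<le> real (Suc n) powr (- (Re s + 2))"
        using s assms by (intro norm_zeta_summand_le) auto
      also have "\<dots> \<le> real (Suc n) powr (- (a + 2))" using s by (intro powr_mono) auto
      finally show ?thesis .
    qed
    have "norm (S s) \<le> (\<Sum>n. real (Suc n) powr (- (a + 2)))"
      unfolding S_def by (rule norm_suminf_le) (use sum le in auto)
    thus "norm (S s) \<le> (\<Sum>n. real (Suc n) powr (- (a + 2))) * exp (0 * \<bar>Im s\<bar>)" by simp
  qed
  have "strip_growth (\<lambda>s. s * (s + of_real 1) * (1 / 2)) a b (\<epsilon> / 2 + \<epsilon> / 2 + 0)"
    using assms strip_growth_shift[OF strip_growth_ident[of "\<epsilon> / 2"], where a = a and b = b and c = 1]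
    by (intro strip_growth_mult strip_growth_ident strip_growth_const) auto
  hence "strip_growth (\<lambda>s. s * (s + of_real 1) * (1 / 2) * S s) a b (\<epsilon> / 2 + \<epsilon> / 2 + 0 + 0)"
    using S by (rule strip_growth_mult)
  hence 1: "strip_growth (\<lambda>s. s * (s + 1) / 2 * S s) a b \<epsilon>" by simp
  have "strip_growth (\<lambda>s. 1 / (s - 1)) a b \<epsilon>"
  proof (rule strip_growth_cong[OF strip_growth_const[of \<epsilon> 1]])
    fix s assume "1 \<le> \<bar>Im s\<bar>"
    hence "1 \<le> norm (s - 1)" using abs_Im_le_cmod[of "s - 1"] by simp
    thus "norm (1 / (s - 1)) \<le> norm (1::complex)" by (simp add: norm_divide divide_simps)
  qed (use assms in auto)
  with 1 have "strip_growth (\<lambda>s. 1 / (s - 1) + 1 / 2 + s * (s + 1) / 2 * S s) a b \<epsilon>"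
    using assms by (intro strip_growth_add strip_growth_const) auto
  thus ?thesis by (simp add: zeta_right_def[abs_def] S_def)
qed

section \<open>Gamma integrals in a form suited to Tonelli's theorem\<close>

lemma Gamma_integral_substitution:
  fixes g g' :: "real \<Rightarrow> real"
  assumes "\<sigma> > 0" and img: "g ` {0<..} = {0<..}" and inj: "inj_on g {0<..}"
    and g: "\<And>w. w > 0 \<Longrightarrow> (g has_field_derivative g' w) (at w within {0<..})"
  shows "((\<lambda>w. \<bar>g' w\<bar> * (g w powr (\<sigma> - 1) / exp (g w))) has_integral Gamma \<sigma>) {0<..}"
proof -
  let ?f = "\<lambda>t::real. t powr (\<sigma> - 1) / exp t"
  have "(?f has_integral Gamma \<sigma>) {0..}" by (rule Gamma_integral_real[OF assms(1)])
  hence hi: "(?f has_integral Gamma \<sigma>) {0<..}"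
    by (subst (asm) has_integral_spike_set_eq[where T = "{0<..}"]) (auto intro: negligible_subset[of "{0}"])
  hence "?f absolutely_integrable_on {0<..}"
    by (intro nonnegative_absolutely_integrable_1) (auto simp: integrable_on_def)
  hence "(\<lambda>w. \<bar>g' w\<bar> * ?f (g w)) absolutely_integrable_on {0<..} \<and> integral {0<..} (\<lambda>w. \<bar>g' w\<bar> * ?f (g w)) = Gamma \<sigma>"
    using hi img inj g by (subst has_absolute_integral_change_of_variables_1') (auto simp: integral_unique)
  thus ?thesis by (auto simp: has_integral_iff dest: set_lebesgue_integral_eq_integral(1))
qed

lemma nn_integral_Gamma_scaled:
  assumes "\<sigma> > 0" "c > (0::real)"
  shows "(\<integral>\<^sup>+w. ennreal (indicator {0<..} w * (w powr (\<sigma> - 1) * exp (- c * w))) \<partial>lborel) = ennreal (Gamma \<sigma> * c powr (-\<sigma>))"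
proof -
  let ?f = "\<lambda>t::real. t powr (\<sigma> - 1) / exp t"
  have img: "(\<lambda>w. c * w) ` {0<..} = {0<..}"
  proof safe
    fix y :: real assume "y > 0"
    thus "y \<in> (\<lambda>w. c * w) ` {0<..}" using assms by (intro image_eqI[of _ _ "y / c"]) auto
  qed (use assms in auto)
  have "((\<lambda>w. \<bar>c\<bar> * ?f (c * w)) has_integral Gamma \<sigma>) {0<..}"
    using assms by (intro Gamma_integral_substitution[OF _ img]) (auto intro!: derivative_eq_intros simp: inj_on_def)
  hence "((\<lambda>w. c powr (-\<sigma>) * (\<bar>c\<bar> * ?f (c * w))) has_integral c powr (-\<sigma>) * Gamma \<sigma>) {0<..}"
    by (rule has_integral_mult_right)
  hence "((\<lambda>w. w powr (\<sigma> - 1) * exp (- c * w)) has_integral c powr (-\<sigma>) * Gamma \<sigma>) {0<..}"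
  proof (rule has_integral_eq[rotated])
    fix w :: real assume "w \<in> {0<..}"
    moreover have "c powr (-\<sigma>) * (c * c powr (\<sigma> - 1)) = 1"
      using assms powr_add[of c 1 "\<sigma> - 1"] powr_add[of c "-\<sigma>" \<sigma>] by simp
    moreover have "c powr (-\<sigma>) * (\<bar>c\<bar> * ?f (c * w)) = (c powr (-\<sigma>) * (c * c powr (\<sigma> - 1))) * (w powr (\<sigma> - 1) * exp (- c * w))"
      if "w > 0" using assms that by (simp add: powr_mult exp_minus divide_inverse mult_ac)
    ultimately show "c powr (-\<sigma>) * (\<bar>c\<bar> * ?f (c * w)) = w powr (\<sigma> - 1) * exp (- c * w)" by simp
  qed
  from nn_integral_has_integral_lebesgue[OF _ this] show ?thesis by (simp add: mult.commute)
qed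

lemma nn_integral_Gamma_square:
  assumes "\<sigma> > 0" "c > (0::real)"
  shows "(\<integral>\<^sup>+w. ennreal (indicator {0<..} w * (w powr (2 * \<sigma> - 1) * exp (- c * w\<^sup>2))) \<partial>lborel) = ennreal (Gamma \<sigma> * c powr (-\<sigma>) / 2)"
proof -
  let ?f = "\<lambda>t::real. t powr (\<sigma> - 1) / exp t"
  have img: "(\<lambda>w. c * w\<^sup>2) ` {0<..} = {0<..}"
  proof safe
    fix y :: real assume "y > 0"
    thus "y \<in> (\<lambda>w. c * w\<^sup>2) ` {0<..}" using assms by (intro image_eqI[of _ _ "sqrt (y / c)"]) auto
  qed (use assms in auto)
  have "((\<lambda>w. \<bar>2 * c * w\<bar> * ?f (c * w\<^sup>2)) has_integral Gamma \<sigma>) {0<..}"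
    using assms by (intro Gamma_integral_substitution[OF _ img]) (auto intro!: derivative_eq_intros simp: inj_on_def)
  hence "((\<lambda>w. c powr (-\<sigma>) / 2 * (\<bar>2 * c * w\<bar> * ?f (c * w\<^sup>2))) has_integral c powr (-\<sigma>) / 2 * Gamma \<sigma>) {0<..}"
    by (rule has_integral_mult_right)
  hence "((\<lambda>w. w powr (2 * \<sigma> - 1) * exp (- c * w\<^sup>2)) has_integral c powr (-\<sigma>) / 2 * Gamma \<sigma>) {0<..}"
  proof (rule has_integral_eq[rotated])
    fix w :: real assume w: "w \<in> {0<..}"
    have 1: "c powr (-\<sigma>) * (c * c powr (\<sigma> - 1)) = 1"
      using assms powr_add[of c 1 "\<sigma> - 1"] powr_add[of c "-\<sigma>" \<sigma>] by simp
    have "w\<^sup>2 powr (\<sigma> - 1) = w powr (2 * (\<sigma> - 1))"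
      using w powr_powr[of w 2 "\<sigma> - 1"] by simp
    hence 2: "w * w\<^sup>2 powr (\<sigma> - 1) = w powr (2 * \<sigma> - 1)"
      using w powr_add[of w 1 "2 * (\<sigma> - 1)"] by (simp add: algebra_simps)
    have f: "?f (c * w\<^sup>2) = c powr (\<sigma> - 1) * w\<^sup>2 powr (\<sigma> - 1) * exp (- c * w\<^sup>2)"
      using assms w by (simp add: powr_mult exp_minus field_simps)
    have "c powr (-\<sigma>) / 2 * (\<bar>2 * c * w\<bar> * ?f (c * w\<^sup>2)) = (c powr (-\<sigma>) * (c * c powr (\<sigma> - 1))) * (w * w\<^sup>2 powr (\<sigma> - 1)) * exp (- c * w\<^sup>2)"
      unfolding f using assms w by (simp add: abs_mult mult_ac)
    also have "\<dots> = w powr (2 * \<sigma> - 1) * exp (- c * w\<^sup>2)" unfolding 1 2 by simp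
    finally show "c powr (-\<sigma>) / 2 * (\<bar>2 * c * w\<bar> * ?f (c * w\<^sup>2)) = w powr (2 * \<sigma> - 1) * exp (- c * w\<^sup>2)" .
  qed
  from nn_integral_has_integral_lebesgue[OF _ this] show ?thesis by (simp add: mult.commute)
qed

text \<open>The quotient 1 / (w^2 + a^2) is the integral of exp(-x (w^2 + a^2)) over x > 0. After
  the interchange both integrations are Gamma integrals, whose arguments are positive because -1 < s
  < 1.\<close>

lemma nn_integral_powr_div_quadratic:
  assumes "-1 < s" "s < 1" "a > (0::real)"
  shows "(\<integral>\<^sup>+w. ennreal (indicator {0<..} w * (w powr s / (w\<^sup>2 + a\<^sup>2))) \<partial>lborel)
     = ennreal (Gamma ((1 + s) / 2) * Gamma ((1 - s) / 2) / 2 * a powr (s - 1))"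
proof -
  let ?J = "\<lambda>w x :: real. ennreal (indicator {0<..} w * w powr s * (indicator {0<..} x * exp (- (w\<^sup>2 + a\<^sup>2) * x)))"
  let ?Q = "\<lambda>w :: real. ennreal (indicator {0<..} w * (w powr s / (w\<^sup>2 + a\<^sup>2)))"
  have "(\<integral>\<^sup>+w. ?Q w \<partial>lborel)
     = (\<integral>\<^sup>+w. (\<integral>\<^sup>+x. ?J w x \<partial>lborel) \<partial>lborel)"
  proof (rule nn_integral_cong)
    fix w :: real
    have pos: "w\<^sup>2 + a\<^sup>2 > 0" using assms by (simp add: add_nonneg_pos)
    have "(\<integral>\<^sup>+x. ?J w x \<partial>lborel)
       = ennreal (indicator {0<..} w * w powr s) * (\<integral>\<^sup>+x. ennreal (indicator {0<..} x * (x powr (1 - 1) * exp (- (w\<^sup>2 + a\<^sup>2) * x))) \<partial>lborel)"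
      by (subst nn_integral_cmult[symmetric]) (auto intro!: nn_integral_cong simp: ennreal_mult'[symmetric] indicator_def)
    also have "\<dots> = ennreal (indicator {0<..} w * w powr s) * ennreal (Gamma 1 * (w\<^sup>2 + a\<^sup>2) powr (-1))"
      by (subst nn_integral_Gamma_scaled) (use pos in auto)
    also have "\<dots> = ?Q w"
      using pos by (simp add: ennreal_mult'[symmetric] powr_minus field_simps)
    finally show "?Q w = (\<integral>\<^sup>+x. ?J w x \<partial>lborel)" ..
  qed
  also have "\<dots> = (\<integral>\<^sup>+x. (\<integral>\<^sup>+w. ?J w x \<partial>lborel) \<partial>lborel)"
    by (rule lborel_pair.Fubini') measurable
  also have "\<dots> = (\<integral>\<^sup>+x. ennreal (Gamma ((1 + s) / 2) / 2) * ennreal (indicator {0<..} x * (x powr ((1 - s) / 2 - 1) * exp (- a\<^sup>2 * x))) \<partial>lborel)"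
  proof (rule nn_integral_cong)
    fix x :: real
    show "(\<integral>\<^sup>+w. ?J w x \<partial>lborel)
      = ennreal (Gamma ((1 + s) / 2) / 2) * ennreal (indicator {0<..} x * (x powr ((1 - s) / 2 - 1) * exp (- a\<^sup>2 * x)))"
    proof (cases "x > 0")
      case True
      have "(\<integral>\<^sup>+w. ?J w x \<partial>lborel)
        = (\<integral>\<^sup>+w. ennreal (exp (- a\<^sup>2 * x)) * ennreal (indicator {0<..} w * (w powr (2 * ((1 + s) / 2) - 1) * exp (- x * w\<^sup>2))) \<partial>lborel)"
        using True by (intro nn_integral_cong) (auto simp: ennreal_mult'[symmetric] indicator_def algebra_simps exp_diff exp_minus divide_simps mult_exp_exp)
      also have "\<dots> = ennreal (exp (- a\<^sup>2 * x)) * ennreal (Gamma ((1 + s) / 2) * x powr (- ((1 + s) / 2)) / 2)"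
        by (subst nn_integral_cmult, measurable, subst nn_integral_Gamma_square) (use assms True in auto)
      also have "- ((1 + s) / 2) = (1 - s) / 2 - 1" by (simp add: field_simps)
      also have "ennreal (exp (- a\<^sup>2 * x)) * ennreal (Gamma ((1 + s) / 2) * x powr ((1 - s) / 2 - 1) / 2) =
         ennreal (Gamma ((1 + s) / 2) / 2) * ennreal (indicator {0<..} x * (x powr ((1 - s) / 2 - 1) * exp (- a\<^sup>2 * x)))"
        using True assms by (subst (1 2) ennreal_mult'[symmetric]) (auto intro!: less_imp_le[OF Gamma_real_pos] simp: mult_ac)
      finally show ?thesis .
    qed auto
  qed
  also have "\<dots> = ennreal (Gamma ((1 + s) / 2) / 2) * ennreal (Gamma ((1 - s) / 2) * a\<^sup>2 powr (- ((1 - s) / 2)))"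
    by (subst nn_integral_cmult, measurable, subst nn_integral_Gamma_scaled) (use assms in auto)
  also have "a\<^sup>2 powr (- ((1 - s) / 2)) = a powr (2 * (- ((1 - s) / 2)))"
    using assms powr_powr[of a 2 "- ((1 - s) / 2)"] by simp
  also have "2 * (- ((1 - s) / 2)) = s - 1" by (simp add: field_simps)
  finally show ?thesis using assms
    by (subst (asm) ennreal_mult'[symmetric]) (auto intro!: less_imp_le[OF Gamma_real_pos] simp: mult_ac)
qed

section \<open>Partial fractions of the cotangent and the hyperbolic cotangent\<close>

text \<open>Logarithmic differentiation of \<open>\<Gamma>(1 + z) \<Gamma>(1 - z) sin (\<pi> z) = \<pi> z\<close> gives the partial fractions of the cotangent.\<close>
lemma cot_partial_fractions:
  fixes z :: complex
  assumes "z \<notin> \<int>"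
  shows "(\<lambda>n. 2 * z / ((of_nat (Suc n))\<^sup>2 - z\<^sup>2)) sums (1 / z - of_real pi * cot (of_real pi * z))"
proof -
  let ?d = "\<lambda>n. (inverse (of_nat (Suc n)) - inverse (1 + z + of_nat n)) - (inverse (of_nat (Suc n)) - inverse (1 - z + of_nat n))"
  define f :: "complex \<Rightarrow> complex" where "f = (\<lambda>z. Gamma (1 + z) * Gamma (1 - z) * sin (of_real pi * z))"
  have nonint: "1 + w \<notin> \<int>\<^sub>\<le>\<^sub>0" "1 - w \<notin> \<int>\<^sub>\<le>\<^sub>0" if "w \<notin> \<int>" for w :: complex
    using that by (auto elim!: nonpos_Ints_cases simp: algebra_simps add_eq_0_iff minus_equation_iff)
       (metis Ints_of_int Ints_diff Ints_1 add_diff_cancel_left' diff_diff_eq2 add.commute diff_add_cancel)+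
  have sin_pi_nonzero: "sin (of_real pi * w) \<noteq> 0" if "w \<notin> \<int>" for w :: complex
  proof
    assume "sin (of_real pi * w) = 0"
    then obtain n :: int where "of_real pi * w = of_real (real_of_int n * pi)"
      unfolding Complex_Transcendental.sin_eq_0 by blast
    hence "of_real pi * w = of_real pi * of_int n" by simp
    hence "w = of_int n" by (simp only: mult_cancel_left) simp
    thus False using that by simp
  qed
  have z0: "z \<noteq> 0" using assms by auto
  have sin0: "sin (of_real pi * z) \<noteq> 0" by (rule sin_pi_nonzero) fact
  have "open (- \<int> :: complex set)" by (simp add: open_Compl)
  have feq: "f w = of_real pi * w" if "w \<in> - \<int>" for w
  proof -
    have w: "w \<notin> \<int>\<^sub>\<le>\<^sub>0" "w \<noteq> 0" "sin (of_real pi * w) \<noteq> 0"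
      using that sin_pi_nonzero by (auto elim!: nonpos_Ints_cases)
    have "f w = w * (Gamma w * Gamma (1 - w)) * sin (of_real pi * w)"
      using Gamma_plus1[OF w(1)] by (simp add: f_def add.commute)
    thus ?thesis using w by (simp add: Gamma_reflection_complex)
  qed
  have d1: "(f has_field_derivative of_real pi) (at z)"
  proof (rule has_field_derivative_transform_within_open[where S = "- \<int>"])
    show "((\<lambda>w. of_real pi * w) has_field_derivative of_real pi) (at z)" by (auto intro!: derivative_eq_intros)
  qed (use assms feq \<open>open (- \<int> :: complex set)\<close> in auto)
  have G: "((\<lambda>w. Gamma (1 + w)) has_field_derivative Gamma (1 + z) * Digamma (1 + z)) (at z)"
    "((\<lambda>w. Gamma (1 - w)) has_field_derivative - (Gamma (1 - z) * Digamma (1 - z))) (at z)"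
    using nonint[OF assms] by (auto intro!: derivative_eq_intros)
  have S: "((\<lambda>w. sin (of_real pi * w)) has_field_derivative cos (of_real pi * z) * of_real pi) (at z)"
    by (auto intro!: derivative_eq_intros)
  have d2: "(f has_field_derivative
     (Gamma (1 + z) * Digamma (1 + z) * Gamma (1 - z) + - (Gamma (1 - z) * Digamma (1 - z)) * Gamma (1 + z)) * sin (of_real pi * z)
      + cos (of_real pi * z) * of_real pi * (Gamma (1 + z) * Gamma (1 - z))) (at z)"
    unfolding f_def by (rule DERIV_mult[OF DERIV_mult[OF G] S])
  have cot: "cos (of_real pi * z) = sin (of_real pi * z) * cot (of_real pi * z)"
    using sin0 by (simp add: cot_def)
  from DERIV_unique[OF d1 d2] have
    "of_real pi = f z * (Digamma (1 + z) - Digamma (1 - z) + of_real pi * cot (of_real pi * z))"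
    unfolding f_def cot by (simp add: algebra_simps)
  hence psi: "Digamma (1 + z) - Digamma (1 - z) = 1 / z - of_real pi * cot (of_real pi * z)"
  proof -
    assume *: "of_real pi = f z * (Digamma (1 + z) - Digamma (1 - z) + of_real pi * cot (of_real pi * z))"
    define X where "X = Digamma (1 + z) - Digamma (1 - z) + of_real pi * cot (of_real pi * z)"
    have "of_real pi * 1 = of_real pi * (z * X)" using * assms by (simp add: feq X_def mult.assoc)
    hence "z * X = 1" by (simp only: mult_cancel_left) simp
    hence "X = 1 / z" using z0 by (simp add: field_simps)
    thus ?thesis by (simp add: X_def algebra_simps)
  qed
  have nz: "1 + z \<noteq> 0" "1 - z \<noteq> 0" using nonint[OF assms] by auto
  \<comment> \<open>Both Digamma series are regularised by the same terms 1 / (n + 1), and the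
    Euler-Mascheroni constants cancel, so the difference is the plain series of partial
    fractions.\<close>
  have "(\<lambda>n. ?d n)
     sums ((Digamma (1 + z) + euler_mascheroni) - (Digamma (1 - z) + euler_mascheroni))"
    using summable_sums[OF summable_Digamma[OF nz(1)]] summable_sums[OF summable_Digamma[OF nz(2)]]
    by (intro sums_diff) (simp_all add: Digamma_def)
  also have "(\<lambda>n. ?d n)
     = (\<lambda>n. 2 * z / ((of_nat (Suc n))\<^sup>2 - z\<^sup>2))"
  proof
    fix n
    have "z = - of_nat (Suc n) \<Longrightarrow> z \<in> \<int>" "z = of_nat (Suc n) \<Longrightarrow> z \<in> \<int>" by (simp_all del: of_nat_Suc)
    hence "of_nat (Suc n) + z \<noteq> 0" "of_nat (Suc n) - z \<noteq> 0"
      using assms by (auto simp only: add_eq_0_iff right_minus_eq)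
    moreover have "(of_nat (Suc n))\<^sup>2 - z\<^sup>2 = (of_nat (Suc n) + z) * (of_nat (Suc n) - z)"
      by (simp add: power2_eq_square algebra_simps)
    moreover have "inverse (b - z) - inverse (b + z) = 2 * z / ((b + z) * (b - z))" if "b + z \<noteq> 0" "b - z \<noteq> 0" for b
      using that by (simp add: divide_simps)
    ultimately have "inverse (of_nat (Suc n) - z) - inverse (of_nat (Suc n) + z) = 2 * z / ((of_nat (Suc n))\<^sup>2 - z\<^sup>2)"
      by simp
    thus "?d n
      = 2 * z / ((of_nat (Suc n))\<^sup>2 - z\<^sup>2)" by (simp add: algebra_simps)
  qed
  finally show ?thesis by (simp add: psi)
qed

text \<open>The cotangent expansion is taken at z = i w / (2 pi) and multiplied by -i / (pi w^2).
  The limit is the Laplace transform of the 1-periodic continuation of v (1 - v).\<close>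

lemma coth_partial_fractions:
  fixes w :: real
  assumes "w > 0"
  shows "(\<lambda>n. 4 / (w * (w\<^sup>2 + (2 * pi * real (Suc n))\<^sup>2))) sums
     ((1 + exp (- w)) / (w\<^sup>2 * (1 - exp (- w))) - 2 / w ^ 3)"
proof -
  define y where "y = w / (2 * pi)"
  have y: "y > 0" using assms by (simp add: y_def)
  have w: "w = 2 * pi * y" by (simp add: y_def)
  define z where "z = \<i> * complex_of_real y"
  have "z \<notin> \<int>" using y by (auto simp: z_def complex_eq_iff elim!: Ints_cases)
  from cot_partial_fractions[OF this]
  have "(\<lambda>n. 2 * z / ((of_nat (Suc n))\<^sup>2 - z\<^sup>2)) sums (1 / z - of_real pi * cot (of_real pi * z))" .
  hence "(\<lambda>n. - \<i> / of_real (pi * w\<^sup>2) * (2 * z / ((of_nat (Suc n))\<^sup>2 - z\<^sup>2)))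
     sums (- \<i> / of_real (pi * w\<^sup>2) * (1 / z - of_real pi * cot (of_real pi * z)))"
    by (rule sums_mult)
  also have "(\<lambda>n. - \<i> / of_real (pi * w\<^sup>2) * (2 * z / ((of_nat (Suc n))\<^sup>2 - z\<^sup>2))) = (\<lambda>n. of_real (4 / (w * (w\<^sup>2 + (2 * pi * real (Suc n))\<^sup>2))))"
  proof
    fix n
    define m where "m = real (Suc n)"
    have m: "m > 0" by (simp add: m_def)
    have "(of_nat (Suc n))\<^sup>2 - z\<^sup>2 = complex_of_real (m\<^sup>2 + y\<^sup>2)"
      by (simp add: z_def m_def power_mult_distrib)
    moreover have "- \<i> * (2 * z) = of_real (2 * y)" by (simp add: z_def)
    ultimately have "- \<i> / of_real (pi * w\<^sup>2) * (2 * z / ((of_nat (Suc n))\<^sup>2 - z\<^sup>2)) = of_real (2 * y / (pi * w\<^sup>2 * (m\<^sup>2 + y\<^sup>2)))"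
      by (simp only: times_divide_times_eq of_real_mult of_real_divide)
    also have "2 * y / (pi * w\<^sup>2 * (m\<^sup>2 + y\<^sup>2)) = 4 / (w * (w\<^sup>2 + (2 * pi * m)\<^sup>2))"
    proof -
      define N where "N = m\<^sup>2 + y\<^sup>2"
      have "N > 0" using m by (simp add: N_def add_pos_nonneg)
      moreover have N: "w\<^sup>2 + (2 * pi * m)\<^sup>2 = 4 * pi\<^sup>2 * N" by (simp add: N_def w power2_eq_square algebra_simps)
      ultimately show ?thesis unfolding N N_def[symmetric] using y by (simp add: w power2_eq_square)
    qed
    finally show "- \<i> / of_real (pi * w\<^sup>2) * (2 * z / ((of_nat (Suc n))\<^sup>2 - z\<^sup>2)) = of_real (4 / (w * (w\<^sup>2 + (2 * pi * real (Suc n))\<^sup>2)))"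
      by (simp add: m_def)
  qed
  also have "- \<i> / of_real (pi * w\<^sup>2) * (1 / z - of_real pi * cot (of_real pi * z)) =
     of_real ((1 + exp (- w)) / (w\<^sup>2 * (1 - exp (- w))) - 2 / w ^ 3)"
  proof -
    define e where "e = exp (- w)"
    have e: "e < 1" "e > 0" using assms by (auto simp: e_def)
    define h where "h = exp (w / 2)"
    have h: "h > 0" "e = inverse (h * h)" by (auto simp: h_def e_def exp_minus simp flip: exp_add)
    have pz: "of_real pi * z = \<i> * of_real (w / 2)" by (simp add: z_def w)
    have E: "exp (\<i> * (of_real pi * z)) = of_real (inverse h)" "exp (- (\<i> * (of_real pi * z))) = of_real h"
      by (simp_all add: pz h_def exp_minus exp_of_real[symmetric])
    have "h * h > 1" using assms by (simp add: h_def flip: exp_add)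
    have hh: "complex_of_real h * of_real h \<noteq> 1" 
      using \<open>h * h > 1\<close> by (metis less_irrefl of_real_1 of_real_eq_iff of_real_mult)
    have "cot (of_real pi * z) = - \<i> * of_real ((1 + e) / (1 - e))"
      unfolding cot_def cos_exp_eq sin_exp_eq E h(2) using h(1) hh by (simp add: field_simps)
    moreover define q where "q = (1 + e) / (1 - e)"
    ultimately have cot: "cot (of_real pi * z) = - \<i> * of_real q" by simp
    have "1 / z = - \<i> * of_real (1 / y)" using y by (simp add: z_def divide_simps)
    hence "1 / z - of_real pi * cot (of_real pi * z) = \<i> * of_real (pi * q - 1 / y)"
      unfolding cot by (simp add: algebra_simps)
    moreover have "- \<i> / A * (\<i> * B) = B / A" for A B :: complex by simp
    ultimately have "- \<i> / of_real (pi * w\<^sup>2) * (1 / z - of_real pi * cot (of_real pi * z)) = of_real ((pi * q - 1 / y) / (pi * w\<^sup>2))"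
      by (simp only: of_real_divide)
    also have "(pi * q - 1 / y) / (pi * w\<^sup>2) = q / w\<^sup>2 - 2 / w ^ 3"
      using y by (simp add: w field_simps power3_eq_cube power2_eq_square)
    also have "q / w\<^sup>2 = (1 + e) / (w\<^sup>2 * (1 - e))" by (simp add: q_def)
    finally show ?thesis unfolding e_def .
  qed
  finally show ?thesis by (subst (asm) sums_of_real_iff)
qed

section \<open>The functional equation on the real interval (-1, 0)\<close>

text \<open>
  For \<open>-1 < s < 0\<close> one has \<open>\<zeta>(s) = s (s + 1) / 2 \<integral>\<^sub>0\<^sup>\<infinity> \<psi>(y) y\<^sup>-\<^sup>s\<^sup>-\<^sup>2 dy\<close>, where \<open>\<psi>\<close> is the 1-periodic
  continuation of \<open>v (1 - v)\<close>. Writing \<open>y\<^sup>-\<^sup>s\<^sup>-\<^sup>2\<close> as a Laplace integral and the Laplace transform of \<open>\<psi>\<close>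
  as a series of partial fractions yields the functional equation; all terms are nonnegative, so
  Tonelli's theorem justifies every interchange.
\<close>
lemma nn_integral_parabola_exp:
  assumes "w > (0::real)"
  shows "(\<integral>\<^sup>+v. ennreal (indicator {0..1} v * (v * (1 - v) * exp (- (w * v)))) \<partial>lborel)
     = ennreal ((1 + exp (- w)) / w\<^sup>2 - 2 * (1 - exp (- w)) / w ^ 3)"
proof (rule nn_integral_has_integral_lebesgue)
  define F where "F = (\<lambda>v. - exp (- (w * v)) * ((v - v\<^sup>2) / w + (1 - 2 * v) / w\<^sup>2 - 2 / w ^ 3))"
  have "((\<lambda>v. v * (1 - v) * exp (- (w * v))) has_integral (F 1 - F 0)) {0..1}"
  proof (rule fundamental_theorem_of_calculus)
    fix v :: real
    have dE: "((\<lambda>v. - exp (- (w * v))) has_real_derivative w * exp (- (w * v))) (at v)"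
      by (auto intro!: derivative_eq_intros)
    have dP: "((\<lambda>v. (v - v\<^sup>2) / w + (1 - 2 * v) / w\<^sup>2 - 2 / w ^ 3) has_real_derivative (1 - 2 * v) / w + - 2 / w\<^sup>2 - 0) (at v)"
      using assms by (intro DERIV_add DERIV_diff DERIV_cdivide DERIV_const) (auto intro!: derivative_eq_intros)
    have "w * ((v - v\<^sup>2) / w + (1 - 2 * v) / w\<^sup>2 - 2 / w ^ 3) = (v - v\<^sup>2) + ((1 - 2 * v) / w + - 2 / w\<^sup>2 - 0)"
      using assms by (simp add: field_simps power2_eq_square power3_eq_cube)
    moreover have "w * E * P + P' * - E = v * (1 - v) * E" if "w * P = (v - v\<^sup>2) + P'" for E P P'
    proof -
      have "w * E * P + P' * - E = E * (w * P - P')" by (simp add: algebra_simps)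
      thus ?thesis unfolding that by (simp add: power2_eq_square algebra_simps)
    qed
    ultimately have "w * exp (- (w * v)) * ((v - v\<^sup>2) / w + (1 - 2 * v) / w\<^sup>2 - 2 / w ^ 3) + ((1 - 2 * v) / w + - 2 / w\<^sup>2 - 0) * - exp (- (w * v))
      = v * (1 - v) * exp (- (w * v))" by blast
    hence "(F has_real_derivative v * (1 - v) * exp (- (w * v))) (at v)"
      using DERIV_mult[OF dE dP] unfolding F_def by simp
    thus "(F has_vector_derivative v * (1 - v) * exp (- (w * v))) (at v within {0..1})"
      unfolding has_real_derivative_iff_has_vector_derivative by (rule has_vector_derivative_at_within)
  qed auto
  also have "F 1 - F 0 = (1 + exp (- w)) / w\<^sup>2 - 2 * (1 - exp (- w)) / w ^ 3"
    by (simp add: F_def diff_divide_distrib add_divide_distrib algebra_simps)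
  finally show "((\<lambda>v. v * (1 - v) * exp (- (w * v))) has_integral ((1 + exp (- w)) / w\<^sup>2 - 2 * (1 - exp (- w)) / w ^ 3)) {0..1}" .
qed auto

context
  fixes s :: real
  assumes s: "-1 < s" "s < 0"
begin

lemma zeta_summand_of_real:
  "zeta_summand (Suc n) (of_real s) = of_real (integral {0..1} (\<lambda>v. v * (1 - v) * (real (Suc n) + v) powr (- s - 2)))"
proof -
  have "((\<lambda>v. v * (1 - v) * (real (Suc n) + v) powr (- s - 2)) has_integral
      integral {0..1} (\<lambda>v. v * (1 - v) * (real (Suc n) + v) powr (- s - 2))) {0..1}"
    by (intro integrable_integral integrable_continuous_real continuous_intros) auto
  from has_integral_of_real[OF this, where 'b = complex]
  have "((\<lambda>v. complex_of_real (v * (1 - v)) * exp (- (of_real s + 2) * of_real (ln (real (Suc n) + v)))) has_integral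
      of_real (integral {0..1} (\<lambda>v. v * (1 - v) * (real (Suc n) + v) powr (- s - 2)))) {0..1}"
  proof (rule has_integral_eq[rotated])
    fix v :: real assume v: "v \<in> {0..1}"
    have "complex_of_real ((real (Suc n) + v) powr (- s - 2)) = of_real (exp ((- s - 2) * ln (real (Suc n) + v)))"
      using v by (simp add: powr_def)
    also have "\<dots> = exp (of_real ((- s - 2) * ln (real (Suc n) + v)))" by (rule exp_of_real[symmetric])
    also have "complex_of_real ((- s - 2) * ln (real (Suc n) + v)) = - (of_real s + 2) * of_real (ln (real (Suc n) + v))"
      by (simp add: algebra_simps)
    finally show "of_real (v * (1 - v) * (real (Suc n) + v) powr (- s - 2)) =
        complex_of_real (v * (1 - v)) * exp (- (of_real s + 2) * of_real (ln (real (Suc n) + v)))" by simp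
  qed
  thus ?thesis unfolding zeta_summand_def by (rule integral_unique)
qed

lemma nn_zeta_summand_Suc:
  "(\<integral>\<^sup>+v. ennreal (indicator {0..1} v * (v * (1 - v) * (real (Suc n) + v) powr (- s - 2))) \<partial>lborel) = ennreal (Re (zeta_summand (Suc n) (of_real s)))"
  unfolding zeta_summand_of_real Re_complex_of_real
  by (intro nn_integral_has_integral_lebesgue integrable_integral integrable_continuous_real continuous_intros) auto

lemma Re_zeta_summand_nonneg: "Re (zeta_summand (Suc n) (of_real s)) \<ge> 0"
  unfolding zeta_summand_of_real Re_complex_of_real
  by (intro integral_nonneg integrable_continuous_real continuous_intros) auto

text \<open>The interval (0, 1] does not occur in \<open>zeta_right\<close>. Multiplied by s (s + 1)
  / 2 its integral equals 1 / (s - 1) + 1 / 2, the two extra terms there, so including it turns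
  \<open>zeta_right\<close> into one integral over y > 0. Convergence at 0 needs s < 0.\<close>

lemma nn_zeta_summand_0:
  "(\<integral>\<^sup>+v. ennreal (indicator {0..1} v * (v * (1 - v) * (real 0 + v) powr (- s - 2))) \<partial>lborel) = ennreal (- 1 / s - 1 / (1 - s))"
proof (rule nn_integral_has_integral_lebesgue)
  have "((\<lambda>v. v powr (- s - 1) - v powr (- s)) has_integral (1 powr (- s - 1 + 1) / (- s - 1 + 1) - 1 powr (- s + 1) / (- s + 1))) {0..1}"
    using s by (intro has_integral_diff has_integral_powr_from_0) auto
  also have "1 powr (- s - 1 + 1) / (- s - 1 + 1) - 1 powr (- s + 1) / (- s + 1) = - 1 / s - 1 / (1 - s)" by simp
  finally show "((\<lambda>v. v * (1 - v) * (real 0 + v) powr (- s - 2)) has_integral - 1 / s - 1 / (1 - s)) {0..1}"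
  proof (rule has_integral_eq[rotated])
    fix v :: real assume v: "v \<in> {0..1}"
    show "v powr (- s - 1) - v powr (- s) = v * (1 - v) * (real 0 + v) powr (- s - 2)"
    proof (cases "v = 0")
      case False
      have e: "- s - 1 = 1 + (- s - 2)" "- s = 1 + (- s - 1)" by simp_all
      have "v powr (- s - 1) = v * v powr (- s - 2)"
        unfolding e(1) powr_add using v False by simp
      moreover have "v powr (- s) = v * v powr (- s - 1)"
        by (subst e(2), subst powr_add) (use v False in simp)
      ultimately have "v powr (- s - 1) = v * v powr (- s - 2)" "v powr (- s) = v * (v * v powr (- s - 2))" by simp_all
      thus ?thesis by (simp add: algebra_simps)
    qed auto
  qed
qed auto

text \<open>Gamma(s + 2) y^(-s-2) is the integral of w^(s+1) e^(-y w) over w > 0. At y = n + v the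
  dependence on n splits off as e^(-n w), ready for a geometric series, and the integral over v is
  the transform of the parabola.\<close>

lemma Gamma_times_nn_zeta_summand:
  "ennreal (Gamma (s + 2)) * (\<integral>\<^sup>+v. ennreal (indicator {0..1} v * (v * (1 - v) * (real n + v) powr (- s - 2))) \<partial>lborel)
   = (\<integral>\<^sup>+w. ennreal (indicator {0<..} w * (w powr (s + 1) * exp (- w) ^ n * ((1 + exp (- w)) / w\<^sup>2 - 2 * (1 - exp (- w)) / w ^ 3))) \<partial>lborel)"
proof -
  let ?J = "\<lambda>v w :: real. ennreal (indicator {0..1} v * (v * (1 - v)) * (indicator {0<..} w * (w powr (s + 1) * exp (- (real n + v) * w))))"
  let ?K = "\<lambda>w :: real. ennreal (indicator {0<..} w * (w powr (s + 1) * exp (- w) ^ n * ((1 + exp (- w)) / w\<^sup>2 - 2 * (1 - exp (- w)) / w ^ 3)))"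
  let ?A = "\<lambda>v :: real. ennreal (indicator {0..1} v * (v * (1 - v) * (real n + v) powr (- s - 2)))"
  have "ennreal (Gamma (s + 2)) * (\<integral>\<^sup>+v. ?A v \<partial>lborel)
     = (\<integral>\<^sup>+v. ennreal (Gamma (s + 2)) * ?A v \<partial>lborel)"
    by (rule nn_integral_cmult[symmetric]) measurable
  also have "\<dots> = (\<integral>\<^sup>+v. (\<integral>\<^sup>+w. ?J v w \<partial>lborel) \<partial>lborel)"
  proof (rule nn_integral_cong)
    fix v :: real
    show "ennreal (Gamma (s + 2)) * ?A v =
      (\<integral>\<^sup>+w. ?J v w \<partial>lborel)"
    \<comment> \<open>At n = v = 0 the Laplace integral alone would diverge; at v = 0 the factor v
      (1 - v) makes both sides vanish.\<close>
    proof (cases "v \<in> {0<..1}")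
      case True
      have "(\<integral>\<^sup>+w. ?J v w \<partial>lborel)
        = (\<integral>\<^sup>+w. ennreal (v * (1 - v)) * ennreal (indicator {0<..} w * (w powr (s + 2 - 1) * exp (- (real n + v) * w))) \<partial>lborel)"
        using True by (intro nn_integral_cong) (auto simp: ennreal_mult'[symmetric] add.commute)
      also have "\<dots> = ennreal (v * (1 - v)) * ennreal (Gamma (s + 2) * (real n + v) powr (- (s + 2)))"
        using True s by (subst nn_integral_cmult, measurable, subst nn_integral_Gamma_scaled) (auto intro: add_nonneg_pos)
      also have "\<dots> = ennreal (v * (1 - v) * (Gamma (s + 2) * (real n + v) powr (- (s + 2))))"
        using True by (subst ennreal_mult'[symmetric]) auto
      also have "\<dots> = ennreal (Gamma (s + 2)) * ?A v"
        using True s by (subst ennreal_mult'[symmetric]) (auto simp: mult_ac intro!: less_imp_le[OF Gamma_real_pos])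
      finally show ?thesis ..
    qed (auto simp: indicator_def)
  qed
  also have "\<dots> = (\<integral>\<^sup>+w. (\<integral>\<^sup>+v. ?J v w \<partial>lborel) \<partial>lborel)"
    by (rule lborel_pair.Fubini') measurable
  also have "\<dots> = (\<integral>\<^sup>+w. ?K w \<partial>lborel)"
  proof (rule nn_integral_cong)
    fix w :: real
    show "(\<integral>\<^sup>+v. ?J v w \<partial>lborel)
      = ?K w"
    proof (cases "w > 0")
      case True
      have "(\<integral>\<^sup>+v. ?J v w \<partial>lborel)
        = (\<integral>\<^sup>+v. ennreal (w powr (s + 1) * exp (- w) ^ n) * ennreal (indicator {0..1} v * (v * (1 - v) * exp (- (w * v)))) \<partial>lborel)"
      proof (rule nn_integral_cong)
        fix v :: real
        have "exp (- (real n + v) * w) = exp (- w) ^ n * exp (- (w * v))"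
          by (simp add: exp_of_nat_mult[symmetric] exp_add[symmetric] algebra_simps)
        thus "?J v w
           = ennreal (w powr (s + 1) * exp (- w) ^ n) * ennreal (indicator {0..1} v * (v * (1 - v) * exp (- (w * v))))"
          using True by (subst ennreal_mult'[symmetric]) (auto simp: mult_ac)
      qed
      also have "\<dots> = ennreal (w powr (s + 1) * exp (- w) ^ n) * ennreal ((1 + exp (- w)) / w\<^sup>2 - 2 * (1 - exp (- w)) / w ^ 3)"
        by (subst nn_integral_cmult, measurable, subst nn_integral_parabola_exp[OF True]) simp
      also have "\<dots> = ?K w"
        using True by (subst ennreal_mult'[symmetric]) auto
      finally show ?thesis .
    qed auto
  qed
  finally show ?thesis .
qed

text \<open>The geometric series in n replaces the transform of one parabola by that of its periodic
  continuation. Its partial fractions lead to integrals of w^s / (w^2 + (2 pi m)^2), each a fixed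
  multiple of m^(s-1): here the dual Dirichlet series at 1 - s arises.\<close>

lemma Gamma_times_nn_zeta_suminf:
  "ennreal (Gamma (s + 2)) * (\<Sum>n. \<integral>\<^sup>+v. ennreal (indicator {0..1} v * (v * (1 - v) * (real n + v) powr (- s - 2))) \<partial>lborel)
   = ennreal (2 * (Gamma ((1 + s) / 2) * Gamma ((1 - s) / 2)) * (2 * pi) powr (s - 1) * (\<Sum>m. real (Suc m) powr (s - 1)))"
proof -
  let ?R = "\<lambda>m w. ennreal 4 * ennreal (indicator {0<..} w * (w powr s / (w\<^sup>2 + (2 * pi * real (Suc m))\<^sup>2)))"
  define K where "K = (\<lambda>w::real. (1 + exp (- w)) / w\<^sup>2 - 2 * (1 - exp (- w)) / w ^ 3)"
  define G where "G = Gamma ((1 + s) / 2) * Gamma ((1 - s) / 2)"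
  have G: "G \<ge> 0" using s by (auto simp: G_def intro!: mult_nonneg_nonneg less_imp_le[OF Gamma_real_pos])
  have coth: "(\<lambda>n. 4 / (w * (w\<^sup>2 + (2 * pi * real (Suc n))\<^sup>2))) sums (K w / (1 - exp (- w)))" if "w > 0" for w
  proof -
    have "K w / (1 - exp (- w)) = (1 + exp (- w)) / (w\<^sup>2 * (1 - exp (- w))) - 2 / w ^ 3"
    proof -
      have split: "(a / b - 2 * E / c) / E = a / (b * E) - 2 / c" if "E \<noteq> 0" for a b c E :: real
        using that by (simp add: diff_divide_distrib)
      show ?thesis unfolding K_def by (rule split) (use that in simp)
    qed
    thus ?thesis using coth_partial_fractions[OF that] by (simp only:)
  qed
  \<comment> \<open>The closed form of \<open>K\<close> hides its sign; nonnegativity is read off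
    the partial fractions.\<close>
  have K0: "K w \<ge> 0" if "w > 0" for w
  proof -
    have "0 \<le> 4 / (w * (w\<^sup>2 + (2 * pi * real (Suc n))\<^sup>2))" for n
      using that by (intro divide_nonneg_nonneg mult_nonneg_nonneg) auto
    hence "K w / (1 - exp (- w)) \<ge> 0"
      by (rule sums_le[OF _ sums_zero coth[OF that]])
    thus ?thesis using that by (simp add: zero_le_divide_iff)
  qed
  have [measurable]: "K \<in> borel_measurable borel" unfolding K_def by measurable
  have "ennreal (Gamma (s + 2)) * (\<Sum>n. \<integral>\<^sup>+v. ennreal (indicator {0..1} v * (v * (1 - v) * (real n + v) powr (- s - 2))) \<partial>lborel)
    = (\<Sum>n. \<integral>\<^sup>+w. ennreal (indicator {0<..} w * (w powr (s + 1) * exp (- w) ^ n * K w)) \<partial>lborel)"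
    unfolding ennreal_suminf_cmult[symmetric] Gamma_times_nn_zeta_summand K_def ..
  also have "\<dots> = (\<integral>\<^sup>+w. (\<Sum>n. ennreal (indicator {0<..} w * (w powr (s + 1) * exp (- w) ^ n * K w))) \<partial>lborel)"
    by (rule nn_integral_suminf[symmetric]) measurable
  also have "\<dots> = (\<integral>\<^sup>+w. (\<Sum>m. ?R m w) \<partial>lborel)"
  proof (rule nn_integral_cong)
    fix w :: real
    show "(\<Sum>n. ennreal (indicator {0<..} w * (w powr (s + 1) * exp (- w) ^ n * K w))) = (\<Sum>m. ?R m w)"
    proof (cases "w > 0")
      case True
      have "(\<lambda>n. w powr (s + 1) * K w * exp (- w) ^ n) sums (w powr (s + 1) * K w * (1 / (1 - exp (- w))))"
        using True by (intro sums_mult geometric_sums) auto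
      hence 1: "(\<Sum>n. ennreal (w powr (s + 1) * K w * exp (- w) ^ n)) = ennreal (w powr (s + 1) * K w * (1 / (1 - exp (- w))))"
        using K0[OF True] by (intro suminf_ennreal_eq) auto
      have "(\<lambda>n. w powr (s + 1) * (4 / (w * (w\<^sup>2 + (2 * pi * real (Suc n))\<^sup>2)))) sums (w powr (s + 1) * (K w / (1 - exp (- w))))"
        by (intro sums_mult coth True)
      hence 2: "(\<Sum>n. ennreal (w powr (s + 1) * (4 / (w * (w\<^sup>2 + (2 * pi * real (Suc n))\<^sup>2))))) = ennreal (w powr (s + 1) * (K w / (1 - exp (- w))))"
        using True by (intro suminf_ennreal_eq) (auto intro!: divide_nonneg_nonneg mult_nonneg_nonneg)
      have 3: "w powr (s + 1) * (4 / (w * d)) = 4 * (w powr s / d)" for d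
        using True by (simp add: powr_add)
      have L: "(\<Sum>n. ennreal (indicator {0<..} w * (w powr (s + 1) * exp (- w) ^ n * K w))) = (\<Sum>n. ennreal (w powr (s + 1) * K w * exp (- w) ^ n))"
        using True by (simp add: mult_ac)
      have R: "(\<Sum>m. ?R m w) = (\<Sum>m. ennreal (w powr (s + 1) * (4 / (w * (w\<^sup>2 + (2 * pi * real (Suc m))\<^sup>2)))))"
        unfolding 3 using True by (intro suminf_cong, subst ennreal_mult'[symmetric]) auto
      show ?thesis unfolding L R 1 2 by simp
    qed auto
  qed
  also have "\<dots> = (\<Sum>m. \<integral>\<^sup>+w. ?R m w \<partial>lborel)"
    by (rule nn_integral_suminf) measurable
  also have "\<dots> = (\<Sum>m. ennreal (2 * G * (2 * pi) powr (s - 1) * real (Suc m) powr (s - 1)))"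
  proof (rule arg_cong[of _ _ suminf], rule ext)
    fix m
    have "(\<integral>\<^sup>+w. ?R m w \<partial>lborel)
      = ennreal 4 * ennreal (G / 2 * (2 * pi * real (Suc m)) powr (s - 1))"
      unfolding G_def using s by (subst nn_integral_cmult, measurable, subst nn_integral_powr_div_quadratic) auto
    also have "(2 * pi * real (Suc m)) powr (s - 1) = (2 * pi) powr (s - 1) * real (Suc m) powr (s - 1)"
      by (rule powr_mult)
    finally show "(\<integral>\<^sup>+w. ?R m w \<partial>lborel)
      = ennreal (2 * G * (2 * pi) powr (s - 1) * real (Suc m) powr (s - 1))"
      by (subst (asm) ennreal_mult'[symmetric]) (auto simp: mult_ac)
  qed
  also have "\<dots> = ennreal (2 * G * (2 * pi) powr (s - 1) * (\<Sum>m. real (Suc m) powr (s - 1)))"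
    using s G by (intro suminf_ennreal_eq sums_mult summable_sums summable_Suc_powr mult_nonneg_nonneg) auto
  finally show ?thesis unfolding G_def .
qed

text \<open>As Gamma(s + 2) = s (s + 1) Gamma(s), the prefactor s (s + 1) / 2 is absorbed.
  Reflection at (1 + s) / 2 gives pi / cos(pi s / 2), reflection at s trades 1 / Gamma(s) for
  Gamma(1 - s), and the double-angle formula leaves sin(pi s / 2).\<close>

lemma zeta_right_functional_real:
  "zeta_right (of_real s) = of_real (2 * (2 * pi) powr (s - 1) * sin (pi * s / 2) * Gamma (1 - s) * (\<Sum>m. real (Suc m) powr (s - 1)))"
proof -
  \<comment> \<open>Index 0 stands for the interval (0, 1], so that the sum of all
    \<open>A n\<close> accounts for the whole integral over y > 0.\<close>
  define A where "A = (\<lambda>n. case n of 0 \<Rightarrow> - 1 / s - 1 / (1 - s) | Suc n \<Rightarrow> Re (zeta_summand (Suc n) (of_real s)))"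
  define S where "S = (\<Sum>n. Re (zeta_summand (Suc n) (of_real s)))"
  define Z where "Z = (\<Sum>m. real (Suc m) powr (s - 1))"
  define G where "G = Gamma ((1 + s) / 2) * Gamma ((1 - s) / 2)"
  have G0: "G \<ge> 0" using s by (auto simp: G_def intro!: mult_nonneg_nonneg less_imp_le[OF Gamma_real_pos])
  have Z0: "Z \<ge> 0" unfolding Z_def using s by (intro suminf_nonneg summable_Suc_powr) auto
  have A0: "A n \<ge> 0" for n
  proof (cases n)
    case 0
    have "- 1 / s - 1 / (1 - s) = -1 / (s * (1 - s))" using s by (simp add: field_simps)
    moreover have "s * (1 - s) < 0" using s by (intro mult_neg_pos) auto
    ultimately show ?thesis using 0 by (simp add: A_def)
  qed (use Re_zeta_summand_nonneg in \<open>simp add: A_def\<close>)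
  have sum: "summable (\<lambda>n. zeta_summand (Suc n) (of_real s))" using s by (intro summable_zeta_summand) auto
  have ReS: "(\<lambda>n. Re (zeta_summand (Suc n) (of_real s))) sums S"
    unfolding S_def using summable_Re[OF sum] by (rule summable_sums)
  hence "A sums (S + A 0)" by (subst sums_Suc_iff[symmetric]) (simp add: A_def)
  hence "(\<Sum>n. ennreal (A n)) = ennreal (S + A 0)" using A0 by (intro suminf_ennreal_eq)
  moreover have "ennreal (A n) = (\<integral>\<^sup>+v. ennreal (indicator {0..1} v * (v * (1 - v) * (real n + v) powr (- s - 2))) \<partial>lborel)" for n
    using nn_zeta_summand_0 nn_zeta_summand_Suc by (cases n) (simp_all add: A_def)
  ultimately have "ennreal (Gamma (s + 2)) * ennreal (S + A 0) = ennreal (2 * G * (2 * pi) powr (s - 1) * Z)"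
    using Gamma_times_nn_zeta_suminf by (simp add: G_def Z_def)
  moreover have "S + A 0 \<ge> 0"
    unfolding S_def using A0[of 0] Re_zeta_summand_nonneg sums_summable[OF ReS]
    by (intro add_nonneg_nonneg suminf_nonneg) auto
  ultimately have eq: "Gamma (s + 2) * (S + A 0) = 2 * G * (2 * pi) powr (s - 1) * Z"
    using s G0 Z0 by (subst (asm) ennreal_mult'[symmetric], simp add: less_imp_le[OF Gamma_real_pos])
      (subst (asm) ennreal_inj, auto intro!: mult_nonneg_nonneg less_imp_le[OF Gamma_real_pos])
  have nint: "s \<notin> \<int>\<^sub>\<le>\<^sub>0" "s + 1 \<notin> \<int>\<^sub>\<le>\<^sub>0"
    using s by (auto elim!: nonpos_Ints_cases)
  have "Gamma (s + 1 + 1) = (s + 1) * Gamma (s + 1)" by (rule Gamma_plus1) fact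
  also have "Gamma (s + 1) = s * Gamma s" by (rule Gamma_plus1) fact
  finally have G2: "Gamma (s + 2) = s * (s + 1) * Gamma s" by (simp add: add_ac mult_ac)
  have G1: "Gamma s \<noteq> 0" using nint by (simp add: Gamma_eq_zero_iff)
  have cos: "cos (pi * s / 2) > 0"
    using s mult_strict_left_mono[of "-1" s pi] mult_strict_left_mono[of s 1 pi] by (intro cos_gt_zero_pi) auto
  have "of_real G = complex_of_real pi / sin (of_real pi * of_real ((1 + s) / 2))"
    using Gamma_reflection_complex[of "of_real ((1 + s) / 2)"]
    by (simp add: G_def Gamma_complex_of_real[symmetric] field_simps)
  also have "\<dots> = of_real (pi / sin (pi * ((1 + s) / 2)))" by (simp only: of_real_divide[of pi] sin_of_real[symmetric] of_real_mult)
  also have "pi * ((1 + s) / 2) = pi * s / 2 + pi / 2" by (simp add: field_simps)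
  also have "sin (pi * s / 2 + pi / 2) = cos (pi * s / 2)" by (simp add: sin_add)
  finally have G: "G = pi / cos (pi * s / 2)" by (subst (asm) of_real_eq_iff)
  have "of_real (Gamma s * Gamma (1 - s)) = complex_of_real pi / sin (of_real pi * of_real s)"
    using Gamma_reflection_complex[of "of_real s"] by (simp add: Gamma_complex_of_real[symmetric])
  also have "\<dots> = of_real (pi / sin (pi * s))" by (simp only: of_real_divide[of pi] sin_of_real[symmetric] of_real_mult)
  finally have refl: "Gamma s * Gamma (1 - s) = pi / sin (pi * s)" by (subst (asm) of_real_eq_iff)
  have sin2: "sin (pi * s) = 2 * sin (pi * s / 2) * cos (pi * s / 2)"
    using sin_double[of "pi * s / 2"] by simp
  have sinneg: "sin (pi * s / 2) < 0"
    using s sin_gt_zero[of "- (pi * s / 2)"] mult_strict_left_mono[of "-1" s pi] mult_strict_left_mono[of s 0 pi] by simp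
  have "zeta_summand (Suc n) (of_real s) = of_real (Re (zeta_summand (Suc n) (of_real s)))" for n
    by (simp add: zeta_summand_of_real)
  hence "(\<Sum>n. zeta_summand (Suc n) (of_real s)) = (\<Sum>n. of_real (Re (zeta_summand (Suc n) (of_real s))))" by presburger
  also have "\<dots> = of_real S"
    using sums_of_real[OF ReS, where 'a = complex] by (rule sums_unique[symmetric])
  finally have "zeta_right (of_real s) = of_real (1 / (s - 1) + 1 / 2 + s * (s + 1) / 2 * S)"
    by (simp add: zeta_right_def)
  also have "1 / (s - 1) + 1 / 2 + s * (s + 1) / 2 * S = s * (s + 1) / 2 * (S + A 0)"
  proof -
    have "s * (s + 1) / 2 * A 0 = 1 / (s - 1) + 1 / 2"
      using s by (simp add: A_def divide_simps) (simp add: algebra_simps)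
    thus ?thesis by (simp add: distrib_left)
  qed
  also have "\<dots> = G * (2 * pi) powr (s - 1) * Z / Gamma s"
  proof -
    have "Gamma s * (s * (s + 1) / 2 * (S + A 0)) = G * (2 * pi) powr (s - 1) * Z"
      using eq unfolding G2 by (simp add: mult_ac)
    thus ?thesis using G1 by (simp add: field_simps)
  qed
  also have "\<dots> = 2 * (2 * pi) powr (s - 1) * sin (pi * s / 2) * Gamma (1 - s) * Z"
  proof -
    have "Gamma (1 - s) = pi / (2 * sin (pi * s / 2) * cos (pi * s / 2)) / Gamma s"
      using arg_cong[OF refl, of "\<lambda>x. x / Gamma s"] G1 unfolding sin2 by simp
    thus ?thesis unfolding G using cos sinneg by simp
  qed
  finally show ?thesis unfolding Z_def .
qed

end

section \<open>Gluing both halves of zeta, and its growth in strips\<close>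

lemma strip_growth_union:
  assumes "strip_growth f a m \<kappa>" "strip_growth f m b \<kappa>"
  shows "strip_growth f a b \<kappa>"
proof -
  obtain C where C: "C > 0" "\<And>s. s \<in> strip a m \<Longrightarrow> norm (f s) \<le> C * exp (\<kappa> * \<bar>Im s\<bar>)"
    using strip_growthE[OF assms(1)] by metis
  obtain D where D: "D > 0" "\<And>s. s \<in> strip m b \<Longrightarrow> norm (f s) \<le> D * exp (\<kappa> * \<bar>Im s\<bar>)"
    using strip_growthE[OF assms(2)] by metis
  have "norm (f s) \<le> (C + D) * exp (\<kappa> * \<bar>Im s\<bar>)" if "s \<in> strip a b" for s
  proof -
    have "0 \<le> C * exp (\<kappa> * \<bar>Im s\<bar>)" "0 \<le> D * exp (\<kappa> * \<bar>Im s\<bar>)" using C D by auto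
    moreover have "s \<in> strip a m \<or> s \<in> strip m b" using that by (auto simp: strip_def)
    ultimately show ?thesis using C(2)[of s] D(2)[of s] unfolding distrib_right by linarith
  qed
  thus ?thesis unfolding strip_growth_def by blast
qed

lemma strip_growth_reflect:
  assumes "strip_growth f (1 - b) (1 - a) \<kappa>"
  shows "strip_growth (\<lambda>s. f (1 - s)) a b \<kappa>"
proof -
  obtain C where C: "\<And>s. s \<in> strip (1 - b) (1 - a) \<Longrightarrow> norm (f s) \<le> C * exp (\<kappa> * \<bar>Im s\<bar>)"
    using strip_growthE[OF assms(1)] by metis
  have "norm (f (1 - s)) \<le> C * exp (\<kappa> * \<bar>Im s\<bar>)" if "s \<in> strip a b" for s
    using C[of "1 - s"] that by (simp add: strip_def)
  thus ?thesis unfolding strip_growth_def by blast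
qed

lemma norm_sin_le_exp: "norm (sin z) \<le> exp \<bar>Im z\<bar>" for z :: complex
proof -
  have "norm (sin z) = norm (exp (\<i> * z) - exp (- (\<i> * z))) / 2"
    by (simp add: sin_exp_eq norm_divide norm_mult)
  also have "\<dots> \<le> (norm (exp (\<i> * z)) + norm (exp (- (\<i> * z)))) / 2"
    by (intro divide_right_mono norm_triangle_ineq4) auto
  also have "\<dots> = (exp (- Im z) + exp (Im z)) / 2" by (simp add: norm_exp_eq_Re)
  also have "\<dots> \<le> (exp \<bar>Im z\<bar> + exp \<bar>Im z\<bar>) / 2" by (intro divide_right_mono add_mono) auto
  finally show ?thesis by simp
qed

text \<open>The right-hand side of Riemann's functional equation. It refers only to
  \<open>zeta_right\<close> at 1 - s, so for Re s < 0 it makes sense before the equation is known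
  and supplies the continuation to the left.\<close>

definition zeta_left :: "complex \<Rightarrow> complex" where
  "zeta_left s = 2 * exp ((s - 1) * of_real (ln (2 * pi))) * sin (of_real pi * s / 2) * Gamma (1 - s) * zeta_right (1 - s)"

lemma holomorphic_zeta_left: "zeta_left holomorphic_on {s. Re s < 0}"
proof -
  have "(\<lambda>s. zeta_right (1 - s)) holomorphic_on {s. Re s < 0}"
    by (rule holomorphic_on_compose_gen[OF _ holomorphic_zeta_right, of "\<lambda>s. 1 - s", unfolded o_def])
       (auto intro!: holomorphic_intros)
  moreover have "(\<lambda>s. Gamma (1 - s)) holomorphic_on {s. Re s < 0}"
    by (intro holomorphic_intros) (auto elim!: nonpos_Ints_cases simp: complex_eq_iff)
  moreover have "(\<lambda>s. 2 * exp ((s - 1) * of_real (ln (2 * pi))) * sin (of_real pi * s / 2)) holomorphic_on {s. Re s < 0}"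
    by (intro holomorphic_intros) auto
  ultimately show ?thesis unfolding zeta_left_def[abs_def] using holomorphic_on_mult by blast
qed

lemma zeta_left_of_real:
  assumes "-1 < s" "s < 0"
  shows "zeta_left (of_real s) = zeta_right (of_real s)"
proof -
  have 1: "exp ((of_real s - 1) * of_real (ln (2 * pi))) = complex_of_real ((2 * pi) powr (s - 1))"
    by (simp add: powr_def exp_of_real[symmetric])
  have 2: "sin (of_real pi * of_real s / 2) = complex_of_real (sin (pi * s / 2))"
    by (simp add: sin_of_real[symmetric])
  have 3: "Gamma (1 - of_real s) = complex_of_real (Gamma (1 - s))"
    using Gamma_complex_of_real[of "1 - s"] by simp
  have "(\<lambda>n. of_nat (Suc n) powr (- (1 - complex_of_real s))) sums zeta_right (1 - of_real s)"
    using assms by (intro zeta_right_sums) auto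
  also have "(\<lambda>n. of_nat (Suc n) powr (- (1 - complex_of_real s))) = (\<lambda>n. of_real (real (Suc n) powr (s - 1)))"
    unfolding powr_complex_nat by (simp add: powr_def exp_of_real[symmetric] del: of_nat_Suc)
  finally have "(\<lambda>n. complex_of_real (real (Suc n) powr (s - 1))) sums zeta_right (1 - of_real s)" .
  moreover have "(\<lambda>n. complex_of_real (real (Suc n) powr (s - 1))) sums of_real (\<Sum>n. real (Suc n) powr (s - 1))"
    using assms by (intro sums_of_real summable_sums summable_Suc_powr) auto
  ultimately have 4: "zeta_right (1 - of_real s) = of_real (\<Sum>n. real (Suc n) powr (s - 1))"
    by (rule sums_unique2)
  show ?thesis unfolding zeta_left_def zeta_right_functional_real[OF assms] 1 2 3 4 by simp
qed

text \<open>Both functions are holomorphic on the strip and agree on the real interval (-1, 0),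
  which has accumulation points inside it; the identity theorem extends the equality.\<close>

lemma zeta_left_eq_right:
  assumes "-1 < Re s" "Re s < 0"
  shows "zeta_left s = zeta_right s"
proof -
  define S where "S = {s. -1 < Re s} \<inter> {s. Re s < 0}"
  have "zeta_left s - zeta_right s = 0"
  proof (rule analytic_continuation[where f = "\<lambda>s. zeta_left s - zeta_right s" and S = S and U = "of_real ` {-1<..<0}" and \<xi> = "of_real (-1/2)"])
    show "(\<lambda>s. zeta_left s - zeta_right s) holomorphic_on S"
      by (intro holomorphic_intros holomorphic_on_subset[OF holomorphic_zeta_left] holomorphic_on_subset[OF holomorphic_zeta_right])
         (auto simp: S_def)
    show "open S" unfolding S_def by (intro open_Int open_halfspace_Re_gt open_halfspace_Re_lt)
    show "connected S" unfolding S_def by (intro convex_connected convex_Int convex_halfspace_Re_gt convex_halfspace_Re_lt)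
    have "(-1/2 :: real) islimpt {-1<..<0}" by (rule open_imp_islimpt) auto
    thus "complex_of_real (-1/2) islimpt of_real ` {-1<..<0}"
    proof (rule islimpt_isCont_image)
      show "\<forall>\<^sub>F x in at (-1/2). complex_of_real x \<noteq> of_real (-1/2)"
        unfolding of_real_eq_iff by (simp add: eventually_at_filter)
    qed auto
  qed (use assms zeta_left_of_real in \<open>auto simp: S_def\<close>)
  thus ?thesis by simp
qed

definition zeta_glue :: "complex \<Rightarrow> complex" where
  "zeta_glue s = (if Re s > -1 then zeta_right s else zeta_left s)"

lemma holomorphic_zeta_glue: "zeta_glue holomorphic_on UNIV - {1}"
proof -
  have "zeta_glue holomorphic_on ({s. Re s > -1} - {1}) \<union> {s. Re s < 0}"
  proof (rule holomorphic_on_Un)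
    show "zeta_glue holomorphic_on {s. Re s > -1} - {1}"
      by (rule holomorphic_transform[OF holomorphic_zeta_right]) (auto simp: zeta_glue_def)
    show "zeta_glue holomorphic_on {s. Re s < 0}"
      by (rule holomorphic_transform[OF holomorphic_zeta_left]) (auto simp: zeta_glue_def zeta_left_eq_right)
    show "open ({s. Re s > -1} - {1})" "open {s. Re s < 0}"
      by (auto intro!: open_delete open_halfspace_Re_gt open_halfspace_Re_lt)
  qed
  moreover have "({s. Re s > -1} - {1}) \<union> {s. Re s < 0} = UNIV - {1}"
    by (force simp: not_less)
  ultimately show ?thesis by simp
qed

lemma zeta_glue_suminf: "Re s > 1 \<Longrightarrow> zeta_glue s = (\<Sum>n. of_nat (Suc n) powr (- s))"
  using zeta_right_sums[of s] by (simp add: zeta_glue_def sums_iff)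

text \<open>\<open>zeta\<close> is a Hilbert choice, so its defining properties become available
  only through a witness, which \<open>zeta_glue\<close> provides.\<close>

lemma holomorphic_zeta: "zeta holomorphic_on UNIV - {1}"
  and zeta_suminf: "Re s > 1 \<Longrightarrow> zeta s = (\<Sum>n. of_nat (Suc n) powr (- s))"
proof -
  define P :: "(complex \<Rightarrow> complex) \<Rightarrow> bool" where
    "P = (\<lambda>f. f holomorphic_on UNIV - {1} \<and> (\<forall>s. Re s > 1 \<longrightarrow> f s = (\<Sum>n. of_nat (Suc n) powr (- s))))"
  have "P zeta_glue" using holomorphic_zeta_glue zeta_glue_suminf by (simp add: P_def)
  hence "P (SOME f. P f)" by (rule someI[of P])
  hence "zeta holomorphic_on UNIV - {1} \<and> (\<forall>s. Re s > 1 \<longrightarrow> zeta s = (\<Sum>n. of_nat (Suc n) powr (- s)))"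
    unfolding zeta_def P_def .
  thus "zeta holomorphic_on UNIV - {1}" "Re s > 1 \<Longrightarrow> zeta s = (\<Sum>n. of_nat (Suc n) powr (- s))" by blast+
qed

lemma zeta_eq_glue:
  assumes "s \<noteq> 1"
  shows "zeta s = zeta_glue s"
proof (rule analytic_continuation_open[where f = zeta and g = zeta_glue and s = "{s. Re s > 1}" and s' = "UNIV - {1}"])
  show "{s. Re s > 1} \<noteq> {}" by (auto intro: exI[of _ 2])
  show "connected (UNIV - {1 :: complex})" by (simp add: Compl_eq_Diff_UNIV[symmetric] connected_punctured_universe)
qed (use assms holomorphic_zeta holomorphic_zeta_glue zeta_suminf zeta_glue_suminf in \<open>auto intro: open_halfspace_Re_gt\<close>)

lemma zeta_eq_right: "s \<noteq> 1 \<Longrightarrow> -1 < Re s \<Longrightarrow> zeta s = zeta_right s"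
  by (simp add: zeta_eq_glue zeta_glue_def)

lemma zeta_eq_left: "Re s < 0 \<Longrightarrow> zeta s = zeta_left s"
  using zeta_left_eq_right[of s] by (cases "s = 1") (auto simp: zeta_eq_glue zeta_glue_def)

lemma zeta_sums: "Re s > 1 \<Longrightarrow> (\<lambda>n. of_nat (Suc n) powr (- s)) sums zeta s"
  using zeta_right_sums[of s] by (subst zeta_eq_right) auto

lemma zeta_0: "zeta 0 = -1/2"
  by (simp add: zeta_eq_right zeta_right_0)

lemma zeta_pole: "((\<lambda>s. (s - 1) * zeta s) \<longlongrightarrow> 1) (at 1)"
proof (rule Lim_transform_eventually[OF zeta_right_residue])
  have "\<forall>\<^sub>F s in at (1::complex). s \<in> {s. Re s > -1} - {1}"
    by (rule eventually_at_in_open) (auto intro: open_halfspace_Re_gt)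
  thus "\<forall>\<^sub>F s in at 1. (s - 1) * zeta_right s = (s - 1) * zeta s"
    by eventually_elim (auto simp: zeta_eq_right)
qed

lemma zeta_functional:
  assumes "Re s < 0"
  shows "zeta s = 2 * exp ((s - 1) * of_real (ln (2 * pi))) * sin (of_real pi * s / 2) * Gamma (1 - s) * zeta (1 - s)"
proof -
  have "1 - s \<noteq> 1" using assms by auto
  thus ?thesis using assms by (simp add: zeta_eq_left zeta_left_def zeta_eq_right)
qed

lemma zeta_trivial_zero:
  assumes "m > 0"
  shows "zeta (- (2 * of_nat m)) = 0"
proof -
  have "sin (of_real pi * (- (2 * of_nat m)) / 2) = (0 :: complex)"
    using sin_of_real[of "pi * real m", where 'a = complex] by (simp add: mult.commute)
  thus ?thesis using assms by (subst zeta_functional) auto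
qed

text \<open>Left of -1/2 the functional equation applies: the growth pi / 2 of the sine cancels the
  decay of Gamma(1 - s), and the two halves of \<open>\<epsilon>\<close> are spent on Gamma(1 - s)
  and zeta(1 - s). To the right the Euler-Maclaurin formula gives the bound.\<close>

lemma strip_growth_zeta:
  assumes "0 < \<epsilon>"
  shows "strip_growth zeta a b \<epsilon>"
proof -
  have right: "strip_growth zeta m b \<epsilon>" if "m > -1" "0 < \<epsilon>" for m b \<epsilon>
  proof (rule strip_growth_cong[OF strip_growth_zeta_right])
    fix s assume "m \<le> Re s" "1 \<le> \<bar>Im s\<bar>"
    hence "s \<noteq> 1" "-1 < Re s" using that by auto
    thus "norm (zeta s) \<le> norm (zeta_right s)" by (simp add: zeta_eq_right)
  qed (use that in auto)
  have left: "strip_growth zeta a (-1/2) \<epsilon>"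
  proof -
    define l where "l = ln (2 * pi)"
    have 1: "strip_growth (\<lambda>s. exp (- s * (of_real (-l) + \<i> * of_real 0))) a (-1/2) \<bar>0\<bar>"
      by (rule strip_growth_exp)
    have 2: "strip_growth (\<lambda>s. sin (of_real pi * s / 2)) a (-1/2) (pi / 2)"
    proof (rule strip_growthI[where C = 1])
      fix s show "norm (sin (of_real pi * s / 2)) \<le> 1 * exp (pi / 2 * \<bar>Im s\<bar>)"
        using norm_sin_le_exp[of "of_real pi * s / 2"] by (simp add: abs_mult)
    qed
    have 3: "strip_growth (\<lambda>s. Gamma (1 - s)) a (-1/2) (\<epsilon> / 2 - pi / 2)"
      by (rule strip_growth_reflect, rule strip_growth_Gamma) (use assms in auto)
    have 4: "strip_growth (\<lambda>s. zeta (1 - s)) a (-1/2) (\<epsilon> / 2)"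
      by (rule strip_growth_reflect, rule right) (use assms in auto)
    have 5: "strip_growth (\<lambda>s. 2 * exp (- of_real l)) a (-1/2) 0"
      by (rule strip_growth_const) auto
    have "strip_growth (\<lambda>s. 2 * exp (- of_real l) * exp (- s * (of_real (-l) + \<i> * of_real 0)) * sin (of_real pi * s / 2) * Gamma (1 - s) * zeta (1 - s))
        a (-1/2) (0 + \<bar>0\<bar> + pi / 2 + (\<epsilon> / 2 - pi / 2) + \<epsilon> / 2)"
      by (rule strip_growth_mult[OF strip_growth_mult[OF strip_growth_mult[OF strip_growth_mult[OF 5 1] 2] 3] 4])
    hence "strip_growth (\<lambda>s. 2 * exp (- of_real l) * exp (- s * (of_real (-l) + \<i> * of_real 0)) * sin (of_real pi * s / 2) * Gamma (1 - s) * zeta (1 - s))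
        a (-1/2) \<epsilon>" by simp
    thus ?thesis
    proof (rule strip_growth_cong)
      fix s assume "Re s \<le> -1/2"
      moreover have "exp ((s - 1) * of_real l) = exp (- of_real l) * exp (- s * (of_real (-l) + \<i> * of_real 0))"
        by (simp add: exp_add[symmetric] algebra_simps)
      ultimately have "zeta s = 2 * exp (- of_real l) * exp (- s * (of_real (-l) + \<i> * of_real 0)) * sin (of_real pi * s / 2) * Gamma (1 - s) * zeta (1 - s)"
        by (subst zeta_functional) (auto simp: l_def mult_ac)
      thus "norm (zeta s) \<le> norm (2 * exp (- of_real l) * exp (- s * (of_real (-l) + \<i> * of_real 0)) * sin (of_real pi * s / 2) * Gamma (1 - s) * zeta (1 - s))"
        by simp
    qed
  qed
  show ?thesis
    by (rule strip_growth_union[OF left right]) (use assms in auto)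
qed

section \<open>Dirichlet series of the divisor functions\<close>

text \<open>Absolute convergence permits regrouping the double sum over pairs (d, m) by the value n
  = d^k m; such a pair amounts to an n together with a d whose k-th power divides n.\<close>

lemma divisor_convolution_sums:
  fixes A B :: "nat \<Rightarrow> 'a :: {real_normed_field, banach}"
  assumes "k > 0"
    and A: "summable (\<lambda>m. norm (A (Suc m)))" and B: "summable (\<lambda>d. norm (B (Suc d)))"
  shows "(\<lambda>n. \<Sum>d | d \<ge> 1 \<and> d ^ k dvd Suc n. A (Suc n div d ^ k) * B d) sums
     ((\<Sum>m. A (Suc m)) * (\<Sum>d. B (Suc d)))"
proof -
  define f where "f = (\<lambda>(d, m). A (Suc m) * B (Suc d))"
  define a b where "a = (\<Sum>m. A (Suc m))" and "b = (\<Sum>d. B (Suc d))"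
  have hA: "((\<lambda>m. A (Suc m)) has_sum a) UNIV"
    unfolding a_def by (rule norm_summable_imp_has_sum[OF A summable_sums[OF summable_norm_cancel[OF A]]])
  have hB: "((\<lambda>d. B (Suc d)) has_sum b) UNIV"
    unfolding b_def by (rule norm_summable_imp_has_sum[OF B summable_sums[OF summable_norm_cancel[OF B]]])
  have nA: "((\<lambda>m. norm (A (Suc m))) has_sum (\<Sum>m. norm (A (Suc m)))) UNIV"
    by (rule sums_nonneg_imp_has_sum[OF summable_sums[OF A]]) auto
  have nB: "((\<lambda>d. norm (B (Suc d))) has_sum (\<Sum>d. norm (B (Suc d)))) UNIV"
    by (rule sums_nonneg_imp_has_sum[OF summable_sums[OF B]]) auto
  have "(\<lambda>x. norm (f x)) summable_on (UNIV \<times> UNIV)"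
  proof (rule Infinite_Sum.abs_summable_on_Sigma_iff[THEN iffD2], intro conjI ballI)
    fix d
    show "(\<lambda>m. norm (f (d, m))) summable_on UNIV"
      using has_sum_cmult_left[OF nA, of "norm (B (Suc d))"] by (auto simp: f_def norm_mult summable_on_def)
  next
    have "infsum (\<lambda>m. norm (f (d, m))) UNIV = (\<Sum>m. norm (A (Suc m))) * norm (B (Suc d))" for d
      using has_sum_cmult_left[OF nA, of "norm (B (Suc d))"] by (auto simp: f_def norm_mult intro!: infsumI)
    moreover have "(\<lambda>d. norm ((\<Sum>m. norm (A (Suc m))) * norm (B (Suc d)))) summable_on UNIV"
      using has_sum_cmult_right[OF nB, of "\<bar>\<Sum>m. norm (A (Suc m))\<bar>"] by (auto simp: abs_mult summable_on_def)
    ultimately show "(\<lambda>d. norm (infsum (\<lambda>m. norm (f (d, m))) UNIV)) summable_on UNIV" by simp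
  qed
  hence "f summable_on (UNIV \<times> UNIV)" by (rule abs_summable_summable)
  then obtain S where S: "(f has_sum S) (UNIV \<times> UNIV)" by (auto simp: summable_on_def)
  have "((\<lambda>d. a * B (Suc d)) has_sum S) UNIV"
    by (rule has_sum_SigmaD[OF S]) (auto simp: f_def intro!: has_sum_cmult_left hA)
  moreover have "((\<lambda>d. a * B (Suc d)) has_sum a * b) UNIV" by (rule has_sum_cmult_right[OF hB])
  ultimately have "S = a * b" by (rule has_sum_unique)
  hence ab: "(f has_sum (a * b)) (UNIV \<times> UNIV)" using S by simp
  define D where "D = (\<lambda>n. {d. d \<ge> 1 \<and> d ^ k dvd Suc n})"
  have "((\<lambda>(n, d). A (Suc n div d ^ k) * B d) has_sum (a * b)) (Sigma UNIV D) \<longleftrightarrow> (f has_sum (a * b)) (UNIV \<times> UNIV)"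
  \<comment> \<open>The series are indexed from 0 while d, m and n start at 1; the two maps
    translate between (n, d) and (d, m) with these shifts.\<close>
  proof (rule has_sum_reindex_bij_witness[where
        j = "\<lambda>(n, d). (d - 1, Suc n div d ^ k - 1)" and i = "\<lambda>(d, m). (Suc d ^ k * Suc m - 1, Suc d)"])
    fix x assume "x \<in> Sigma UNIV D"
    then obtain n d where x: "x = (n, d)" "d \<ge> 1" "d ^ k dvd Suc n" by (auto simp: D_def)
    then obtain q where q: "Suc n = d ^ k * q" by (auto elim: dvdE)
    have "q > 0" using q by (cases q) auto
    have "d ^ k > 0" using x by simp
    hence div: "Suc n div d ^ k = q" using q by simp
    have d: "Suc (d - 1) = d" "Suc (q - 1) = q" using x \<open>q > 0\<close> by auto
    show "(\<lambda>(d, m). (Suc d ^ k * Suc m - 1, Suc d)) ((\<lambda>(n, d). (d - 1, Suc n div d ^ k - 1)) x) = x"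
      unfolding x prod.case div d q[symmetric] by simp
    show "(\<lambda>(n, d). (d - 1, Suc n div d ^ k - 1)) x \<in> UNIV \<times> UNIV" by simp
    show "f ((\<lambda>(n, d). (d - 1, Suc n div d ^ k - 1)) x) = (\<lambda>(n, d). A (Suc n div d ^ k) * B d) x"
      unfolding x f_def prod.case div d ..
  next
    fix y :: "nat \<times> nat"
    obtain d m where y: "y = (d, m)" by (cases y)
    have pos: "Suc (Suc d ^ k * Suc m - 1) = Suc d ^ k * Suc m" by simp
    show "(\<lambda>(n, d). (d - 1, Suc n div d ^ k - 1)) ((\<lambda>(d, m). (Suc d ^ k * Suc m - 1, Suc d)) y) = y"
      unfolding y prod.case pos by (subst nonzero_mult_div_cancel_left) auto
    show "(\<lambda>(d, m). (Suc d ^ k * Suc m - 1, Suc d)) y \<in> Sigma UNIV D"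
      unfolding y prod.case D_def mem_Sigma_iff mem_Collect_eq pos by simp
  qed auto
  with ab have "((\<lambda>(n, d). A (Suc n div d ^ k) * B d) has_sum (a * b)) (Sigma UNIV D)" by simp
  hence "((\<lambda>n. \<Sum>d\<in>D n. A (Suc n div d ^ k) * B d) has_sum (a * b)) UNIV"
  proof (rule has_sum_SigmaD)
    fix n
    have "d \<le> Suc n" if "d \<in> D n" for d
    proof -
      have "d ^ 1 \<le> d ^ k" using that assms(1) by (intro power_increasing) (auto simp: D_def)
      also have "d ^ k \<le> Suc n" using that by (intro dvd_imp_le) (auto simp: D_def)
      finally show ?thesis by simp
    qed
    hence "finite (D n)" by (intro finite_subset[of "D n" "{..Suc n}"]) auto
    thus "((\<lambda>d. case (n, d) of (n, d) \<Rightarrow> A (Suc n div d ^ k) * B d) has_sum (\<Sum>d\<in>D n. A (Suc n div d ^ k) * B d)) (D n)"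
      by simp
  qed
  thus ?thesis unfolding D_def a_def b_def by (rule has_sum_imp_sums)
qed

section \<open>The Cahen--Mellin integral\<close>

lemma residue_Gamma_times_exp:
  "residue (\<lambda>s. Gamma s * exp (- s * of_real l)) (- of_nat n) = (-1) ^ n / fact n * exp (of_nat n * complex_of_real l)"
proof (rule residue_simple')
  show "open (- (\<int>\<^sub>\<le>\<^sub>0 - {- of_nat n}) :: complex set)"
    by (intro open_Compl closed_subset_Ints) (auto elim!: nonpos_Ints_cases)
  show "- complex_of_nat n \<in> - (\<int>\<^sub>\<le>\<^sub>0 - {- of_nat n})" by simp
  show "(\<lambda>s. Gamma s * exp (- s * of_real l)) holomorphic_on - (\<int>\<^sub>\<le>\<^sub>0 - {- of_nat n}) - {- of_nat n}"
    by (intro holomorphic_intros) auto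
  have "((\<lambda>s. Gamma s * (s + of_nat n) * exp (- s * of_real l)) \<longlongrightarrow> (-1) ^ n / fact n * exp (- (- of_nat n) * complex_of_real l)) (at (- of_nat n))"
    by (intro tendsto_intros Gamma_residues)
  thus "((\<lambda>s. Gamma s * exp (- s * of_real l) * (s - - of_nat n)) \<longlongrightarrow> (-1) ^ n / fact n * exp (of_nat n * complex_of_real l)) (at (- of_nat n))"
    by (simp add: mult_ac)
qed

text \<open>Multiplication by z (z + 1) ... (z + n) leads to the line Re = 1/2. The modulus of z + i
  is at least n + 1/2 - i, hence at least n - i, and at least 1/2 for i = n; the product of these
  bounds is n! / 2.\<close>

lemma norm_Gamma_left_line:
  "norm (Gamma (Complex (- real n - 1/2) t)) \<le> 2 * sqrt (2 * pi) / fact n * exp (- (pi / 2) * \<bar>t\<bar>)"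
proof -
  define z where "z = Complex (- real n - 1/2) t"
  have z: "z \<notin> \<int>\<^sub>\<le>\<^sub>0"
  proof
    assume "z \<in> \<int>\<^sub>\<le>\<^sub>0"
    then obtain m :: int where "z = of_int m" by (auto elim!: nonpos_Ints_cases)
    hence "real_of_int m = - real n - 1/2" by (simp add: z_def complex_eq_iff)
    hence "real_of_int (2 * m + 2 * int n + 1) = 0" by simp
    hence "2 * m + 2 * int n + 1 = 0" by (simp only: of_int_eq_0_iff)
    thus False by presburger
  qed
  have "fact n / 2 \<le> norm (pochhammer z (Suc n))"
  proof -
    have "(fact n / 2 :: real) = (\<Prod>i<Suc n. if i = n then 1/2 else real (n - i))"
    proof -
      have "(\<Prod>i<n. if i = n then 1/2 else real (n - i)) = (\<Prod>i<n. real (n - i))" by (intro prod.cong) auto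
      also have "\<dots> = (\<Prod>i=1..n. real i)"
        by (rule prod.reindex_bij_witness[of _ "\<lambda>i. n - i" "\<lambda>i. n - i"]) auto
      finally show ?thesis by (simp add: fact_prod)
    qed
    also have "\<dots> \<le> (\<Prod>i<Suc n. norm (z + of_nat i))"
    proof (intro prod_mono conjI)
      fix i assume i: "i \<in> {..<Suc n}"
      have "\<bar>- real n - 1/2 + real i\<bar> \<le> norm (z + of_nat i)"
        using abs_Re_le_cmod[of "z + of_nat i"] by (simp add: z_def)
      thus "(if i = n then 1/2 else real (n - i)) \<le> norm (z + of_nat i)"
        using i by (auto simp: of_nat_diff split: if_splits)
    qed auto
    also have "\<dots> = norm (pochhammer z (Suc n))" by (simp only: pochhammer_prod_upto prod_norm)
    finally show ?thesis .
  qed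
  hence le: "fact n / 2 * norm (Gamma z) \<le> norm (pochhammer z (Suc n)) * norm (Gamma z)"
    by (rule mult_right_mono) auto
  have "pochhammer z (Suc n) * Gamma z = Gamma (z + of_nat (Suc n))"
    using pochhammer_Gamma[OF z, of "Suc n"] z by (simp add: Gamma_eq_zero_iff del: of_nat_Suc)
  also have "z + of_nat (Suc n) = Complex (1/2) t" by (simp add: z_def complex_eq_iff)
  finally have "norm (pochhammer z (Suc n)) * norm (Gamma z) = norm (Gamma (Complex (1/2) t))" by (metis norm_mult)
  also have "\<dots> \<le> sqrt (2 * pi) * exp (- (pi / 2) * \<bar>t\<bar>)" by (rule norm_Gamma_half_line)
  finally have "fact n / 2 * norm (Gamma z) \<le> sqrt (2 * pi) * exp (- (pi / 2) * \<bar>t\<bar>)" using le by linarith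
  thus ?thesis by (simp add: z_def field_simps)
qed

text \<open>On Re s = -n - 1/2 the factorial in the bound for Gamma beats y^n, so pushing the line
  to the left without end leaves just the series of the residues (-y)^n / n!.\<close>

theorem Cahen_Mellin:
  assumes "c > 0" "y > 0"
  shows "line_integral (\<lambda>s. Gamma s * exp (- s * of_real (ln y))) c = 2 * of_real pi * of_real (exp (- y))"
proof -
  define f where "f = (\<lambda>s::complex. Gamma s * exp (- s * of_real (ln y)))"
  have growth: "strip_growth f a b (- (pi / 4))" for a b
  proof -
    have "strip_growth (\<lambda>s. Gamma s * exp (- s * (of_real (ln y) + \<i> * of_real 0))) a b (pi / 4 - pi / 2 + \<bar>0\<bar>)"
      by (intro strip_growth_mult strip_growth_exp strip_growth_Gamma) auto
    thus ?thesis by (simp add: f_def)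
  qed
  have nonint: "s \<notin> \<int>\<^sub>\<le>\<^sub>0" if "Re s = - real n - 1/2" for s n
  proof
    assume "s \<in> \<int>\<^sub>\<le>\<^sub>0"
    then obtain m :: int where "s = of_int m" by (auto elim!: nonpos_Ints_cases)
    hence "real_of_int (2 * m + 2 * int n + 1) = 0" using that by simp
    hence "2 * m + 2 * int n + 1 = 0" by (simp only: of_int_eq_0_iff)
    thus False by presburger
  qed
  have shift: "line_integral f c - line_integral f (- real n - 1/2) = 2 * of_real pi * of_real (\<Sum>i\<le>n. (- y) ^ i / fact i)" for n
  proof -
    define P :: "complex set" where "P = (\<lambda>i. - of_nat i) ` {..n}"
    have "line_integral f c - line_integral f (- real n - 1/2) = 2 * of_real pi * (\<Sum>p\<in>P. residue f p)"
    proof (rule line_integral_shift[where a' = "- real n - 3/4"])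
      show "f holomorphic_on {s. - real n - 3/4 < Re s} - P"
      proof -
        have "s \<in> P" if "s \<in> \<int>\<^sub>\<le>\<^sub>0" "- real n - 3/4 < Re s" for s
        proof -
          obtain m :: int where m: "s = of_int m" "m \<le> 0" using \<open>s \<in> \<int>\<^sub>\<le>\<^sub>0\<close> by (auto elim!: nonpos_Ints_cases)
          hence "- real n - 1 < real_of_int m" using that by simp
          hence "- int n - 1 < m" by linarith
          hence "nat (- m) \<le> n" "s = - of_nat (nat (- m))" using m by (auto simp: of_nat_nat)
          thus ?thesis unfolding P_def by blast
        qed
        thus ?thesis unfolding f_def by (intro holomorphic_intros) auto
      qed
      show "- real n - 1/2 < Re p \<and> Re p < c" if "p \<in> P" for p
        using that assms by (auto simp: P_def)
      show "strip_growth f (- real n - 1/2) c (- (pi / 4))" by (rule growth)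
    qed (use assms in \<open>auto simp: P_def\<close>)
    also have "(\<Sum>p\<in>P. residue f p) = (\<Sum>i\<le>n. residue f (- of_nat i))"
      unfolding P_def by (subst sum.reindex) (auto simp: inj_on_def)
    also have "\<dots> = of_real (\<Sum>i\<le>n. (- y) ^ i / fact i)"
    proof -
      have "exp (of_nat i * complex_of_real (ln y)) = of_real y ^ i" for i
        unfolding exp_of_nat_mult using assms by (simp add: exp_of_real)
      hence "residue f (- of_nat i) = of_real ((- y) ^ i / fact i)" for i
        unfolding f_def residue_Gamma_times_exp by (simp add: power_mult_distrib[symmetric] mult.commute)
      thus ?thesis by simp
    qed
    finally show ?thesis .
  qed
  have int: "integrable lborel (\<lambda>t::real. exp (- (pi / 2) * \<bar>t\<bar>))" by (rule integrable_exp_neg_abs) simp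
  define I where "I = (LINT t|lborel. exp (- (pi / 2) * \<bar>t\<bar>))"
  have bound: "norm (line_integral f (- real n - 1/2)) \<le> 2 * sqrt (2 * pi) * sqrt y * I * (y ^ n / fact n)" for n
  proof -
    have pt: "norm (f (Complex (- real n - 1/2) t)) \<le> 2 * sqrt (2 * pi) * sqrt y * (y ^ n / fact n) * exp (- (pi / 2) * \<bar>t\<bar>)" for t
    proof -
      have "(real n + 1/2) * ln y = ln (y ^ n * sqrt y)"
        using assms by (simp add: ln_mult ln_realpow ln_sqrt algebra_simps)
      hence "exp ((real n + 1/2) * ln y) = y ^ n * sqrt y" using assms by simp
      moreover have "norm (exp (- Complex (- real n - 1/2) t * of_real (ln y))) = exp ((real n + 1/2) * ln y)"
        by (simp add: norm_exp_eq_Re algebra_simps)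
      ultimately have "norm (f (Complex (- real n - 1/2) t)) = norm (Gamma (Complex (- real n - 1/2) t)) * (y ^ n * sqrt y)"
        unfolding f_def norm_mult by simp
      also have "\<dots> \<le> 2 * sqrt (2 * pi) / fact n * exp (- (pi / 2) * \<bar>t\<bar>) * (y ^ n * sqrt y)"
        using assms by (intro mult_right_mono norm_Gamma_left_line) auto
      finally show ?thesis by (simp add: mult_ac)
    qed
    have "norm (line_integral f (- real n - 1/2)) \<le> (LINT t|lborel. norm (f (Complex (- real n - 1/2) t)))"
      unfolding line_integral_def by (rule integral_norm_bound)
    also have "\<dots> \<le> (LINT t|lborel. 2 * sqrt (2 * pi) * sqrt y * (y ^ n / fact n) * exp (- (pi / 2) * \<bar>t\<bar>))"
    proof (rule integral_mono)
      have "integrable lborel (\<lambda>t. f (Complex (- real n - 1/2) t))"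
      proof (rule integrable_line)
        show "continuous_on {s. Re s = - real n - 1/2} f"
          unfolding f_def using nonint by (intro continuous_intros) auto
      qed (rule growth, simp)
      thus "integrable lborel (\<lambda>t. norm (f (Complex (- real n - 1/2) t)))" by simp
    qed (use int pt in auto)
    also have "\<dots> = 2 * sqrt (2 * pi) * sqrt y * I * (y ^ n / fact n)" by (simp add: I_def mult_ac)
    finally show ?thesis .
  qed
  have "(\<lambda>n. y ^ n / fact n) \<longlonglongrightarrow> 0"
    using summable_LIMSEQ_zero[OF summable_exp[of y]] by (simp add: divide_inverse mult.commute)
  from tendsto_mult_left[OF this, of "2 * sqrt (2 * pi) * sqrt y * I"]
  have "(\<lambda>n. 2 * sqrt (2 * pi) * sqrt y * I * (y ^ n / fact n)) \<longlonglongrightarrow> 0" by simp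
  hence lim0: "(\<lambda>n. line_integral f (- real n - 1/2)) \<longlonglongrightarrow> 0"
    by (rule Lim_null_comparison[rotated]) (use bound in auto)
  have "(\<lambda>i. (- y) ^ i / fact i) sums exp (- y)"
    using exp_converges[of "- y"] by (simp add: divide_inverse mult.commute)
  hence "(\<lambda>n. \<Sum>i\<le>n. (- y) ^ i / fact i) \<longlonglongrightarrow> exp (- y)" by (simp add: sums_def_le)
  hence "(\<lambda>n. 2 * complex_of_real pi * of_real (\<Sum>i\<le>n. (- y) ^ i / fact i)) \<longlonglongrightarrow> 2 * of_real pi * of_real (exp (- y))"
    by (intro tendsto_intros)
  hence "(\<lambda>n. line_integral f c - line_integral f (- real n - 1/2)) \<longlonglongrightarrow> 2 * of_real pi * of_real (exp (- y))"
    unfolding shift .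
  moreover have "(\<lambda>n. line_integral f c - line_integral f (- real n - 1/2)) \<longlonglongrightarrow> line_integral f c - 0"
    by (intro tendsto_intros lim0)
  ultimately have "2 * of_real pi * of_real (exp (- y)) = line_integral f c - 0" by (rule LIMSEQ_unique)
  thus ?thesis by (simp add: f_def)
qed

section \<open>Mellin--Barnes integrals\<close>

text \<open>On the line the modulus exp(-c l) of exp(-s l) is independent of t. Each summand is thus
  dominated by a constant times |H|, and convergence at the real point c justifies the
  interchange.\<close>

lemma line_integral_sums:
  fixes g l :: "nat \<Rightarrow> real"
  assumes "integrable lborel (\<lambda>t. H (Complex c t))"
    and g: "\<And>n. g n \<ge> 0" and sum: "summable (\<lambda>n. g n * exp (- c * l n))"
  shows "(\<lambda>n. of_real (g n) * line_integral (\<lambda>s. H s * exp (- s * of_real (l n))) c) sums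
     line_integral (\<lambda>s. H s * (\<Sum>n. of_real (g n) * exp (- s * of_real (l n)))) c"
proof -
  define f where "f = (\<lambda>n t. H (Complex c t) * (of_real (g n) * exp (- Complex c t * of_real (l n))))"
  have norm: "norm (f n t) = norm (H (Complex c t)) * (g n * exp (- c * l n))" for n t
    using g[of n] by (simp add: f_def norm_mult norm_exp_eq_Re)
  have int: "integrable lborel (f n)" for n
  proof (rule Bochner_Integration.integrable_bound)
    show "integrable lborel (\<lambda>t. (g n * exp (- c * l n)) *\<^sub>R H (Complex c t))" using assms(1) by simp
    have "(\<lambda>t. H (Complex c t)) \<in> borel_measurable lborel" using assms(1) by auto
    moreover have "(\<lambda>t. of_real (g n) * exp (- Complex c t * of_real (l n))) \<in> borel_measurable borel"
      unfolding Complex_eq by (intro borel_measurable_continuous_onI continuous_intros)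
    ultimately show "f n \<in> borel_measurable lborel" unfolding f_def by measurable
    show "AE t in lborel. norm (f n t) \<le> norm ((g n * exp (- c * l n)) *\<^sub>R H (Complex c t))"
      using g[of n] by (auto simp: norm abs_mult mult_ac)
  qed
  have "(\<lambda>n. integral\<^sup>L lborel (f n)) sums (LINT t|lborel. (\<Sum>n. f n t))"
  proof (rule sums_integral[OF int])
    show "AE t in lborel. summable (\<lambda>n. norm (f n t))"
      unfolding norm using sum by (intro AE_I2 summable_mult)
    show "summable (\<lambda>n. LINT t|lborel. norm (f n t))"
      unfolding norm using sum by (simp add: summable_mult)
  qed
  moreover have "(\<Sum>n. f n t) = H (Complex c t) * (\<Sum>n. of_real (g n) * exp (- Complex c t * of_real (l n)))" for t
  proof -
    have "summable (\<lambda>n. of_real (g n) * exp (- Complex c t * complex_of_real (l n)))"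
      by (rule summable_norm_cancel) (use sum g in \<open>simp add: norm_mult norm_exp_eq_Re\<close>)
    thus ?thesis unfolding f_def by (rule suminf_mult)
  qed
  moreover have "integral\<^sup>L lborel (f n) = of_real (g n) * line_integral (\<lambda>s. H s * exp (- s * of_real (l n))) c" for n
    unfolding line_integral_def f_def by (subst integral_mult_right_zero[symmetric]) (simp add: mult_ac)
  ultimately show ?thesis unfolding line_integral_def by simp
qed

lemma line_integral_reflect: "line_integral (\<lambda>s. f (1 - s)) c = line_integral f (1 - c)"
proof -
  have "line_integral f (1 - c) = (LINT t|lborel. f (Complex (1 - c) (0 + (-1) * t)))"
    unfolding line_integral_def by (subst lborel_integral_real_affine[where c = "-1" and t = 0]) auto
  also have "(\<lambda>t. Complex (1 - c) (0 + (-1) * t)) = (\<lambda>t. 1 - Complex c t)"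
    by (auto simp: complex_eq_iff)
  hence "(\<lambda>t. f (Complex (1 - c) (0 + (-1) * t))) = (\<lambda>t. f (1 - Complex c t))" by metis
  finally show ?thesis by (simp add: line_integral_def)
qed

lemma line_integral_cong:
  assumes "\<And>s. Re s = c \<Longrightarrow> f s = g s"
  shows "line_integral f c = line_integral g c"
  unfolding line_integral_def by (rule Bochner_Integration.integral_cong) (auto intro: assms)

lemma strip_growth_Gamma_prod:
  assumes "\<And>b. b \<in> set bs \<Longrightarrow> b \<in> \<real>" "bs \<noteq> []" "\<bar>\<theta>\<bar> < real (length bs) * pi / 2"
  obtains \<kappa> where "\<kappa> < 0" "\<And>l x y. strip_growth (\<lambda>s. (\<Prod>b\<leftarrow>bs. Gamma (b + s)) * exp (- s * (of_real l + \<i> * of_real \<theta>))) x y \<kappa>"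
proof
  define k where "k = real (length bs)"
  have k: "k > 0" using assms(2) by (simp add: k_def)
  \<comment> \<open>Half of the gap between k pi / 2 and |theta| is distributed among the k factors;
    the total rate is then minus the other half.\<close>
  define \<epsilon> where "\<epsilon> = (k * pi / 2 - \<bar>\<theta>\<bar>) / (2 * k)"
  have \<epsilon>: "\<epsilon> > 0" using assms(3) k by (simp add: \<epsilon>_def k_def)
  define \<kappa> where "\<kappa> = k * (\<epsilon> - pi / 2) + \<bar>\<theta>\<bar>"
  have "\<kappa> = - (k * pi / 2 - \<bar>\<theta>\<bar>) / 2" using k by (simp add: \<kappa>_def \<epsilon>_def field_simps)
  thus "\<kappa> < 0" using assms(3) by (simp add: k_def)
  fix l x y
  have "strip_growth (\<lambda>s. \<Prod>b\<leftarrow>bs. Gamma (b + s)) x y (real (length bs) * (\<epsilon> - pi / 2))"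
  proof (rule strip_growth_prod_list)
    fix b assume "b \<in> set bs"
    then obtain c where b: "b = of_real c" using assms(1) by (auto elim: Reals_cases)
    show "strip_growth (\<lambda>s. Gamma (b + s)) x y (\<epsilon> - pi / 2)"
      using strip_growth_shift[OF strip_growth_Gamma[OF \<epsilon>]] unfolding b by (simp add: add.commute)
  qed
  from strip_growth_mult[OF this strip_growth_exp]
  show "strip_growth (\<lambda>s. (\<Prod>b\<leftarrow>bs. Gamma (b + s)) * exp (- s * (of_real l + \<i> * of_real \<theta>))) x y \<kappa>"
    by (simp add: \<kappa>_def k_def)
qed

lemma holomorphic_Gamma_prod:
  assumes "\<And>b. b \<in> set bs \<Longrightarrow> - Re b \<le> a"
  shows "(\<lambda>s. \<Prod>b\<leftarrow>bs. Gamma (b + s)) holomorphic_on {s. Re s > a}"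
  using assms
proof (induction bs)
  case (Cons b bs)
  have "(\<lambda>s. Gamma (b + s)) holomorphic_on {s. Re s > a}"
    using Cons.prems[of b] by (intro holomorphic_intros) (auto elim!: nonpos_Ints_cases simp: complex_eq_iff)
  with Cons show ?case by (auto intro!: holomorphic_intros)
qed auto

text \<open>No pole lies between two lines to the right of all -b, so the shift formula applies with
  an empty set of residues. This frees the Meijer integral from the particular abscissa selected in
  its definition.\<close>

lemma line_integral_Gamma_prod_shift:
  fixes l :: real
  assumes bs: "\<And>b. b \<in> set bs \<Longrightarrow> b \<in> \<real>" "bs \<noteq> []" and \<theta>: "\<bar>\<theta>\<bar> < real (length bs) * pi / 2"
    and c: "\<And>b. b \<in> set bs \<Longrightarrow> - Re b < c" "\<And>b. b \<in> set bs \<Longrightarrow> - Re b < c'"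
  defines "f \<equiv> \<lambda>s. (\<Prod>b\<leftarrow>bs. Gamma (b + s)) * exp (- s * (of_real l + \<i> * of_real \<theta>))"
  shows "line_integral f c = line_integral f c'"
proof -
  obtain \<kappa> where \<kappa>: "\<kappa> < 0" "\<And>x y. strip_growth f x y \<kappa>"
    unfolding f_def by (rule strip_growth_Gamma_prod[OF bs \<theta>]) blast+
  have main: "line_integral f y - line_integral f x = 0" if "x < y" "\<And>b. b \<in> set bs \<Longrightarrow> - Re b < x" for x y
  proof -
    define a where "a = Max ((\<lambda>b. - Re b) ` set bs)"
    have a: "a < x" "\<And>b. b \<in> set bs \<Longrightarrow> - Re b \<le> a" using that(2) bs(2) by (auto simp: a_def)
    have "line_integral f y - line_integral f x = 2 * of_real pi * (\<Sum>p\<in>{}. residue f p)"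
    proof (rule line_integral_shift[OF _ a(1) that(1) _ _ \<kappa>(2,1)])
      show "f holomorphic_on {s. a < Re s} - {}"
        unfolding f_def Diff_empty by (intro holomorphic_intros holomorphic_Gamma_prod a)
    qed auto
    thus ?thesis by simp
  qed
  show ?thesis using main[of c c'] main[of c' c] c by (cases c c' rule: linorder_cases) auto
qed

text \<open>About \<open>line_abscissa\<close> only its defining property can be known, and only if
  some real number satisfies it. The given c does, because -b is the rightmost pole of each factor;
  the line can then be moved to c.\<close>

lemma meijer_G_line_integral:
  assumes bs: "\<And>b. b \<in> set bs \<Longrightarrow> b \<in> \<real>" "bs \<noteq> []" and \<theta>: "\<bar>\<theta>\<bar> < real (length bs) * pi / 2"
    and c: "\<And>b. b \<in> set bs \<Longrightarrow> - Re b < c"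
  shows "line_integral (\<lambda>s. (\<Prod>b\<leftarrow>bs. Gamma (b + s)) * exp (- s * (of_real (ln \<rho>) + \<i> * of_real \<theta>))) c
     = 2 * of_real pi * meijer_G bs \<rho> \<theta>"
proof -
  define A where "A = line_abscissa bs"
  have "\<forall>b\<in>set bs. \<forall>m::nat. Re (- b - of_nat m) < c"
    using c by (force intro: le_less_trans[rotated])
  hence "\<forall>b\<in>set bs. \<forall>m::nat. Re (- b - of_nat m) < A"
    unfolding A_def line_abscissa_def by (rule someI[where P = "\<lambda>c. \<forall>b\<in>set bs. \<forall>m::nat. Re (- b - of_nat m) < c"])
  hence A: "- Re b < A" if "b \<in> set bs" for b
    using that by (metis diff_zero of_nat_0 uminus_complex.sel(1))
  have "2 * of_real pi * meijer_G bs \<rho> \<theta> = line_integral (\<lambda>s. (\<Prod>b\<leftarrow>bs. Gamma (b + s)) * exp (- s * (of_real (ln \<rho>) + \<i> * of_real \<theta>))) A"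
    unfolding meijer_G_def Let_def line_integral_def A_def[symmetric] integral_mult_left_zero by simp
  thus ?thesis using line_integral_Gamma_prod_shift[OF bs \<theta> c A, of "ln \<rho>"] by simp
qed

section \<open>Divisor sums as Dirichlet coefficients\<close>

text \<open>A common generalisation of \<open>divisor_D\<close> (\<open>e = 0\<close>) and
  \<open>divisor_S\<close> (\<open>e = k - 1\<close>, exponent \<open>- r\<close>), so that a single
  computation of the Dirichlet series zeta(s - rho) zeta(k s - e) serves both.\<close>

definition power_divisor_sum :: "nat \<Rightarrow> int \<Rightarrow> nat \<Rightarrow> nat \<Rightarrow> real" where
  "power_divisor_sum k \<rho> e n = (\<Sum>d | d \<ge> 1 \<and> d ^ k dvd n. (real n / real (d ^ k)) powi \<rho> * real (d ^ e))"

lemma divisor_D_eq: "divisor_D k r n = power_divisor_sum k r 0 n"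
  by (simp add: divisor_D_def power_divisor_sum_def)

lemma divisor_S_eq: "divisor_S k r n = power_divisor_sum k (- r) (k - 1) n"
  by (simp add: divisor_S_def power_divisor_sum_def)

lemma power_divisor_sum_nonneg: "power_divisor_sum k \<rho> e n \<ge> 0"
  unfolding power_divisor_sum_def by (intro sum_nonneg mult_nonneg_nonneg zero_le_power_int) auto

text \<open>For n = d^k q a summand times n^(-s) splits into q^(-(s - rho)) and d^(-(k s - e)). The
  two conditions on real parts place both zeta series in their regions of absolute
  convergence.\<close>

lemma power_divisor_sum_sums:
  assumes "k > 0" "Re (s - of_int \<rho>) > 1" "Re (of_nat k * s - of_nat e) > 1"
  shows "(\<lambda>n. of_real (power_divisor_sum k \<rho> e (Suc n)) * exp (- s * of_real (ln (real (Suc n))))) sums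
     (zeta (s - of_int \<rho>) * zeta (of_nat k * s - of_nat e))"
proof -
  define A B :: "nat \<Rightarrow> complex" where "A = (\<lambda>m. exp (- (s - of_int \<rho>) * of_real (ln (real m))))"
    and "B = (\<lambda>d. exp (- (of_nat k * s - of_nat e) * of_real (ln (real d))))"
  have sA: "(\<lambda>m. A (Suc m)) sums zeta (s - of_int \<rho>)"
    using zeta_sums[OF assms(2)] unfolding powr_complex_nat A_def .
  have sB: "(\<lambda>d. B (Suc d)) sums zeta (of_nat k * s - of_nat e)"
    using zeta_sums[OF assms(3)] unfolding powr_complex_nat B_def .
  have nA: "summable (\<lambda>m. norm (A (Suc m)))"
    using summable_Suc_powr[of "- Re (s - of_int \<rho>)"] assms(2)
    by (simp add: A_def norm_exp_eq_Re powr_def del: of_nat_Suc)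
  have nB: "summable (\<lambda>m. norm (B (Suc m)))"
    using summable_Suc_powr[of "- Re (of_nat k * s - of_nat e)"] assms(3)
    by (simp add: B_def norm_exp_eq_Re powr_def del: of_nat_Suc)
  have summand: "A (n div d ^ k) * B d = of_real ((real n / real (d ^ k)) powi \<rho> * real (d ^ e)) * exp (- s * of_real (ln (real n)))"
    if nd: "d \<ge> 1" "d ^ k dvd n" "n > 0" for n d
  proof -
    obtain q where q: "n = d ^ k * q" using nd(2) by (auto elim: dvdE)
    have pos: "q > 0" "d > 0" using q nd by (auto intro!: Nat.gr0I)
    define u v where "u = ln (real q)" and "v = ln (real d)"
    have "n div d ^ k = q" using pos by (simp add: q)
    moreover have "real n / real (d ^ k) = real q" using pos by (simp add: q)
    moreover have "real q powi \<rho> = exp (real_of_int \<rho> * u)"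
      using powr_real_of_int'[of "real q" \<rho>] pos by (simp add: powr_def u_def)
    moreover have "real (d ^ e) = exp (real e * v)"
      using pos by (simp add: v_def exp_of_nat_mult)
    moreover have "ln (real n) = real k * v + u"
      using pos by (simp add: q ln_mult ln_realpow u_def v_def)
    ultimately show ?thesis
      by (simp add: A_def B_def u_def[symmetric] v_def[symmetric] exp_of_real[symmetric] exp_add[symmetric] algebra_simps)
  qed
  have "(\<lambda>n. \<Sum>d | d \<ge> 1 \<and> d ^ k dvd Suc n. A (Suc n div d ^ k) * B d) sums
     ((\<Sum>m. A (Suc m)) * (\<Sum>d. B (Suc d)))"
    by (rule divisor_convolution_sums[OF assms(1) nA nB])
  also have "(\<lambda>n. \<Sum>d | d \<ge> 1 \<and> d ^ k dvd Suc n. A (Suc n div d ^ k) * B d) =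
      (\<lambda>n. of_real (power_divisor_sum k \<rho> e (Suc n)) * exp (- s * of_real (ln (real (Suc n)))))"
    unfolding power_divisor_sum_def of_real_sum sum_distrib_right
    by (intro ext sum.cong refl summand) auto
  finally show ?thesis using sA sB by (simp add: sums_iff)
qed

lemma power_divisor_sum_summable:
  assumes "k > 0" "c - of_int \<rho> > 1" "of_nat k * c - of_nat e > 1"
  shows "summable (\<lambda>n. power_divisor_sum k \<rho> e (Suc n) * exp (- c * ln (real (Suc n))))"
proof -
  have "summable (\<lambda>n. of_real (power_divisor_sum k \<rho> e (Suc n)) * exp (- complex_of_real c * of_real (ln (real (Suc n)))))"
    using power_divisor_sum_sums[of k "of_real c" \<rho> e] assms by (auto simp: sums_iff)
  moreover have "of_real (power_divisor_sum k \<rho> e (Suc n)) * exp (- complex_of_real c * of_real (ln (real (Suc n)))) =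
     complex_of_real (power_divisor_sum k \<rho> e (Suc n) * exp (- c * ln (real (Suc n))))" for n
    by (simp add: exp_of_real[symmetric] del: of_nat_Suc)
  ultimately show ?thesis by (simp only: summable_complex_of_real)
qed

section \<open>The functional equation of the integrand\<close>

lemma sum_j_indices:
  assumes "k > 0"
  shows "(\<Sum>j\<in>j_indices k. f j) = (\<Sum>m<k. f (2 * int m - (int k - 1)))"
proof (rule sum.reindex_bij_witness[where j = "\<lambda>j. nat ((j + (int k - 1)) div 2)" and i = "\<lambda>m. 2 * int m - (int k - 1)"])
  fix j assume "j \<in> j_indices k"
  hence j: "- (int k - 1) \<le> j" "j \<le> int k - 1" "even (j + (int k - 1))"
    by (auto simp: j_indices_def)
  obtain i where i: "j + (int k - 1) = 2 * i" using evenE[OF j(3)] by blast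
  have ii: "0 \<le> i" "i < int k" using i j assms by linarith+
  have eq: "nat ((j + (int k - 1)) div 2) = nat i" unfolding i by simp
  show "2 * int (nat ((j + (int k - 1)) div 2)) - (int k - 1) = j" using i ii unfolding eq by simp
  show "nat ((j + (int k - 1)) div 2) \<in> {..<k}" using ii unfolding eq by auto
  have "2 * i - (int k - 1) = j" using i by simp
  thus "f (2 * int (nat ((j + (int k - 1)) div 2)) - (int k - 1)) = f j" using ii unfolding eq by simp
next
  fix m assume "m \<in> {..<k}"
  thus "2 * int m - (int k - 1) \<in> j_indices k" "nat ((2 * int m - (int k - 1) + (int k - 1)) div 2) = m"
    by (auto simp: j_indices_def) presburger+
qed

text \<open>Neighbouring elements of \<open>j_indices k\<close> differ by 2, so multiplication by
  e^(i u) - e^(-i u) makes the sum telescope.\<close>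

lemma dirichlet_kernel:
  fixes u :: complex
  assumes "k > 0"
  shows "sin u * (\<Sum>j\<in>j_indices k. exp (\<i> * of_int j * u)) = sin (of_nat k * u)"
proof -
  define h where "h = (\<lambda>m. exp (\<i> * of_int (2 * int m - int k) * u))"
  have "(exp (\<i> * u) - exp (- (\<i> * u))) * (\<Sum>j\<in>j_indices k. exp (\<i> * of_int j * u)) = (\<Sum>m<k. h (Suc m) - h m)"
    unfolding sum_j_indices[OF assms] sum_distrib_left
    by (intro sum.cong refl) (simp add: h_def left_diff_distrib exp_add[symmetric] algebra_simps)
  also have "\<dots> = h k - h 0" by (rule sum_lessThan_telescope)
  also have "\<dots> = exp (\<i> * (of_nat k * u)) - exp (- (\<i> * (of_nat k * u)))" by (simp add: h_def algebra_simps)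
  finally show ?thesis by (simp add: sin_exp_eq)
qed

lemma prod_list_G_params:
  "(\<Prod>b\<leftarrow>G_params k r. Gamma (b + w)) = Gamma (w + of_int r) * (\<Prod>m=1..<k. Gamma (w - of_nat m / of_nat k))"
  by (simp add: G_params_def o_def prod.list_conv_set_nth[symmetric] prod.distinct_set_conv_list[symmetric] add.commute)

lemma sin_shift_even:
  assumes "even (r :: int)"
  shows "sin (of_real pi * (s - of_int r) / 2) = (-1) powi (r div 2) * sin (of_real pi * s / 2 :: complex)"
proof -
  obtain q where q: "r = 2 * q" using assms by (auto elim: evenE)
  have eq: "of_real pi * (s - of_int r) / 2 = of_real pi * s / 2 - of_real (pi * of_int q)" by (simp add: q field_simps)
  have cs: "cos (complex_of_real (pi * of_int q)) = (-1) powi q" "sin (complex_of_real (pi * of_int q)) = 0"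
    by (simp_all only: cos_of_real sin_of_real cos_npi_int sin_npi_int) (auto simp: power_int_minus_left)
  show ?thesis unfolding eq sin_diff cs by (simp add: q)
qed

text \<open>The conditions on real parts are those of the functional equation for the two zeta
  factors; off the integers sin(pi s) is nonzero, so that sine and cosine can be cancelled. All
  powers are carried as exponentials of the logarithms \<open>L\<close>, \<open>K\<close> and
  \<open>X\<close>, which reduces the constants to an identity between exponents.\<close>

lemma zeta_product_functional:
  fixes k :: nat and r :: int and x :: real and s :: complex
  assumes k: "k \<ge> 2" "even k" and r: "even r" and x: "x > 0"
    and s: "Re s < 0" "Re (s - of_int r) < 0" "s \<notin> \<int>"
  defines "w \<equiv> 1 - s"
  shows "Gamma s * zeta (of_nat k * s) * zeta (s - of_int r) * exp (- s * of_real (ln x)) =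
     (-1) powi ((int k + r - 2) div 2) * of_real ((2 * pi) powr ((real k + 1 - 2 * of_int r) / 2))
          / of_real (x * real k powr ((2 * real k - 1) / 2))
     * (\<Sum>j\<in>j_indices k. (\<Prod>b\<leftarrow>G_params k r. Gamma (b + w)) * exp (- w * (of_real (ln (X_modulus k x 1)) + \<i> * of_real (X_arg j))))
     * (zeta (w + of_int r) * zeta (of_nat k * w - of_nat (k - 1)))"
proof -
  define L where "L = complex_of_real (ln (2 * pi))"
  define K where "K = complex_of_real (ln (real k))"
  define X where "X = complex_of_real (ln x)"
  define Z where "Z = zeta (w + of_int r) * zeta (of_nat k * w - of_nat (k - 1))"
  define E where "E = (\<Sum>j\<in>j_indices k. exp (\<i> * of_int j * (of_real pi * w / 2)))"
  define P where "P = (\<Prod>m=1..<k. Gamma (w - of_nat m / of_nat k))"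
  have k0: "k > 0" "complex_of_nat k \<noteq> 0" using k by auto
  have sw: "s = 1 - w" by (simp add: w_def)
  define sn where "sn = sin (of_real pi * s / 2)"
  define cs where "cs = cos (of_real pi * s / 2)"
  have cs_sin: "cs = sin (of_real pi * w / 2)"
  proof -
    have "of_real pi * s / 2 = of_real pi / 2 - of_real pi * w / 2" by (simp add: sw field_simps)
    hence "cs = cos (of_real pi / 2 - of_real pi * w / 2)" by (simp only: cs_def)
    thus ?thesis by (simp only: sin_cos_eq)
  qed
  have sin_pi_s: "sin (of_real pi * s) = 2 * sn * cs"
    using sin_double[of "of_real pi * s / 2"] by (simp add: sn_def cs_def)
  have sin_nz: "sin (of_real pi * s) \<noteq> 0"
  proof
    assume "sin (of_real pi * s) = 0"
    then obtain n :: int where "of_real pi * s = of_real (real_of_int n * pi)"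
      unfolding Complex_Transcendental.sin_eq_0 by blast
    hence "of_real pi * s = of_real pi * of_int n" by simp
    hence "s = of_int n" by (simp only: mult_cancel_left) simp
    thus False using s(3) by simp
  qed
  have nz: "sn \<noteq> 0" "cs \<noteq> 0" using sin_nz sin_pi_s by auto
  have w_pos: "Re w > 1" using s by (simp add: w_def)
  hence Gw: "Gamma w \<noteq> 0" by (auto simp: Gamma_eq_zero_iff elim!: nonpos_Ints_cases)
  \<comment> \<open>Reflection gives pi / (2 sn cs Gamma w) for Gamma s; the sine belonging to
    zeta(s - r) removes sn and leaves cs in the denominator.\<close>
  have g1: "Gamma s * sn = of_real pi / (2 * cs * Gamma w)"
    using Gamma_reflection_complex[of s] nz Gw unfolding w_def[symmetric] sin_pi_s
    by (simp add: field_simps)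
  \<comment> \<open>As k is even, pi k s / 2 differs from -k pi w / 2 by an integral multiple of pi.
    The kernel then supplies the factor cs that meets the denominator of \<open>g1\<close>.\<close>
  have g2: "sin (of_real pi * (of_nat k * s) / 2) = (-1) ^ (k div 2 - 1) * (cs * E)"
  proof -
    obtain q where q: "k = 2 * q" using k by (auto elim: evenE)
    have "q > 0" using q k by auto
    have eq: "of_real pi * (of_nat k * s) / 2 = of_real (pi * real q) - of_nat k * (of_real pi * w / 2)"
      by (simp add: sw q field_simps)
    have cs': "cos (complex_of_real (pi * real q)) = (-1) ^ q" "sin (complex_of_real (pi * real q)) = 0"
      by (simp_all only: cos_of_real sin_of_real) (simp_all add: mult.commute)
    have "sin (of_real pi * (of_nat k * s) / 2) = - ((-1) ^ q * sin (of_nat k * (of_real pi * w / 2)))"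
      unfolding eq sin_diff cs' by simp
    also have "sin (of_nat k * (of_real pi * w / 2)) = cs * E"
      unfolding cs_sin E_def by (rule dirichlet_kernel[OF k0(1), symmetric])
    also have "- ((-1) ^ q * (cs * E)) = (-1) ^ (q - 1) * (cs * E)"
      using \<open>q > 0\<close> by (cases q) auto
    finally show ?thesis by (simp add: q)
  qed
  have g3: "Gamma (1 - of_nat k * s) = Gamma w * P * exp ((of_nat k * w - of_nat k + 1) * K) * exp (- ((of_nat k - 1) / 2 * L) - K / 2)"
  proof -
    \<comment> \<open>Chosen such that k z = 1 - k s. The points z + l / k are then the w - m / k
      with m = k - 1 - l, and m = 0 yields the Gamma w that cancels against
      \<open>g1\<close>.\<close>
    define z where "z = w - 1 + 1 / of_nat k"
    have kz: "of_nat k * z = 1 - of_nat k * s" using k0 by (simp add: z_def w_def field_simps)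
    have "real k * Re s < 0" using s k0 by (intro mult_pos_neg) auto
    hence "Re (of_nat k * z) > 0" unfolding kz by simp
    hence "of_nat k * z \<notin> \<int>\<^sub>\<le>\<^sub>0" by (metis nonpos_Ints_cases not_le of_int_0_le_iff Re_complex_of_real of_real_of_int_eq of_int_le_0_iff)
    note mult = Gamma_multiplication[OF k0(1) this]
    have "(\<Prod>l<k. Gamma (z + of_nat l / of_nat k)) = (\<Prod>m\<in>{0..<k}. Gamma (w - of_nat m / of_nat k))"
      by (rule prod.reindex_bij_witness[of _ "\<lambda>m. k - 1 - m" "\<lambda>l. k - 1 - l"])
         (use k0 in \<open>auto simp: z_def of_nat_diff field_simps\<close>)
    also have "{0..<k} = insert 0 {1..<k}" using k0 by auto
    also have "(\<Prod>m\<in>insert 0 {1..<k}. Gamma (w - of_nat m / of_nat k)) = Gamma w * P" by (simp add: P_def)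
    finally have prod: "(\<Prod>l<k. Gamma (z + of_nat l / of_nat k)) = Gamma w * P" .
    have "(2 * pi) powr ((real k - 1) / 2) * sqrt (real k) = exp ((real k - 1) / 2 * ln (2 * pi) + ln (real k) / 2)"
      using k0 by (simp add: powr_def exp_add ln_sqrt[symmetric])
    hence const: "complex_of_real ((2 * pi) powr ((real k - 1) / 2) * sqrt (real k)) = exp ((of_nat k - 1) / 2 * L + K / 2)"
      by (simp only: exp_of_real[symmetric]) (simp add: L_def K_def)
    have "Gamma w * P = exp ((of_nat k - 1) / 2 * L + K / 2) * exp (- (of_nat k * z * K)) * Gamma (of_nat k * z)"
      using mult unfolding prod const by (simp only: K_def)
    hence "Gamma w * P * exp (of_nat k * z * K) * exp (- ((of_nat k - 1) / 2 * L + K / 2)) =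
       (exp ((of_nat k - 1) / 2 * L + K / 2) * exp (- ((of_nat k - 1) / 2 * L + K / 2))) *
       (exp (- (of_nat k * z * K)) * exp (of_nat k * z * K)) * Gamma (of_nat k * z)"
      by (simp only: mult_ac)
    also have "\<dots> = Gamma (of_nat k * z)" by (simp add: mult_exp_exp)
    finally have "Gamma (of_nat k * z) = Gamma w * P * exp (of_nat k * z * K) * exp (- ((of_nat k - 1) / 2 * L + K / 2))" ..
    moreover have "of_nat k * z = of_nat k * w - of_nat k + 1" using k0 by (simp add: z_def field_simps)
    moreover have "- ((of_nat k - 1) / 2 * L + K / 2) = - ((of_nat k - 1) / 2 * L) - K / 2" by simp
    ultimately show ?thesis using kz by metis
  qed
  have f1: "zeta (of_nat k * s) = 2 * exp ((of_nat k * s - 1) * L) * ((-1) ^ (k div 2 - 1) * (cs * E)) *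
     (Gamma w * P * exp ((of_nat k * w - of_nat k + 1) * K) * exp (- ((of_nat k - 1) / 2 * L) - K / 2)) * zeta (of_nat k * w - of_nat (k - 1))"
  proof -
    have "1 - of_nat k * s = of_nat k * w - of_nat (k - 1)" using k0 by (simp add: w_def of_nat_diff algebra_simps)
    hence reflect: "zeta (1 - of_nat k * s) = zeta (of_nat k * w - of_nat (k - 1))" by (rule arg_cong)
    have "Re (of_nat k * s) < 0" using s k0 by (simp add: mult_pos_neg)
    hence "zeta (of_nat k * s) = 2 * exp ((of_nat k * s - 1) * L) * sin (of_real pi * (of_nat k * s) / 2) * Gamma (1 - of_nat k * s) * zeta (1 - of_nat k * s)"
      unfolding L_def by (rule zeta_functional)
    thus ?thesis unfolding g2 g3 reflect .
  qed
  have f2: "zeta (s - of_int r) = 2 * exp ((s - of_int r - 1) * L) * ((-1) powi (r div 2) * sn) * Gamma (w + of_int r) * zeta (w + of_int r)"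
  proof -
    have "1 - (s - of_int r) = w + of_int r" by (simp add: w_def)
    thus ?thesis using zeta_functional[OF s(2)] unfolding sin_shift_even[OF r] by (simp only: L_def sn_def)
  qed
  define T1 where "T1 = exp ((of_nat k * s - 1) * L)"
  define T2 where "T2 = exp ((s - of_int r - 1) * L)"
  define T3 where "T3 = exp ((of_nat k * w - of_nat k + 1) * K)"
  define T4 where "T4 = exp (- ((of_nat k - 1) / 2 * L) - K / 2)"
  define T5 where "T5 = exp (- s * X)"
  define sg :: complex where "sg = (-1) ^ (k div 2 - 1) * (-1) powi (r div 2)"
  have sg: "sg = (-1) powi ((int k + r - 2) div 2)"
  proof -
    obtain q where q: "k = 2 * q" using k by (auto elim: evenE)
    obtain p where p: "r = 2 * p" using r by (auto elim: evenE)
    have "q > 0" using q k by auto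
    hence "int (q - 1) + p = (int k + r - 2) div 2" by (simp add: q p of_nat_diff)
    moreover have "sg = (-1) powi (int (q - 1) + p)" by (simp add: sg_def q p power_int_add power_int_of_nat)
    ultimately show ?thesis by simp
  qed
  have "Gamma s * zeta (of_nat k * s) * zeta (s - of_int r) * exp (- s * of_real (ln x)) =
     4 * sg * (T1 * T2 * T3 * T4 * T5) * (Gamma s * sn) * (cs * Gamma w) * E * (Gamma (w + of_int r) * P) * Z"
    unfolding f1 f2 X_def[symmetric] T1_def[symmetric] T2_def[symmetric] T3_def[symmetric] T4_def[symmetric] T5_def[symmetric] sg_def Z_def
    by (simp only: mult_ac) (simp add: mult_ac)
  also have "\<dots> = sg * (2 * of_real pi * (T1 * T2 * T3 * T4 * T5)) * E * (Gamma (w + of_int r) * P) * Z"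
    unfolding g1 using nz Gw by (simp add: field_simps)
  also have "2 * of_real pi * (T1 * T2 * T3 * T4 * T5) =
     of_real ((2 * pi) powr ((real k + 1 - 2 * of_int r) / 2)) / of_real (x * real k powr ((2 * real k - 1) / 2)) * exp (- w * of_real (ln (X_modulus k x 1)))"
  proof -
    have l0: "complex_of_real (ln (X_modulus k x 1)) = (of_nat k + 1) * L - of_nat k * K - X"
    proof -
      have "ln (X_modulus k x 1) = ln ((2 * pi) ^ (k + 1)) - ln (real k ^ k * x)"
        unfolding X_modulus_def using x k0 by (subst ln_div) auto
      also have "\<dots> = real (k + 1) * ln (2 * pi) - (real k * ln (real k) + ln x)"
        using x k0 by (simp only: ln_realpow ln_mult zero_less_power of_nat_0_less_iff zero_less_mult_iff pi_gt_zero) (simp add: ln_mult ln_realpow)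
      finally have ln_X: "ln (X_modulus k x 1) = real (k + 1) * ln (2 * pi) - (real k * ln (real k) + ln x)" .
      show ?thesis unfolding ln_X by (simp add: L_def K_def X_def algebra_simps)
    qed
    have "2 * complex_of_real pi = exp L" by (simp add: L_def exp_of_real)
    hence "2 * of_real pi * (T1 * T2 * T3 * T4 * T5) = exp (L + ((of_nat k * s - 1) * L + (s - of_int r - 1) * L + (of_nat k * w - of_nat k + 1) * K + (- ((of_nat k - 1) / 2 * L) - K / 2) + - s * X))"
      by (simp only: T1_def T2_def T3_def T4_def T5_def exp_add)
    \<comment> \<open>With s = 1 - w inserted, the coefficients of L, K and X agree; what is
      proportional to w is the logarithm of the modulus of X(j) at n = 1.\<close>
    also have "\<dots> = exp ((of_nat k + 1 - 2 * of_int r) / 2 * L + (- X - (2 * of_nat k - 1) / 2 * K) + - w * ((of_nat k + 1) * L - of_nat k * K - X))"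
      by (rule arg_cong[of _ _ exp]) (simp add: sw field_simps)
    also have "\<dots> = exp ((of_nat k + 1 - 2 * of_int r) / 2 * L) * exp (- X - (2 * of_nat k - 1) / 2 * K) * exp (- w * of_real (ln (X_modulus k x 1)))"
      unfolding l0 by (simp only: exp_add)
    also have "exp ((of_nat k + 1 - 2 * of_int r) / 2 * L) = of_real ((2 * pi) powr ((real k + 1 - 2 * of_int r) / 2))"
      by (simp add: powr_def L_def exp_of_real[symmetric])
    also have "exp (- X - (2 * of_nat k - 1) / 2 * K) = 1 / of_real (x * real k powr ((2 * real k - 1) / 2))"
    proof -
      have "x * real k powr ((2 * real k - 1) / 2) = exp (ln x + (2 * real k - 1) / 2 * ln (real k))"
        using x k0 by (simp add: powr_def exp_add)
      hence "complex_of_real (x * real k powr ((2 * real k - 1) / 2)) = exp (X + (2 * of_nat k - 1) / 2 * K)"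
        by (simp only: exp_of_real[symmetric]) (simp add: X_def K_def)
      moreover have "- X - (2 * of_nat k - 1) / 2 * K = - (X + (2 * of_nat k - 1) / 2 * K)" by simp
      ultimately show ?thesis by (simp only: exp_minus inverse_eq_divide)
    qed
    finally show ?thesis by simp
  qed
  finally have main: "Gamma s * zeta (of_nat k * s) * zeta (s - of_int r) * exp (- s * of_real (ln x)) =
     sg * (of_real ((2 * pi) powr ((real k + 1 - 2 * of_int r) / 2)) / of_real (x * real k powr ((2 * real k - 1) / 2)) * exp (- w * of_real (ln (X_modulus k x 1))))
     * E * (Gamma (w + of_int r) * P) * Z" .
  have sum: "(\<Sum>j\<in>j_indices k. (\<Prod>b\<leftarrow>G_params k r. Gamma (b + w)) * exp (- w * (of_real (ln (X_modulus k x 1)) + \<i> * of_real (X_arg j))))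
     = exp (- w * of_real (ln (X_modulus k x 1))) * E * (Gamma (w + of_int r) * P)"
  proof -
    have "exp (- w * (of_real (ln (X_modulus k x 1)) + \<i> * of_real (X_arg j))) = exp (- w * of_real (ln (X_modulus k x 1))) * exp (\<i> * of_int j * (of_real pi * w / 2))" for j
      unfolding exp_add[symmetric] by (rule arg_cong[of _ _ exp]) (simp add: X_arg_def algebra_simps)
    thus ?thesis unfolding prod_list_G_params P_def[symmetric] E_def
      by (simp only: sum_distrib_left[symmetric] mult_ac)
  qed
  show ?thesis unfolding main sum sg Z_def[symmetric] by (simp only: mult_ac times_divide_eq_left times_divide_eq_right)
qed

section \<open>Residues\<close>

definition mellin_integrand :: "nat \<Rightarrow> int \<Rightarrow> real \<Rightarrow> complex \<Rightarrow> complex" where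
  "mellin_integrand k r x s = Gamma s * zeta (of_nat k * s) * zeta (s - of_int r) * exp (- s * of_real (ln x))"

lemma isCont_zeta: "s \<noteq> 1 \<Longrightarrow> isCont zeta s"
  using holomorphic_on_imp_continuous_on[OF holomorphic_zeta]
  by (rule continuous_on_interior) (simp add: interior_open open_delete)

lemma tendsto_zeta: "(f \<longlongrightarrow> a) G \<Longrightarrow> a \<noteq> 1 \<Longrightarrow> ((\<lambda>x. zeta (f x)) \<longlongrightarrow> zeta a) G"
  using isCont_tendsto_compose[OF isCont_zeta] .

lemma holomorphic_zeta_compose:
  assumes "f holomorphic_on A" "\<And>z. z \<in> A \<Longrightarrow> f z \<noteq> 1"
  shows "(\<lambda>z. zeta (f z)) holomorphic_on A"
proof -
  have "f ` A \<subseteq> UNIV - {1}" using assms(2) by auto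
  from holomorphic_on_compose_gen[OF assms(1) holomorphic_zeta this] show ?thesis by (simp add: o_def)
qed

lemma zeta_pole_shift: "((\<lambda>s. zeta (s - a) * (s - (1 + a))) \<longlongrightarrow> 1) (at (1 + a))"
proof -
  have "filterlim (\<lambda>s. s - a) (at 1) (at (1 + a))"
    by (rule filterlim_atI) (auto intro!: tendsto_eq_intros always_eventually simp: eventually_at_filter diff_eq_eq)
  from filterlim_compose[OF zeta_pole this] show ?thesis by (simp add: mult.commute diff_diff_eq add.commute)
qed

lemma zeta_pole_scale:
  assumes "k > 0"
  shows "((\<lambda>s. zeta (of_nat k * s) * (s - 1 / of_nat k)) \<longlongrightarrow> 1 / of_nat k) (at (1 / of_nat k))"
proof -
  have "filterlim (\<lambda>s. of_nat k * s) (at 1) (at (1 / of_nat k :: complex))"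
    by (rule filterlim_atI) (use assms in \<open>auto intro!: tendsto_eq_intros simp: eventually_at_filter field_simps\<close>)
  from tendsto_mult_left[OF filterlim_compose[OF zeta_pole this], of "1 / of_nat k"]
  have "((\<lambda>s. 1 / of_nat k * ((of_nat k * s - 1) * zeta (of_nat k * s))) \<longlongrightarrow> 1 / of_nat k) (at (1 / of_nat k))" by simp
  moreover have "1 / of_nat k * ((of_nat k * s - 1) * z) = z * (s - 1 / of_nat k)" for s z :: complex
    using assms by (simp add: field_simps)
  ultimately show ?thesis by simp
qed

context
  fixes k :: nat and r :: int and x :: real
  assumes k: "k \<ge> 2" "even k" and r: "even r" and x: "x > 0"
begin

lemma holomorphic_mellin_integrand:
  "mellin_integrand k r x holomorphic_on - (\<int>\<^sub>\<le>\<^sub>0 \<union> {1 / of_nat k, 1 + of_int r})"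
proof -
  have "of_nat k * z = 1 \<longleftrightarrow> z = 1 / of_nat k" for z :: complex using k by (auto simp: field_simps)
  moreover have "z - of_int r = 1 \<longleftrightarrow> z = 1 + of_int r" for z :: complex by (auto simp: algebra_simps)
  ultimately show ?thesis
    unfolding mellin_integrand_def[abs_def]
    by (intro holomorphic_on_mult holomorphic_zeta_compose) (auto intro!: holomorphic_intros)
qed

text \<open>The remaining singularities lie among the integers and two further points, hence form a
  closed set, and p is isolated. The value c = 0 is allowed, so removable singularities are covered
  too.\<close>

lemma residue_mellin_integrand:
  assumes "((\<lambda>w. mellin_integrand k r x w * (w - p)) \<longlongrightarrow> c) (at p)"
  shows "residue (mellin_integrand k r x) p = c"
proof (rule residue_simple'[OF _ _ _ assms])
  define X where "X = \<int>\<^sub>\<le>\<^sub>0 \<union> {1 / of_nat k, 1 + of_int r :: complex}"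
  have "closed (X - {p})"
    unfolding X_def Un_Diff
    by (intro closed_Un closed_subset_Ints finite_imp_closed) (auto elim!: nonpos_Ints_cases)
  thus "open (- (X - {p}))" by (rule open_Compl)
  show "mellin_integrand k r x holomorphic_on - (X - {p}) - {p}"
    using holomorphic_mellin_integrand unfolding X_def by (rule holomorphic_on_subset) auto
qed auto

lemma residue_mellin_integrand_0:
  "residue (mellin_integrand k r x) 0 = - 1 / 2 * zeta (- of_int r)"
proof (rule residue_mellin_integrand)
  have nz: "- of_int r \<noteq> (1 :: complex)"
  proof
    assume "- of_int r = (1 :: complex)"
    hence "of_int (- r) = (of_int 1 :: complex)" by simp
    thus False using r by (simp only: of_int_eq_iff) presburger
  qed
  have "((\<lambda>w. Gamma w * (w + of_nat 0) * zeta (of_nat k * w) * zeta (w - of_int r) * exp (- w * of_real (ln x)))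
    \<longlongrightarrow> (-1) ^ 0 / fact 0 * zeta (of_nat k * (- of_nat 0)) * zeta (- of_nat 0 - of_int r) * exp (- (- of_nat 0) * of_real (ln x))) (at (- of_nat 0))"
    by (intro tendsto_mult Gamma_residues tendsto_zeta tendsto_intros) (use nz in auto)
  thus "((\<lambda>w. mellin_integrand k r x w * (w - 0)) \<longlongrightarrow> - 1 / 2 * zeta (- of_int r)) (at 0)"
    by (simp add: mellin_integrand_def zeta_0 mult_ac)
qed

lemma residue_mellin_integrand_inverse_k:
  "residue (mellin_integrand k r x) (1 / of_nat k) =
     1 / of_nat k * Gamma (1 / of_nat k) * zeta (1 / of_nat k - of_int r) * of_real (x powr (- 1 / real k))"
proof (rule residue_mellin_integrand)
  have nz: "1 / of_nat k - of_int r \<noteq> (1 :: complex)"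
  proof
    assume "1 / of_nat k - of_int r = (1 :: complex)"
    hence "1 = of_nat k * (of_int r + 1 :: complex)" using k by (simp add: field_simps)
    hence "of_int 1 = (of_int (int k * (r + 1)) :: complex)" by simp
    hence "1 = int k * (r + 1)" by (simp only: of_int_eq_iff)
    hence "int k dvd 1" by (metis dvd_triv_left)
    thus False using k by simp
  qed
  have pos: "1 / of_nat k \<notin> (\<int>\<^sub>\<le>\<^sub>0 :: complex set)"
  proof
    assume "1 / of_nat k \<in> (\<int>\<^sub>\<le>\<^sub>0 :: complex set)"
    then obtain n :: int where "1 / of_nat k = (of_int n :: complex)" "n \<le> 0" by (auto elim!: nonpos_Ints_cases)
    hence "1 = real k * of_int n" using k by (metis Re_complex_of_real divide_eq_eq mult.commute of_nat_eq_0_iff of_real_1 of_real_divide of_real_of_int_eq of_real_of_nat_eq not_numeral_le_zero)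
    moreover have "real k * of_int n \<le> 0" using \<open>n \<le> 0\<close> by (intro mult_nonneg_nonpos) auto
    ultimately show False by simp
  qed
  have "((\<lambda>w. zeta (of_nat k * w) * (w - 1 / of_nat k) * Gamma w * zeta (w - of_int r) * exp (- w * of_real (ln x)))
    \<longlongrightarrow> 1 / of_nat k * Gamma (1 / of_nat k) * zeta (1 / of_nat k - of_int r) * exp (- (1 / of_nat k) * of_real (ln x))) (at (1 / of_nat k))"
    by (intro tendsto_mult zeta_pole_scale tendsto_zeta tendsto_intros tendsto_Gamma) (use nz pos k in auto)
  moreover have "exp (- (1 / of_nat k) * of_real (ln x)) = complex_of_real (x powr (- 1 / real k))"
    using x by (simp add: powr_def exp_of_real[symmetric])
  ultimately show "((\<lambda>w. mellin_integrand k r x w * (w - 1 / of_nat k)) \<longlongrightarrow>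
      1 / of_nat k * Gamma (1 / of_nat k) * zeta (1 / of_nat k - of_int r) * of_real (x powr (- 1 / real k))) (at (1 / of_nat k))"
    by (simp add: mellin_integrand_def mult_ac)
qed

lemma exp_int_ln: "exp (- of_int m * of_real (ln x)) = complex_of_real (x powi (- m))"
proof -
  have "x powi (- m) = exp (real_of_int (- m) * ln x)"
    using powr_real_of_int'[of x "- m"] x by (simp add: powr_def)
  thus ?thesis by (simp add: exp_of_real[symmetric])
qed

text \<open>For \<open>r \<ge> 0\<close> only zeta(s - r) has a pole here. For negative r the point
  is a pole of Gamma as well, but also a trivial zero of zeta(k s), whose linear coefficient enters
  the residue as k times the derivative of zeta.\<close>

lemma residue_mellin_integrand_1_plus_r:
  "residue (mellin_integrand k r x) (1 + of_int r) = residue_term k r x"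
proof (rule residue_mellin_integrand)
  have e: "exp (- (1 + of_int r) * of_real (ln x)) = complex_of_real (x powi (- (1 + r)))"
    using exp_int_ln[of "1 + r"] by simp
  show "((\<lambda>w. mellin_integrand k r x w * (w - (1 + of_int r))) \<longlongrightarrow> residue_term k r x) (at (1 + of_int r))"
  proof (cases "r \<ge> 0")
    case True
    have nz: "of_nat k * (1 + of_int r) \<noteq> (1 :: complex)"
    proof
      assume "of_nat k * (1 + of_int r) = (1 :: complex)"
      hence "of_int (int k * (1 + r)) = (of_int 1 :: complex)" by simp
      hence "int k * (1 + r) = 1" by (simp only: of_int_eq_iff)
      hence "int k dvd 1" by (metis dvd_triv_left)
      thus False using k by simp
    qed
    have pos: "1 + of_int r \<notin> (\<int>\<^sub>\<le>\<^sub>0 :: complex set)"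
      using True by (auto elim!: nonpos_Ints_cases simp: complex_eq_iff)
    have "((\<lambda>w. zeta (w - of_int r) * (w - (1 + of_int r)) * (Gamma w * zeta (of_nat k * w) * exp (- w * of_real (ln x))))
      \<longlongrightarrow> 1 * (Gamma (1 + of_int r) * zeta (of_nat k * (1 + of_int r)) * exp (- (1 + of_int r) * of_real (ln x)))) (at (1 + of_int r))"
      by (intro tendsto_mult zeta_pole_shift tendsto_zeta tendsto_intros tendsto_Gamma) (use nz pos in auto)
    moreover have "Gamma (1 + of_int r) = (fact (nat r) :: complex)"
      using Gamma_fact[of "nat r", where 'a = complex] True by simp
    ultimately show ?thesis using True unfolding e
      by (simp add: mellin_integrand_def residue_term_def mult_ac)
  next
    case False
    define n where "n = nat (- (1 + r))"
    have n: "1 + r = - int n" using False by (simp add: n_def)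
    \<comment> \<open>As r is even, 1 + r is odd and thus nonzero; hence n > 0 and -k n is a trivial
      zero of zeta.\<close>
    have "odd (int n)" using r n by presburger
    hence "odd n" by simp
    have n0: "n > 0" using \<open>odd n\<close> by (cases n) auto
    have p: "1 + of_int r = (- of_nat n :: complex)" using n by (metis of_int_1 of_int_add of_int_minus of_int_of_nat_eq)
    have kn: "of_int (int k * (1 + r)) = - (complex_of_nat (k * n))" unfolding n by simp
    have zero: "zeta (of_nat k * (- of_nat n)) = 0"
    proof -
      obtain q where q: "k = 2 * q" using k by (auto elim: evenE)
      have "q * n > 0" using q k n0 by auto
      from zeta_trivial_zero[OF this] show ?thesis by (simp add: q mult_ac)
    qed
    have "(zeta has_field_derivative deriv zeta (- of_nat (k * n))) (at (- of_nat (k * n)))"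
    proof (rule holomorphic_derivI[OF holomorphic_zeta])
      have "- of_nat (k * n) \<noteq> (1::complex)" by (auto simp: complex_eq_iff simp del: of_nat_mult)
      thus "- of_nat (k * n) \<in> UNIV - {1 :: complex}" by simp
    qed (auto intro: open_delete)
    hence "((\<lambda>w. zeta (of_nat k * w)) has_field_derivative deriv zeta (- of_nat (k * n)) * of_nat k) (at (- of_nat n))"
      by (intro DERIV_chain2[where f = zeta]) (auto intro!: derivative_eq_intros)
    \<comment> \<open>Since zeta vanishes at -k n, the difference quotient is zeta(k w) / (w + n):
      the zero is spent on one of the two poles.\<close>
    hence d: "((\<lambda>w. (zeta (of_nat k * w) - zeta (of_nat k * (- of_nat n))) / (w - - of_nat n)) \<longlongrightarrow> deriv zeta (- of_nat (k * n)) * of_nat k) (at (- of_nat n))"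
      by (simp only: has_field_derivative_iff)
    have g: "((\<lambda>w. Gamma w * (w + of_nat n)) \<longlongrightarrow> (-1) ^ n / fact n) (at (- of_nat n :: complex))" by (rule Gamma_residues)
    have z: "((\<lambda>w. zeta (w - of_int r) * (w - (- of_nat n))) \<longlongrightarrow> 1) (at (- of_nat n))"
      using zeta_pole_shift[of "of_int r"] unfolding p .
    have "((\<lambda>w. (Gamma w * (w + of_nat n)) * ((zeta (of_nat k * w) - zeta (of_nat k * (- of_nat n))) / (w - - of_nat n)) *
        (zeta (w - of_int r) * (w - (- of_nat n))) * exp (- w * of_real (ln x)))
      \<longlongrightarrow> ((-1) ^ n / fact n) * (deriv zeta (- of_nat (k * n)) * of_nat k) * 1 * exp (- (- of_nat n) * of_real (ln x))) (at (- of_nat n))"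
      by (intro tendsto_mult g d z tendsto_intros)
    moreover have "eventually (\<lambda>w. (Gamma w * (w + of_nat n)) * ((zeta (of_nat k * w) - zeta (of_nat k * (- of_nat n))) / (w - - of_nat n)) *
        (zeta (w - of_int r) * (w - (- of_nat n))) * exp (- w * of_real (ln x)) = mellin_integrand k r x w * (w - - of_nat n)) (at (- complex_of_nat n))"
      unfolding eventually_at_filter zero
      by (rule always_eventually) (auto simp: mellin_integrand_def add_eq_0_iff2 field_simps)
    ultimately have lim: "((\<lambda>w. mellin_integrand k r x w * (w - - of_nat n)) \<longlongrightarrow>
       ((-1) ^ n / fact n) * (deriv zeta (- of_nat (k * n)) * of_nat k) * 1 * exp (- (- of_nat n) * of_real (ln x))) (at (- of_nat n))"
      by (rule Lim_transform_eventually)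
    have sgn: "(-1) powi (1 + r) = ((-1) ^ n :: complex)"
      unfolding n by (simp add: power_int_minus power_inverse[symmetric])
    have "residue_term k r x = ((-1) ^ n / fact n) * (deriv zeta (- of_nat (k * n)) * of_nat k) * 1 * exp (- (- of_nat n) * of_real (ln x))"
      unfolding residue_term_def kn sgn using False e[unfolded p] by (simp add: n_def mult_ac)
    thus ?thesis using lim unfolding p by (simp only:)
  qed
qed

text \<open>Since k is even, -k m is a trivial zero of zeta and cancels the simple pole of Gamma;
  the second hypothesis keeps zeta(s - r) away from its own pole.\<close>

lemma residue_mellin_integrand_trivial_zero:
  assumes "m > 0" "- int m \<noteq> 1 + r"
  shows "residue (mellin_integrand k r x) (- of_nat m) = 0"
proof (rule residue_mellin_integrand)
  have nz: "- of_nat m - of_int r \<noteq> (1 :: complex)"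
  proof
    assume "- of_nat m - of_int r = (1 :: complex)"
    hence "of_int (- int m - r) = (of_int 1 :: complex)" by simp
    hence "- int m - r = 1" by (simp only: of_int_eq_iff)
    thus False using assms(2) by simp
  qed
  have nz': "of_nat k * (- of_nat m) \<noteq> (1 :: complex)"
  proof -
    have "real k * real m \<ge> 0" by simp
    thus ?thesis by (simp add: complex_eq_iff del: mult_nonneg_nonneg)
  qed
  have zero: "zeta (of_nat k * (- of_nat m)) = 0"
  proof -
    obtain q where q: "k = 2 * q" using k by (auto elim: evenE)
    have "q * m > 0" using q k assms by auto
    from zeta_trivial_zero[OF this] show ?thesis by (simp add: q mult_ac)
  qed
  have "((\<lambda>w. Gamma w * (w + of_nat m) * zeta (of_nat k * w) * zeta (w - of_int r) * exp (- w * of_real (ln x)))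
    \<longlongrightarrow> (-1) ^ m / fact m * zeta (of_nat k * (- of_nat m)) * zeta (- of_nat m - of_int r) * exp (- (- of_nat m) * of_real (ln x))) (at (- of_nat m))"
    by (intro tendsto_mult Gamma_residues tendsto_zeta tendsto_intros) (use nz nz' in auto)
  thus "((\<lambda>w. mellin_integrand k r x w * (w - - of_nat m)) \<longlongrightarrow> 0) (at (- of_nat m))"
    unfolding zero by (simp add: mellin_integrand_def mult_ac)
qed

end

section \<open>The main theorem\<close>

context
  fixes k :: nat and r :: int and x :: real
  assumes k: "k \<ge> 2" "even k" and r: "even r" and x: "x > 0"
begin

text \<open>The rate -pi / 2 of Gamma leaves room for three losses of pi / 8: one from Gamma itself
  and one from each zeta factor. For zeta(k s) the loss is pi / (8 k) before scaling.\<close>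

lemma strip_growth_mellin_integrand: "strip_growth (mellin_integrand k r x) a b (- (pi / 8))"
proof -
  have G: "strip_growth Gamma a b (pi / 8 - pi / 2)" by (rule strip_growth_Gamma) simp
  have "strip_growth zeta (real k * a + 0) (real k * b + 0) (pi / (8 * real k))"
    using k by (intro strip_growth_zeta) auto
  from strip_growth_affine[OF this] have Z1: "strip_growth (\<lambda>s. zeta (of_nat k * s)) a b (pi / 8)"
    using k by simp
  have "strip_growth zeta (a + - of_int r) (b + - of_int r) (pi / 8)" by (rule strip_growth_zeta) simp
  from strip_growth_shift[OF this] have Z2: "strip_growth (\<lambda>s. zeta (s - of_int r)) a b (pi / 8)" by simp
  have E: "strip_growth (\<lambda>s. exp (- s * of_real (ln x))) a b 0"
    using strip_growth_exp[of "ln x" 0] by simp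
  have "strip_growth (mellin_integrand k r x) a b (pi / 8 - pi / 2 + pi / 8 + pi / 8 + 0)"
    unfolding mellin_integrand_def[abs_def] by (rule strip_growth_mult[OF strip_growth_mult[OF strip_growth_mult[OF G Z1] Z2] E])
  thus ?thesis by simp
qed

text \<open>The abscissa |r| + 2 exceeds both 1 + r and 1 / k, so the product of the zeta factors is
  the absolutely convergent Dirichlet series of \<open>divisor_D\<close>, and the Cahen-Mellin
  integral evaluates each term.\<close>

lemma divisor_D_sums_line_integral:
  assumes c: "c = \<bar>real_of_int r\<bar> + 2"
  shows "(\<lambda>n. of_real (divisor_D k r (Suc n)) * (2 * of_real pi * of_real (exp (- (real (Suc n) * x))))) sums
     line_integral (mellin_integrand k r x) c"
proof -
  let ?e = "\<lambda>n s :: complex. exp (- s * of_real (ln (real (Suc n))))"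
  have cr: "c - real_of_int r > 1" using c by linarith
  have "2 * 1 \<le> real k * c" using k c by (intro mult_mono) auto
  hence ck: "real k * c > 1" by linarith
  define H where "H = (\<lambda>s. Gamma s * exp (- s * complex_of_real (ln x)))"
  have intH: "integrable lborel (\<lambda>t. H (Complex c t))"
  proof (rule integrable_line)
    show "continuous_on {s. Re s = c} H"
      unfolding H_def using c by (intro continuous_intros) (auto elim!: nonpos_Ints_cases)
    have "strip_growth (\<lambda>s. Gamma s * exp (- s * (of_real (ln x) + \<i> * of_real 0))) c c (pi / 4 - pi / 2 + \<bar>0\<bar>)"
      by (intro strip_growth_mult strip_growth_exp strip_growth_Gamma) auto
    thus "strip_growth H c c (pi / 4 - pi / 2)" by (simp add: H_def)
  qed simp
  have "(\<lambda>n. of_real (divisor_D k r (Suc n)) * line_integral (\<lambda>s. H s * ?e n s) c) sums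
     line_integral (\<lambda>s. H s * (\<Sum>n. of_real (divisor_D k r (Suc n)) * ?e n s)) c"
    unfolding divisor_D_eq
    by (rule line_integral_sums[OF intH power_divisor_sum_nonneg power_divisor_sum_summable]) (use k cr ck in auto)
  also have "line_integral (\<lambda>s. H s * (\<Sum>n. of_real (divisor_D k r (Suc n)) * ?e n s)) c = line_integral (mellin_integrand k r x) c"
  proof (rule line_integral_cong)
    fix s assume s: "Re s = c"
    have "(\<lambda>n. of_real (power_divisor_sum k r 0 (Suc n)) * ?e n s) sums
       (zeta (s - of_int r) * zeta (of_nat k * s - of_nat 0))"
      by (rule power_divisor_sum_sums) (use k cr ck s in auto)
    thus "H s * (\<Sum>n. of_real (divisor_D k r (Suc n)) * ?e n s) = mellin_integrand k r x s"
      unfolding divisor_D_eq sums_iff by (simp add: H_def mellin_integrand_def mult_ac)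
  qed
  also have "(\<lambda>n. of_real (divisor_D k r (Suc n)) * line_integral (\<lambda>s. H s * ?e n s) c) =
     (\<lambda>n. of_real (divisor_D k r (Suc n)) * (2 * of_real pi * of_real (exp (- (real (Suc n) * x)))))"
  proof
    fix n
    have "H s * ?e n s = Gamma s * exp (- s * of_real (ln (real (Suc n) * x)))" for s
    proof -
      have "- s * complex_of_real (ln (real (Suc n) * x)) = - s * of_real (ln x) + - s * of_real (ln (real (Suc n)))"
        using x by (subst ln_mult) (auto simp: algebra_simps)
      thus ?thesis by (simp only: H_def exp_add mult.assoc)
    qed
    hence "line_integral (\<lambda>s. H s * ?e n s) c = 2 * of_real pi * of_real (exp (- (real (Suc n) * x)))"
      using Cahen_Mellin[of c "real (Suc n) * x"] x c by simp
    thus "of_real (divisor_D k r (Suc n)) * line_integral (\<lambda>s. H s * ?e n s) c =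
        of_real (divisor_D k r (Suc n)) * (2 * of_real pi * of_real (exp (- (real (Suc n) * x))))" by (simp only:)
  qed
  finally show ?thesis .
qed

lemma mellin_integrand_shift:
  assumes c: "c = \<bar>real_of_int r\<bar> + 2" and c': "c' = real_of_int (min 0 r) - 1/2"
  shows "line_integral (mellin_integrand k r x) c - line_integral (mellin_integrand k r x) c' = 2 * of_real pi *
     (- 1 / 2 * zeta (- of_int r)
      + 1 / of_nat k * Gamma (1 / of_nat k) * zeta (1 / of_nat k - of_int r) * of_real (x powr (- 1 / real k))
      + residue_term k r x)"
proof -
  define F where "F = mellin_integrand k r x"
  \<comment> \<open>\<open>P\<close> contains every singularity to the right of the new line,
    \<open>T\<close> the points whose residue can be nonzero. For negative r the point 1 + r already
    lies in the integer range, which the union absorbs.\<close>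
  define P :: "complex set" where "P = of_int ` {min 0 r..0} \<union> {1 / of_nat k, 1 + of_int r}"
  define T :: "complex set" where "T = {0, 1 / of_nat k, 1 + of_int r}"
  have shift: "line_integral F c - line_integral F c' = 2 * of_real pi * (\<Sum>p\<in>P. residue F p)"
  \<comment> \<open>The quarter keeps the next integer, half a unit to the left of
    \<open>c'\<close>, outside the larger half-plane.\<close>
  proof (rule line_integral_shift[where a' = "c' - 1/4"])
    have "s \<in> P" if "s \<in> \<int>\<^sub>\<le>\<^sub>0" "c' - 1/4 < Re s" for s
    proof -
      obtain m :: int where m: "s = of_int m" "m \<le> 0" using \<open>s \<in> \<int>\<^sub>\<le>\<^sub>0\<close> by (auto elim!: nonpos_Ints_cases)
      hence "real_of_int (min 0 r) - 3/4 < real_of_int m" using that c' by simp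
      hence "min 0 r \<le> m" by linarith
      thus ?thesis using m unfolding P_def by auto
    qed
    hence "{s. c' - 1/4 < Re s} - P \<subseteq> - (\<int>\<^sub>\<le>\<^sub>0 \<union> {1 / of_nat k, 1 + of_int r})"
      by (auto simp: P_def)
    thus "F holomorphic_on {s. c' - 1/4 < Re s} - P"
      unfolding F_def by (rule holomorphic_on_subset[OF holomorphic_mellin_integrand[OF k r x]])
    have k1: "0 < 1 / real k" "1 / real k < 1" using k by auto
    have Re_k: "Re (1 / of_nat k) = 1 / real k"
      using Re_complex_of_real[of "1 / real k"] by simp
    show "c' < Re p \<and> Re p < c" if p: "p \<in> P" for p
    proof -
      consider m where "p = of_int m" "min 0 r \<le> m" "m \<le> 0" | "p = 1 / of_nat k" | "p = 1 + of_int r"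
        using p by (auto simp: P_def)
      thus ?thesis
      proof cases
        case 1
        hence "real_of_int (min 0 r) \<le> real_of_int m" "real_of_int m \<le> 0" by (simp_all only: of_int_le_iff of_int_le_0_iff)
        thus ?thesis using 1 unfolding c c' by simp
      next
        case 2
        have "real_of_int (min 0 r) \<le> 0" "\<bar>real_of_int r\<bar> \<ge> 0" by auto
        thus ?thesis unfolding c c' 2 Re_k using k1 by linarith
      next
        case 3
        thus ?thesis unfolding c c' by (auto simp: min_def)
      qed
    qed
    show "strip_growth F c' c (- (pi / 8))" unfolding F_def by (rule strip_growth_mellin_integrand)
    show "c' < c" unfolding c c' by (auto simp: min_def)
  qed (auto simp: P_def)
  have "(\<Sum>p\<in>P. residue F p) = (\<Sum>p\<in>T. residue F p)"
  proof (rule sum.mono_neutral_right)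
    show "finite P" by (simp add: P_def)
    show "T \<subseteq> P" by (auto simp: T_def P_def)
    show "\<forall>p\<in>P - T. residue F p = 0"
    proof
      fix p assume p: "p \<in> P - T"
      then obtain m where m: "p = of_int m" "m \<le> 0" "m \<noteq> 0" "p \<noteq> 1 + of_int r" by (auto simp: P_def T_def)
      define n where "n = nat (- m)"
      have n: "m = - int n" "n > 0" using m by (auto simp: n_def)
      have "p = - of_nat n" using m n by simp
      moreover have "- int n \<noteq> 1 + r"
      proof
        assume "- int n = 1 + r"
        hence "(of_int m :: complex) = of_int (1 + r)" using n by simp
        thus False using m by simp
      qed
      ultimately show "residue F p = 0"
        using residue_mellin_integrand_trivial_zero[OF k r x n(2)] by (simp add: F_def)
    qed
  qed
  also have "(\<Sum>p\<in>T. residue F p) = residue F 0 + residue F (1 / of_nat k) + residue F (1 + of_int r)"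
  proof -
    \<comment> \<open>The parity of r separates the points 0 and 1 + r, and \<open>k \<ge> 2\<close>
      separates 1 / k from the integers; coinciding points would merge residues.\<close>
    have "1 + r \<noteq> 0" using r by presburger
    hence "(of_int (1 + r) :: complex) \<noteq> 0" by (simp only: of_int_eq_0_iff not_False_eq_True)
    hence "(0::complex) \<noteq> 1 + of_int r" by simp
    moreover have "(0::complex) \<noteq> 1 / of_nat k" using k by simp
    moreover have "1 / of_nat k \<noteq> (1 + of_int r :: complex)"
    proof
      assume "1 / of_nat k = (1 + of_int r :: complex)"
      hence "1 = of_nat k * (1 + of_int r :: complex)" using k by (simp add: field_simps)
      hence "of_int 1 = (of_int (int k * (1 + r)) :: complex)" by simp
      hence "1 = int k * (1 + r)" by (simp only: of_int_eq_iff)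
      hence "int k dvd 1" by (metis dvd_triv_left)
      thus False using k by simp
    qed
    ultimately show ?thesis by (simp add: T_def add.assoc)
  qed
  finally show ?thesis
    using shift residue_mellin_integrand_0[OF k r x] residue_mellin_integrand_inverse_k[OF k r x]
      residue_mellin_integrand_1_plus_r[OF k r x]
    by (simp only: F_def)
qed

text \<open>At abscissa c the Dirichlet series of \<open>divisor_S\<close> converges absolutely, and
  the line lies to the right of all poles of the Gamma factors. Integrability is recorded because
  the finite sum over j will have to be exchanged with the integral.\<close>

lemma divisor_S_sums_line_integral:
  assumes j: "j \<in> j_indices k" and c: "c > 1" "c > 1 - real_of_int r"
  defines "H \<equiv> \<lambda>w. (\<Prod>b\<leftarrow>G_params k r. Gamma (b + w)) * exp (- w * (of_real (ln (X_modulus k x 1)) + \<i> * of_real (X_arg j)))"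
  shows "(\<lambda>n. of_real (divisor_S k r (Suc n)) * (2 * of_real pi * meijer_G (G_params k r) (X_modulus k x (Suc n)) (X_arg j))) sums
     line_integral (\<lambda>w. H w * (zeta (w + of_int r) * zeta (of_nat k * w - of_nat (k - 1)))) c" (is ?sums)
    and "integrable lborel (\<lambda>t. H (Complex c t) * (zeta (Complex c t + of_int r) * zeta (of_nat k * Complex c t - of_nat (k - 1))))" (is ?integrable)
proof -
  let ?Z = "\<lambda>w. zeta (w + of_int r) * zeta (of_nat k * w - of_nat (k - 1))"
  let ?e = "\<lambda>n w :: complex. exp (- w * of_real (ln (real (Suc n))))"
  let ?G = "\<lambda>n. meijer_G (G_params k r) (X_modulus k x (Suc n)) (X_arg j)"
  define bs where "bs = G_params k r"
  have len: "length bs = k" using k by (simp add: bs_def G_params_def)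
  hence ne: "bs \<noteq> []" using k by auto
  have real: "b \<in> \<real>" if "b \<in> set bs" for b
    using that by (auto simp: bs_def G_params_def)
  have "\<bar>real_of_int j\<bar> \<le> real k - 1" using j by (auto simp: j_indices_def)
  hence "pi / 2 * \<bar>real_of_int j\<bar> < pi / 2 * real k" by (intro mult_strict_left_mono) auto
  hence \<theta>: "\<bar>X_arg j\<bar> < real (length bs) * pi / 2" by (simp add: X_arg_def len abs_mult mult_ac)
  have gt: "- Re b < c" if "b \<in> set bs" for b
  proof -
    consider "b = of_int r" | m where "b = - (of_nat m / of_nat k)" "m < k"
      using \<open>b \<in> set bs\<close> by (auto simp: bs_def G_params_def)
    thus ?thesis
    proof cases
      case 2
      have "Re b = - (real m / real k)" using Re_complex_of_real[of "- (real m / real k)"] 2 by simp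
      moreover have "real m / real k < 1" using 2 by simp
      ultimately show ?thesis using c by simp
    qed (use c in auto)
  qed
  obtain \<kappa> where \<kappa>: "\<kappa> < 0" "\<And>a b. strip_growth H a b \<kappa>"
    unfolding H_def bs_def[symmetric] by (rule strip_growth_Gamma_prod[OF real ne \<theta>]) blast+
  define a where "a = Max ((\<lambda>b. - Re b) ` set bs)"
  have a: "a < c" "\<And>b. b \<in> set bs \<Longrightarrow> - Re b \<le> a" using gt ne by (auto simp: a_def)
  have "H holomorphic_on {s. a < Re s}"
    unfolding H_def bs_def[symmetric] by (intro holomorphic_intros holomorphic_Gamma_prod a)
  hence cont: "continuous_on {s. Re s = c} H"
    by (rule continuous_on_subset[OF holomorphic_on_imp_continuous_on]) (use a in auto)
  have intH: "integrable lborel (\<lambda>t. H (Complex c t))"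
    by (rule integrable_line[OF cont \<kappa>(2,1)])
  have e: "real k * c - real (k - 1) > 1"
  proof -
    have "real k * (c - 1) > 0" using k c by simp
    thus ?thesis using k by (simp add: of_nat_diff algebra_simps)
  qed
  have Re_e: "Re (of_nat k * s - of_nat (k - 1)) > 1" if "Re s = c" for s using e that by simp
  have "(\<lambda>n. of_real (divisor_S k r (Suc n)) * line_integral (\<lambda>w. H w * ?e n w) c) sums
     line_integral (\<lambda>w. H w * (\<Sum>n. of_real (divisor_S k r (Suc n)) * ?e n w)) c"
    unfolding divisor_S_eq
    by (rule line_integral_sums[OF intH power_divisor_sum_nonneg power_divisor_sum_summable]) (use k c e in auto)
  also have "line_integral (\<lambda>w. H w * (\<Sum>n. of_real (divisor_S k r (Suc n)) * ?e n w)) c =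
     line_integral (\<lambda>w. H w * ?Z w) c"
  proof (rule line_integral_cong)
    fix w assume w: "Re w = c"
    have "(\<lambda>n. of_real (power_divisor_sum k (- r) (k - 1) (Suc n)) * ?e n w) sums
       (zeta (w - of_int (- r)) * zeta (of_nat k * w - of_nat (k - 1)))"
      by (rule power_divisor_sum_sums[OF _ _ Re_e]) (use k c w in auto)
    thus "H w * (\<Sum>n. of_real (divisor_S k r (Suc n)) * ?e n w) = H w * ?Z w"
      unfolding divisor_S_eq sums_iff by simp
  qed
  also have "(\<lambda>n. of_real (divisor_S k r (Suc n)) * line_integral (\<lambda>w. H w * ?e n w) c) =
     (\<lambda>n. of_real (divisor_S k r (Suc n)) * (2 * of_real pi * ?G n))"
  proof
    fix n
    have "X_modulus k x 1 > 0" using x k by (simp add: X_modulus_def)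
    moreover have "X_modulus k x (Suc n) = X_modulus k x 1 * real (Suc n)" by (simp add: X_modulus_def)
    ultimately have lnX: "ln (X_modulus k x (Suc n)) = ln (X_modulus k x 1) + ln (real (Suc n))"
      by (simp add: ln_mult)
    have "H w * ?e n w =
       (\<Prod>b\<leftarrow>bs. Gamma (b + w)) * exp (- w * (of_real (ln (X_modulus k x (Suc n))) + \<i> * of_real (X_arg j)))" for w
    proof -
      have "- w * (of_real (ln (X_modulus k x (Suc n))) + \<i> * of_real (X_arg j)) =
         - w * (of_real (ln (X_modulus k x 1)) + \<i> * of_real (X_arg j)) + - w * of_real (ln (real (Suc n)))"
        unfolding lnX of_real_add by (simp only: distrib_left add_ac)
      thus ?thesis by (simp only: H_def bs_def exp_add mult.assoc)
    qed
    hence "line_integral (\<lambda>w. H w * ?e n w) c = 2 * of_real pi * meijer_G bs (X_modulus k x (Suc n)) (X_arg j)"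
      using meijer_G_line_integral[OF real ne \<theta> gt] by simp
    thus "of_real (divisor_S k r (Suc n)) * line_integral (\<lambda>w. H w * ?e n w) c =
       of_real (divisor_S k r (Suc n)) * (2 * of_real pi * ?G n)"
      unfolding bs_def by (simp only:)
  qed
  finally show ?sums .
  show ?integrable
  \<comment> \<open>Each zeta factor may use up a third of the decay \<open>\<kappa>\<close> of
    \<open>H\<close>, so that a third remains.\<close>
  proof (rule integrable_line[where f = "\<lambda>w. H w * ?Z w" and \<kappa> = "\<kappa> / 3"])
    have "continuous_on {s. Re s = c} (\<lambda>w. zeta (w + of_int r))"
      by (rule holomorphic_on_imp_continuous_on, rule holomorphic_zeta_compose) (use c in \<open>auto intro!: holomorphic_intros simp: complex_eq_iff\<close>)
    moreover have "continuous_on {s. Re s = c} (\<lambda>w. zeta (of_nat k * w - of_nat (k - 1)))"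
      by (rule holomorphic_on_imp_continuous_on, rule holomorphic_zeta_compose) (use Re_e in \<open>fastforce intro!: holomorphic_intros\<close>)+
    ultimately show "continuous_on {s. Re s = c} (\<lambda>w. H w * ?Z w)"
      by (intro continuous_intros cont)
    have "strip_growth zeta (c + of_int r) (c + of_int r) (- \<kappa> / 3)"
      using \<kappa>(1) by (intro strip_growth_zeta) auto
    from strip_growth_shift[OF this] have Z1: "strip_growth (\<lambda>w. zeta (w + of_int r)) c c (- \<kappa> / 3)" by simp
    have "strip_growth zeta (real k * c + - real (k - 1)) (real k * c + - real (k - 1)) (- \<kappa> / (3 * real k))"
      using \<kappa>(1) k by (intro strip_growth_zeta divide_pos_pos) auto
    from strip_growth_affine[OF this] have Z2: "strip_growth (\<lambda>w. zeta (of_nat k * w - of_nat (k - 1))) c c (- \<kappa> / 3)"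
      using k by (simp add: algebra_simps)
    have "strip_growth (\<lambda>w. H w * ?Z w) c c (\<kappa> + (- \<kappa> / 3 + - \<kappa> / 3))"
      by (rule strip_growth_mult[OF \<kappa>(2) strip_growth_mult[OF Z1 Z2]])
    thus "strip_growth (\<lambda>w. H w * ?Z w) c c (\<kappa> / 3)" by simp
    show "\<kappa> / 3 < 0" using \<kappa>(1) by simp
  qed
qed

text \<open>The substitution w = 1 - s sends the line to abscissa 1 - c' > 1, right of all poles of
  the Meijer integrands. The half-integral c' keeps 1 - w off the integers, as the pointwise
  identity of the integrands requires.\<close>

lemma mellin_integrand_left_line:
  assumes c': "c' = real_of_int (min 0 r) - 1/2"
  shows "line_integral (mellin_integrand k r x) c' = 2 * of_real pi *
     ((-1) powi ((int k + r - 2) div 2)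
          * of_real ((2 * pi) powr ((real k + 1 - 2 * of_int r) / 2))
          / of_real (x * real k powr ((2 * real k - 1) / 2))
        * (\<Sum>j\<in>j_indices k. \<Sum>n. of_real (divisor_S k r (Suc n)) *
             meijer_G (G_params k r) (X_modulus k x (Suc n)) (X_arg j)))" (is ?integral)
    and "j \<in> j_indices k \<Longrightarrow> summable (\<lambda>n. of_real (divisor_S k r (Suc n)) *
             meijer_G (G_params k r) (X_modulus k x (Suc n)) (X_arg j))"
proof -
  define c where "c = 1 - c'"
  have c: "c > 1" "c > 1 - real_of_int r" by (auto simp: c_def c' min_def)
  define H where "H = (\<lambda>j w. (\<Prod>b\<leftarrow>G_params k r. Gamma (b + w)) * exp (- w * (of_real (ln (X_modulus k x 1)) + \<i> * of_real (X_arg j))))"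
  define Z where "Z = (\<lambda>w. zeta (w + of_int r) * zeta (of_nat k * w - of_nat (k - 1)))"
  define K :: complex where "K = (-1) powi ((int k + r - 2) div 2)
          * of_real ((2 * pi) powr ((real k + 1 - 2 * of_int r) / 2))
          / of_real (x * real k powr ((2 * real k - 1) / 2))"
  define f where "f = (\<lambda>j n. of_real (divisor_S k r (Suc n)) * meijer_G (G_params k r) (X_modulus k x (Suc n)) (X_arg j))"
  have sums: "f j sums (line_integral (\<lambda>w. H j w * Z w) c / (2 * of_real pi))" if "j \<in> j_indices k" for j
    using sums_divide[OF divisor_S_sums_line_integral(1)[OF that c], of "2 * of_real pi"]
    by (simp add: f_def H_def Z_def)
  show "summable (\<lambda>n. of_real (divisor_S k r (Suc n)) * meijer_G (G_params k r) (X_modulus k x (Suc n)) (X_arg j))"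
    if "j \<in> j_indices k" using sums[OF that] by (simp add: sums_iff f_def)
  have "line_integral (mellin_integrand k r x) c' = line_integral (\<lambda>w. mellin_integrand k r x (1 - w)) c"
    unfolding line_integral_reflect by (simp add: c_def)
  also have "\<dots> = line_integral (\<lambda>w. K * (\<Sum>j\<in>j_indices k. H j w * Z w)) c"
  proof (rule line_integral_cong)
    fix w assume w: "Re w = c"
    have "1 - w \<notin> \<int>"
    proof
      assume "1 - w \<in> \<int>"
      then obtain m :: int where "1 - w = of_int m" by (rule Ints_cases)
      hence "c' = real_of_int m" using w by (simp add: c_def complex_eq_iff)
      hence "real_of_int (2 * min 0 r - 1 - 2 * m) = 0" using c' by simp
      hence "2 * min 0 r - 1 - 2 * m = 0" by (simp only: of_int_eq_0_iff)
      thus False by presburger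
    qed
    hence "mellin_integrand k r x (1 - w) = K * (\<Sum>j\<in>j_indices k. H j w) * Z w"
      using zeta_product_functional[OF k r x, of "1 - w"] c w
      by (simp add: mellin_integrand_def K_def H_def Z_def)
    thus "mellin_integrand k r x (1 - w) = K * (\<Sum>j\<in>j_indices k. H j w * Z w)"
      by (simp only: sum_distrib_right mult.assoc)
  qed
  also have "\<dots> = K * (\<Sum>j\<in>j_indices k. line_integral (\<lambda>w. H j w * Z w) c)"
    unfolding line_integral_def integral_mult_right_zero
    using divisor_S_sums_line_integral(2)[OF _ c]
    by (subst Bochner_Integration.integral_sum) (auto simp: H_def Z_def)
  also have "\<dots> = 2 * of_real pi * (K * (\<Sum>j\<in>j_indices k. \<Sum>n. f j n))"
  proof -
    have "line_integral (\<lambda>w. H j w * Z w) c = 2 * of_real pi * (\<Sum>n. f j n)" if "j \<in> j_indices k" for j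
      using sums[OF that] by (simp add: sums_iff)
    hence "(\<Sum>j\<in>j_indices k. line_integral (\<lambda>w. H j w * Z w) c) = 2 * of_real pi * (\<Sum>j\<in>j_indices k. \<Sum>n. f j n)"
      by (simp add: sum_distrib_left)
    thus ?thesis by (simp only: mult.left_commute)
  qed
  finally show ?integral unfolding K_def f_def .
qed

end

text \<open>Summability is asserted along with the identity, since \<open>suminf\<close> is only
  meaningful for convergent series. The division by 2 in the exponent of -1 is exact because k and r
  are even.\<close>

theorem theorem3p1:
  fixes k :: nat and r :: int and x :: real
  assumes "k \<ge> 2" and "even k" and "even r" and "x > 0"
  shows "summable (\<lambda>n. divisor_D k r (Suc n) * exp (- real (Suc n) * x)) \<and>
    (\<forall>j\<in>j_indices k. summable (\<lambda>n. of_real (divisor_S k r (Suc n)) *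
       meijer_G (G_params k r) (X_modulus k x (Suc n)) (X_arg j))) \<and>
    of_real (\<Sum>n. divisor_D k r (Suc n) * exp (- real (Suc n) * x)) =
      - 1 / 2 * zeta (- of_int r)
      + 1 / of_nat k * Gamma (1 / of_nat k) * zeta (1 / of_nat k - of_int r)
          * of_real (x powr (- 1 / real k))
      + residue_term k r x
      + (-1) powi ((int k + r - 2) div 2)
          * of_real ((2 * pi) powr ((real k + 1 - 2 * of_int r) / 2))
          / of_real (x * real k powr ((2 * real k - 1) / 2))
        * (\<Sum>j\<in>j_indices k. \<Sum>n. of_real (divisor_S k r (Suc n)) *
             meijer_G (G_params k r) (X_modulus k x (Suc n)) (X_arg j))"
proof -
  define c c' where "c = \<bar>real_of_int r\<bar> + 2" and "c' = real_of_int (min 0 r) - 1/2"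
  define I where "I = line_integral (mellin_integrand k r x)"
  have "(\<lambda>n. of_real (divisor_D k r (Suc n)) * (2 * of_real pi * of_real (exp (- (real (Suc n) * x))))) sums I c"
    unfolding I_def by (rule divisor_D_sums_line_integral[OF assms c_def])
  from sums_divide[OF this, of "2 * of_real pi"]
  have D: "(\<lambda>n. complex_of_real (divisor_D k r (Suc n) * exp (- real (Suc n) * x))) sums (I c / (2 * of_real pi))"
    by (simp add: algebra_simps)
  hence summable: "summable (\<lambda>n. divisor_D k r (Suc n) * exp (- real (Suc n) * x))"
    by (simp only: sums_iff summable_complex_of_real)
  define A where "A = - 1 / 2 * zeta (- of_int r)
      + 1 / of_nat k * Gamma (1 / of_nat k) * zeta (1 / of_nat k - of_int r)
          * of_real (x powr (- 1 / real k))
      + residue_term k r x"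
  define B :: complex where "B = (-1) powi ((int k + r - 2) div 2)
          * of_real ((2 * pi) powr ((real k + 1 - 2 * of_int r) / 2))
          / of_real (x * real k powr ((2 * real k - 1) / 2))
        * (\<Sum>j\<in>j_indices k. \<Sum>n. of_real (divisor_S k r (Suc n)) *
             meijer_G (G_params k r) (X_modulus k x (Suc n)) (X_arg j))"
  have shift: "I c - I c' = 2 * of_real pi * A"
    unfolding I_def A_def by (rule mellin_integrand_shift[OF assms c_def c'_def])
  have left: "I c' = 2 * of_real pi * B"
    unfolding I_def B_def by (rule mellin_integrand_left_line(1)[OF assms c'_def])
  have "of_real (\<Sum>n. divisor_D k r (Suc n) * exp (- real (Suc n) * x)) = I c / (2 * of_real pi)"
    using sums_unique2[OF sums_of_real[OF summable_sums[OF summable]] D] .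
  also have "\<dots> = (I c - I c') / (2 * of_real pi) + I c' / (2 * of_real pi)"
    by (simp add: diff_divide_distrib)
  also have "\<dots> = A + B"
    unfolding shift unfolding left by simp
  finally show ?thesis
    unfolding A_def B_def using summable mellin_integrand_left_line(2)[OF assms c'_def] by (intro conjI ballI)
qed

end
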